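(* Let $Q$ be a smooth $n$-dimensional manifold, let $M=Q\times\mathbb{R}$, let $H:T^*Q\times\mathbb{R}\to\mathbb{R}$ be smooth, and let $\tilde H=H\circ\mu+p_t$ on $T^*(Q\times\mathbb{R})$, where $\mu:T^*(Q\times\mathbb{R})\to T^*Q\times\mathbb{R}$ is the projection forgetting $p_t$. Let $R_d^Q$ and $R_d^{\mathbb R}$ be discretization maps on $Q$ and $\mathbb{R}$, let $R_d^M=(R_d^{\mathbb R},R_d^Q)$ be the product discretization map on $M$, and let $h$ be the time step. Let $\Psi_h:T^*(Q\times\mathbb{R})\to T^*(Q\times\mathbb{R})$ be the map implicitly defined by the Lagrangian submanifold $(\Phi^{-1}\circ\widehat R_d^M\circ\mathcal{I}_{TM})(h\,d\tilde H(T^*M))\subset T^*M\times T^*M$ (i.e. whose graph is this submanifold), and let $\phi_h:T^*Q\times\mathbb{R}\to T^*Q\times\mathbb{R}$ be the map onto which it projects, $\mu\circ\Psi_h=\phi_h\circ\mu$. Then: 1. $\phi_h$ preserves the volume form $\mathrm{vol}_0=\omega_0^{\,n}\wedge\eta$, i.e. $\phi_h^*\mathrm{vol}_0=\mathrm{vol}_0$; 2. $\phi_h$ preserves the Poisson bracket $\{\cdot,\cdot\}_0$ on $T^*Q\times\mathbb{R}$, i.e. $\{f\circ\phi_h,g\circ\phi_h\}_0=\{f,g\}_0\circ\phi_h$ for all $f,g\in C^\infty(T^*Q\times\mathbb{R})$; 3. for each fixed $t\in\mathbb{R}$, the induced map $\phi_{t,h}:T^*Q\to T^*Q$, $\phi_{t,h}=\mathrm{pr}_{T^*Q}\circ\phi_h\circ\iota_t$,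 is a symplectomorphism of $(T^*Q,\omega_Q)$.
   Context: All objects are smooth. $\omega_N$ denotes the canonical symplectic form of $T^*N$, in canonical coordinates $\omega_N=dx^i\wedge dp_i$. On $T^*(Q\times\mathbb{R})$ use coordinates $(q^A,t,p_A,p_t)$; $\mu(q,t,p,p_t)=(q,p,t)$. On $T^*Q\times\mathbb{R}$: $\omega_0=\mathrm{pr}_{T^*Q}^*\omega_Q$ and $\eta=dt$ (pulled back from $\mathbb{R}$), where $\mathrm{pr}_{T^*Q}:T^*Q\times\mathbb{R}\to T^*Q$ is the projection. The Poisson bracket $\{\cdot,\cdot\}_0$ is $\{f,g\}_0=\omega_0(X_f,X_g)$, where $X_f$ is defined by $i_{X_f}\omega_0=df-\frac{\partial f}{\partial t}\eta$, $i_{X_f}\eta=0$; it corresponds to the bivector $\frac{\partial}{\partial q^A}\wedge\frac{\partial}{\partial p_A}$. $\iota_t:T^*Q\to T^*Q\times\mathbb{R}$ is the inclusion of $T^*Q$ as the slice at time $t$. Discretization map on a manifold $N$: a map $R_d=(R^1,R^2):U\subset TN\to N\times N$, with $U$ an open neighborhood of the zero section, such that (1) $R_d(x,0)=(x,x)$ for all $x\in N$, and (2) $T_{0_x}R^2_x-T_{0_x}R^1_x:T_{0_x}T_xN\simeq T_xN\to T_xN$ is the identity for every $x\in N$, where $R^a_x$ is the restriction of $R^a$ to $T_xN$. Such a map is a local diffeomorphism near the zero section; following the usual abuse of notation, one writes $R_d:TN\to N\times N$ without displaying the domain $U$ on which it is a diffeomorphism onto its image. The product discretization map on $M=Q\times\mathbb{R}$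 is $$R_d^M(q,t,\dot q,\dot t)=\bigl(((R_d^Q)^1(q,\dot q),(R_d^{\mathbb R})^1(t,\dot t)),\;((R_d^Q)^2(q,\dot q),(R_d^{\mathbb R})^2(t,\dot t))\bigr).$$ Cotangent lift: for a diffeomorphism $F:N_1\to N_2$, $\widehat F:T^*N_1\to T^*N_2$ sends $\alpha\in T_x^*N_1$ to $\alpha\circ(T_xF)^{-1}\in T^*_{F(x)}N_2$. Thus $\widehat R_d^M:T^*TM\to T^*(M\times M)$. $\mathcal{I}_{TM}:T^*T^*M\to T^*TM$ is given locally by $\mathcal{I}_{TM}(x,p,\mu_x,\mu_p)=(x,\mu_p,-\mu_x,p)$. $\Phi:T^*M\times T^*M\to T^*(M\times M)$ is $\Phi(x_0,p_0;x_1,p_1)=(x_0,x_1,-p_0,p_1)$; $T^*M\times T^*M$ carries the symplectic form $pr_2^*\omega_M-pr_1^*\omega_M$. $h\,d\tilde H(T^*M)\subset T^*T^*M$ is the image of the 1-form $h\,d\tilde H$ on $T^*M$.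
   Formalization: Claim 1 is proved assuming the discrete times satisfy t1 = t0 + h (false for arbitrary discretization maps on R); in claim 3, φ_{t,h} is smooth and preserves ω_Q always, but is shown to be a diffeomorphism only when Ψ_h is one (it can otherwise fail to be onto). *)

theory Defs
  imports "HOL-Analysis.Analysis" "HOL-Combinatorics.Permutations"
begin

section \<open>Smooth functions on open subsets of Euclidean spaces\<close>

primrec Ck_on :: "nat \<Rightarrow> 'a::euclidean_space set \<Rightarrow> ('a \<Rightarrow> 'b::real_normed_vector) \<Rightarrow> bool" where
  "Ck_on 0 S f \<longleftrightarrow> continuous_on S f"
| "Ck_on (Suc k) S f \<longleftrightarrow> (\<forall>x\<in>S. f differentiable (at x)) \<and>
     (\<forall>v. Ck_on k S (\<lambda>x. frechet_derivative f (at x) v))"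

definition smooth_on :: "'a::euclidean_space set \<Rightarrow> ('a \<Rightarrow> 'b::real_normed_vector) \<Rightarrow> bool" where
  "smooth_on S f \<longleftrightarrow> open S \<and> (\<forall>k. Ck_on k S f)"


section \<open>Smooth manifolds\<close>

text \<open>
  A manifold structure on a type \<open>'m\<close>, modelled on the Euclidean space \<open>'a\<close>, is an atlas (not
  necessarily maximal) together with a choice of a preferred chart around every point. The
  topology is the one generated by the atlas. The preferred charts only serve to name tangent
  vectors and covectors: an element of \<open>T\<^sub>xM\<close> is represented by its components in the preferred
  chart at \<open>x\<close>, and an element of \<open>T\<^sup>*\<^sub>xM\<close> by its components in the dual basis, the pairing being the
  inner product of \<open>'a\<close>. Hence \<open>TM\<close> and \<open>T\<^sup>*M\<close> have the same underlying type \<open>'m \<times> 'a\<close>; they differ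
  in their charts, which account for the change from the preferred chart to a given one.
\<close>

type_synonym ('m, 'a) chart = "'m set \<times> ('m \<Rightarrow> 'a)"

abbreviation chart_inv :: "('m, 'a) chart \<Rightarrow> 'a \<Rightarrow> 'm" where
  "chart_inv c \<equiv> inv_into (fst c) (snd c)"

record ('m, 'a) mfd =
  atlas :: "('m, 'a) chart set"
  chart_at :: "'m \<Rightarrow> ('m, 'a) chart"

definition mopen :: "('m, 'a::euclidean_space) mfd \<Rightarrow> 'm set \<Rightarrow> bool" where
  "mopen M U \<longleftrightarrow> (\<forall>c\<in>atlas M. open (snd c ` (U \<inter> fst c)))"

definition mtopology :: "('m, 'a::euclidean_space) mfd \<Rightarrow> 'm topology" where
  "mtopology M = topology (mopen M)"

definition smooth_manifold :: "('m, 'a::euclidean_space) mfd \<Rightarrow> bool" where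
  "smooth_manifold M \<longleftrightarrow>
     (\<forall>x. chart_at M x \<in> atlas M \<and> x \<in> fst (chart_at M x)) \<and>
     (\<forall>c\<in>atlas M. inj_on (snd c) (fst c) \<and> open (snd c ` fst c)) \<and>
     (\<forall>c\<in>atlas M. \<forall>d\<in>atlas M. smooth_on (snd c ` (fst c \<inter> fst d)) (snd d \<circ> chart_inv c)) \<and>
     Hausdorff_space (mtopology M) \<and> second_countable (mtopology M)"

lemma openin_mtopology:
  assumes "smooth_manifold M"
  shows "openin (mtopology M) = mopen M"
proof -
  have inj: "inj_on (snd c) (fst c)" if "c \<in> atlas M" for c
    using assms that by (auto simp: smooth_manifold_def)
  have "istopology (mopen M)"
    unfolding istopology_def
  proof (intro conjI allI impI)
    fix S T assume "mopen M S" "mopen M T"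
    moreover have "snd c ` (S \<inter> T \<inter> fst c) = snd c ` (S \<inter> fst c) \<inter> snd c ` (T \<inter> fst c)"
      if "c \<in> atlas M" for c
      using inj_on_image_Int[OF inj[OF that], of "S \<inter> fst c" "T \<inter> fst c"]
      by (simp add: Int_ac)
    ultimately show "mopen M (S \<inter> T)"
      by (simp add: mopen_def open_Int)
  next
    fix K assume "\<forall>S\<in>K. mopen M S"
    moreover have "snd c ` (\<Union>K \<inter> fst c) = (\<Union>S\<in>K. snd c ` (S \<inter> fst c))" for c :: "('a, 'b) chart"
      by auto
    ultimately show "mopen M (\<Union>K)"
      by (auto simp: mopen_def)
  qed
  then show ?thesis
    by (simp add: mtopology_def topology_inverse')
qed

definition euclid :: "('a, 'a::euclidean_space) mfd" where
  "euclid = \<lparr>atlas = {(UNIV, id)}, chart_at = (\<lambda>_. (UNIV, id))\<rparr>"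

definition prod_chart :: "('m, 'a) chart \<Rightarrow> ('n, 'b) chart \<Rightarrow> ('m \<times> 'n, 'a \<times> 'b) chart" where
  "prod_chart c d = (fst c \<times> fst d, map_prod (snd c) (snd d))"

definition prod_mfd ::
  "('m, 'a::euclidean_space) mfd \<Rightarrow> ('n, 'b::euclidean_space) mfd \<Rightarrow> ('m \<times> 'n, 'a \<times> 'b) mfd"
  (infixr \<open>\<times>\<^sub>M\<close> 80) where
  "M \<times>\<^sub>M N = \<lparr>atlas = (\<lambda>(c, d). prod_chart c d) ` (atlas M \<times> atlas N),
     chart_at = (\<lambda>(x, y). prod_chart (chart_at M x) (chart_at N y))\<rparr>"

text \<open>Openness of the domains of the local representatives encodes continuity.\<close>

definition smooth_map_on ::
  "('m, 'a::euclidean_space) mfd \<Rightarrow> ('n, 'b::euclidean_space) mfd \<Rightarrow> 'm set \<Rightarrow> ('m \<Rightarrow> 'n) \<Rightarrow> bool" where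
  "smooth_map_on M N U f \<longleftrightarrow> mopen M U \<and>
     (\<forall>c\<in>atlas M. \<forall>d\<in>atlas N.
        smooth_on (snd c ` (fst c \<inter> U \<inter> f -` fst d)) (snd d \<circ> f \<circ> chart_inv c))"

abbreviation smooth_map ::
  "('m, 'a::euclidean_space) mfd \<Rightarrow> ('n, 'b::euclidean_space) mfd \<Rightarrow> ('m \<Rightarrow> 'n) \<Rightarrow> bool" where
  "smooth_map M N \<equiv> smooth_map_on M N UNIV"

definition diffeo_onto_image ::
  "('m, 'a::euclidean_space) mfd \<Rightarrow> ('n, 'b::euclidean_space) mfd \<Rightarrow> 'm set \<Rightarrow> ('m \<Rightarrow> 'n) \<Rightarrow> bool" where
  "diffeo_onto_image M N U f \<longleftrightarrow>
     smooth_map_on M N U f \<and> inj_on f U \<and> smooth_map_on N M (f ` U) (inv_into U f)"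

definition diffeomorphism ::
  "('m, 'a::euclidean_space) mfd \<Rightarrow> ('n, 'b::euclidean_space) mfd \<Rightarrow> ('m \<Rightarrow> 'n) \<Rightarrow> bool" where
  "diffeomorphism M N f \<longleftrightarrow> bij f \<and> smooth_map M N f \<and> smooth_map N M (inv f)"


section \<open>Tangent and cotangent bundles\<close>

text \<open>The tangent map \<open>T\<^sub>xf : T\<^sub>xM \<rightarrow> T\<^bsub>f x\<^esub>N\<close>.\<close>

definition mderiv ::
  "('m, 'a::euclidean_space) mfd \<Rightarrow> ('n, 'b::euclidean_space) mfd \<Rightarrow> ('m \<Rightarrow> 'n) \<Rightarrow> 'm \<Rightarrow> 'a \<Rightarrow> 'b" where
  "mderiv M N f x =
     frechet_derivative (snd (chart_at N (f x)) \<circ> f \<circ> chart_inv (chart_at M x))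
       (at (snd (chart_at M x) x))"

definition tangent_chart ::
  "('m, 'a::euclidean_space) mfd \<Rightarrow> ('m, 'a) chart \<Rightarrow> ('m \<times> 'a, 'a \<times> 'a) chart" where
  "tangent_chart M c = (fst c \<times> UNIV, \<lambda>(x, v).
     (snd c x,
      frechet_derivative (snd c \<circ> chart_inv (chart_at M x)) (at (snd (chart_at M x) x)) v))"

definition tangent :: "('m, 'a::euclidean_space) mfd \<Rightarrow> ('m \<times> 'a, 'a \<times> 'a) mfd" where
  "tangent M = \<lparr>atlas = tangent_chart M ` atlas M,
     chart_at = (\<lambda>(x, v). tangent_chart M (chart_at M x))\<rparr>"

text \<open>Components of covectors transform by the transpose of the inverse Jacobian.\<close>

definition cotangent_chart ::
  "('m, 'a::euclidean_space) mfd \<Rightarrow> ('m, 'a) chart \<Rightarrow> ('m \<times> 'a, 'a \<times> 'a) chart" where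
  "cotangent_chart M c = (fst c \<times> UNIV, \<lambda>(x, p).
     (snd c x,
      adjoint (frechet_derivative (snd (chart_at M x) \<circ> chart_inv c) (at (snd c x))) p))"

definition cotangent :: "('m, 'a::euclidean_space) mfd \<Rightarrow> ('m \<times> 'a, 'a \<times> 'a) mfd" where
  "cotangent M = \<lparr>atlas = cotangent_chart M ` atlas M,
     chart_at = (\<lambda>(x, p). cotangent_chart M (chart_at M x))\<rparr>"

text \<open>The components of a linear functional: \<open>covector l \<bullet> v = l v\<close>.\<close>

definition covector :: "('a::euclidean_space \<Rightarrow> real) \<Rightarrow> 'a" where
  "covector l = (\<Sum>b\<in>Basis. l b *\<^sub>R b)"

definition scaled_differential ::
  "('m, 'a::euclidean_space) mfd \<Rightarrow> real \<Rightarrow> ('m \<Rightarrow> real) \<Rightarrow> 'm \<Rightarrow> 'm \<times> 'a" where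
  "scaled_differential M h f x = (x, h *\<^sub>R covector (mderiv M euclid f x))"

text \<open>The cotangent lift \<open>\<alpha> \<mapsto> \<alpha> \<circ> (T\<^sub>xF)\<^sup>-\<^sup>1\<close>.\<close>

definition cotangent_lift ::
  "('m, 'a::euclidean_space) mfd \<Rightarrow> ('n, 'b::euclidean_space) mfd \<Rightarrow> ('m \<Rightarrow> 'n)
     \<Rightarrow> 'm \<times> 'a \<Rightarrow> 'n \<times> 'b" where
  "cotangent_lift M N F = (\<lambda>(x, \<alpha>). (F x, covector (\<lambda>w. \<alpha> \<bullet> inv (mderiv M N F x) w)))"

text \<open>
  The preferred charts of \<open>T\<^sup>*M\<close> at \<open>(x, p)\<close>, of \<open>TM\<close> at \<open>(x, \<mu>\<^sub>p)\<close> and of \<open>M \<times> M\<close> are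
  those induced by the preferred charts of \<open>M\<close>, so the usual coordinate formulas apply verbatim
  to the next two maps.
\<close>

definition I_tangent :: "('m \<times> 'a::euclidean_space) \<times> ('a \<times> 'a) \<Rightarrow> ('m \<times> 'a) \<times> ('a \<times> 'a)" where
  "I_tangent = (\<lambda>((x, p), (\<mu>x, \<mu>p)). ((x, \<mu>p), (- \<mu>x, p)))"

definition Phi :: "('m \<times> 'a::euclidean_space) \<times> ('m \<times> 'a) \<Rightarrow> ('m \<times> 'm) \<times> ('a \<times> 'a)" where
  "Phi = (\<lambda>((x0, p0), (x1, p1)). ((x0, x1), (- p0, p1)))"


section \<open>Differential forms\<close>

text \<open>
  A differential \<open>k\<close>-form takes a point and a list of \<open>k\<close> tangent vectors at that point; its values
  on lists of other lengths are irrelevant.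
\<close>

type_synonym ('m, 'a) form = "'m \<Rightarrow> 'a list \<Rightarrow> real"

definition pullback ::
  "('m, 'a::euclidean_space) mfd \<Rightarrow> ('n, 'b::euclidean_space) mfd \<Rightarrow> ('m \<Rightarrow> 'n)
     \<Rightarrow> ('n, 'b) form \<Rightarrow> ('m, 'a) form" where
  "pullback M N f \<omega> x vs = \<omega> (f x) (map (mderiv M N f x) vs)"

definition form_eq :: "nat \<Rightarrow> ('m, 'a) form \<Rightarrow> ('m, 'a) form \<Rightarrow> bool" where
  "form_eq k \<alpha> \<beta> \<longleftrightarrow> (\<forall>x vs. length vs = k \<longrightarrow> \<alpha> x vs = \<beta> x vs)"

text \<open>The wedge product of a \<open>k\<close>-form and an \<open>l\<close>-form.\<close>

definition wedge :: "nat \<Rightarrow> nat \<Rightarrow> ('m, 'a) form \<Rightarrow> ('m, 'a) form \<Rightarrow> ('m, 'a) form" where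
  "wedge k l \<alpha> \<beta> x vs =
     (\<Sum>\<sigma> | \<sigma> permutes {..<k + l}. of_int (sign \<sigma>) *
        (\<alpha> x (take k (permute_list \<sigma> vs)) * \<beta> x (drop k (permute_list \<sigma> vs))))
     / (fact k * fact l)"

text \<open>The \<open>m\<close>-th exterior power of a 2-form.\<close>

primrec wedge_power :: "nat \<Rightarrow> ('m, 'a) form \<Rightarrow> ('m, 'a) form" where
  "wedge_power 0 \<omega> = (\<lambda>x vs. 1)"
| "wedge_power (Suc m) \<omega> = wedge 2 (2 * m) \<omega> (wedge_power m \<omega>)"

text \<open>The form \<open>dx\<^sup>i \<and> dp\<^sub>i\<close> on a cotangent bundle.\<close>

definition omega_can :: "('m \<times> 'a::euclidean_space, 'a \<times> 'a) form" where
  "omega_can z vs = fst (vs ! 0) \<bullet> snd (vs ! 1) - fst (vs ! 1) \<bullet> snd (vs ! 0)"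

definition symplectic_map ::
  "('m, 'a::euclidean_space) mfd \<Rightarrow> ('m \<times> 'a \<Rightarrow> 'm \<times> 'a) \<Rightarrow> bool" where
  "symplectic_map M f \<longleftrightarrow> smooth_map (cotangent M) (cotangent M) f \<and>
     form_eq 2 (pullback (cotangent M) (cotangent M) f omega_can) omega_can"

definition symplectomorphism ::
  "('m, 'a::euclidean_space) mfd \<Rightarrow> ('m \<times> 'a \<Rightarrow> 'm \<times> 'a) \<Rightarrow> bool" where
  "symplectomorphism M f \<longleftrightarrow>
     diffeomorphism (cotangent M) (cotangent M) f \<and> symplectic_map M f"


section \<open>The cosymplectic structure of \<open>T\<^sup>*Q \<times> \<real>\<close>\<close>

abbreviation ext_phase :: "('q, 'a::euclidean_space) mfd \<Rightarrow> (('q \<times> 'a) \<times> real, ('a \<times> 'a) \<times> real) mfd" where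
  "ext_phase Q \<equiv> cotangent Q \<times>\<^sub>M euclid"

definition omega0 :: "('q, 'a::euclidean_space) mfd \<Rightarrow> (('q \<times> 'a) \<times> real, ('a \<times> 'a) \<times> real) form" where
  "omega0 Q = pullback (ext_phase Q) (cotangent Q) fst omega_can"

definition eta :: "('q, 'a::euclidean_space) mfd \<Rightarrow> (('q \<times> 'a) \<times> real, ('a \<times> 'a) \<times> real) form" where
  "eta Q = pullback (ext_phase Q) euclid snd (\<lambda>t vs. vs ! 0)"

definition vol0 :: "('q, 'a::euclidean_space) mfd \<Rightarrow> (('q \<times> 'a) \<times> real, ('a \<times> 'a) \<times> real) form" where
  "vol0 Q = wedge (2 * DIM('a)) 1 (wedge_power DIM('a) (omega0 Q)) (eta Q)"

definition hamiltonian_vf ::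
  "('q, 'a::euclidean_space) mfd \<Rightarrow> (('q \<times> 'a) \<times> real \<Rightarrow> real)
     \<Rightarrow> ('q \<times> 'a) \<times> real \<Rightarrow> ('a \<times> 'a) \<times> real" where
  "hamiltonian_vf Q f x =
     (THE X. (\<forall>v. omega0 Q x [X, v] =
                  mderiv (ext_phase Q) euclid f x v
                  - deriv (\<lambda>t. f (fst x, t)) (snd x) * eta Q x [v]) \<and>
             eta Q x [X] = 0)"

definition poisson0 ::
  "('q, 'a::euclidean_space) mfd \<Rightarrow> (('q \<times> 'a) \<times> real \<Rightarrow> real) \<Rightarrow> (('q \<times> 'a) \<times> real \<Rightarrow> real)
     \<Rightarrow> ('q \<times> 'a) \<times> real \<Rightarrow> real" where
  "poisson0 Q f g x = omega0 Q x [hamiltonian_vf Q f x, hamiltonian_vf Q g x]"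


section \<open>Discretization maps\<close>

definition discretization_map ::
  "('m, 'a::euclidean_space) mfd \<Rightarrow> ('m \<times> 'a) set \<Rightarrow> ('m \<times> 'a \<Rightarrow> 'm \<times> 'm) \<Rightarrow> bool" where
  "discretization_map N U R \<longleftrightarrow>
     smooth_map_on (tangent N) (N \<times>\<^sub>M N) U R \<and>
     (\<forall>x. (x, 0) \<in> U \<and> R (x, 0) = (x, x)) \<and>
     (\<forall>x v. mderiv euclid N (\<lambda>w. snd (R (x, w))) 0 v
            - mderiv euclid N (\<lambda>w. fst (R (x, w))) 0 v = v)"

definition prod_discretization ::
  "('q \<times> 'a \<Rightarrow> 'q \<times> 'q) \<Rightarrow> (real \<times> real \<Rightarrow> real \<times> real)
     \<Rightarrow> ('q \<times> real) \<times> ('a \<times> real) \<Rightarrow> ('q \<times> real) \<times> ('q \<times> real)" where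
  "prod_discretization RQ RR = (\<lambda>((q, t), (vq, vt)).
     ((fst (RQ (q, vq)), fst (RR (t, vt))), (snd (RQ (q, vq)), snd (RR (t, vt)))))"

definition prod_domain ::
  "('q \<times> 'a) set \<Rightarrow> (real \<times> real) set \<Rightarrow> (('q \<times> real) \<times> ('a \<times> real)) set" where
  "prod_domain UQ UR = {((q, t), (vq, vt)). (q, vq) \<in> UQ \<and> (t, vt) \<in> UR}"

text \<open>
  The two times \<open>(t\<^sub>0, t\<^sub>1) = R(t, h)\<close> produced by a discretization map of the time axis
  for the velocity \<open>h\<close> satisfy \<open>t\<^sub>1 = t\<^sub>0 + h\<close>.
\<close>

definition is_time_step :: "(real \<times> real) set \<Rightarrow> (real \<times> real \<Rightarrow> real \<times> real) \<Rightarrow> real \<Rightarrow> bool" where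
  "is_time_step UR RR h \<longleftrightarrow> (\<forall>t. (t, h) \<in> UR \<longrightarrow> snd (RR (t, h)) = fst (RR (t, h)) + h)"

definition forget_pt :: "('q \<times> real) \<times> ('a \<times> real) \<Rightarrow> ('q \<times> 'a) \<times> real" where
  "forget_pt = (\<lambda>((q, t), (p, pt)). ((q, p), t))"

definition H_tilde :: "(('q \<times> 'a) \<times> real \<Rightarrow> real) \<Rightarrow> ('q \<times> real) \<times> ('a \<times> real) \<Rightarrow> real" where
  "H_tilde H z = H (forget_pt z) + snd (snd z)"

text \<open>
  The set \<open>(\<Phi>\<^sup>-\<^sup>1 \<circ> L \<circ> I)(h df(T\<^sup>*M))\<close>, where \<open>L\<close> is the cotangent lift of \<open>R\<close>, which is
  defined on the covectors of \<open>TM\<close> based at points of the domain \<open>U\<close> of \<open>R\<close>.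
\<close>

definition discrete_relation ::
  "('m, 'a::euclidean_space) mfd \<Rightarrow> ('m \<times> 'a) set \<Rightarrow> ('m \<times> 'a \<Rightarrow> 'm \<times> 'm) \<Rightarrow> real
     \<Rightarrow> ('m \<times> 'a \<Rightarrow> real) \<Rightarrow> (('m \<times> 'a) \<times> ('m \<times> 'a)) set" where
  "discrete_relation M U R h f =
     Phi -` (cotangent_lift (tangent M) (M \<times>\<^sub>M M) R `
       {\<xi> \<in> I_tangent ` range (scaled_differential (cotangent M) h f). fst \<xi> \<in> U})"

end

theory Submission
  imports Defs
begin

text \<open>
  Let \<open>z\<^sub>0 = (x\<^sub>0, p\<^sub>0)\<close> and \<open>\<Psi> z\<^sub>0 = (x\<^sub>1, p\<^sub>1)\<close>, let \<open>\<zeta> = (x, p)\<close> be the point of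
  \<open>T\<^sup>*M\<close> that generates this pair, and let \<open>v = h \<partial>f/\<partial>p (\<zeta>)\<close>, so that \<open>R (x, v) = (x\<^sub>0, x\<^sub>1)\<close>.
  As a function of \<open>z\<^sub>0\<close>, the quantity \<open>p \<bullet> v - h f \<zeta>\<close> has the differential
  \<open>p\<^sub>1 dx\<^sub>1 - p\<^sub>0 dx\<^sub>0\<close>; symmetry of its second derivative says that \<open>\<Psi>\<close> is symplectic.

  For \<open>M = Q \<times> \<real>\<close> the map \<open>\<Psi>\<close> preserves the fibres of \<open>forget_pt\<close>, and these are tangent to
  the Hamiltonian vector field of \<open>t\<close>. Hence the new time has a differential that is a nonzero
  multiple of \<open>dt\<close>, and the restriction of \<open>d\<phi>\<close> to the time slices is symplectic. This gives the
  Poisson and the slice statements. If the multiple is 1, then \<open>\<phi>\<close> acts on \<open>\<omega>\<^sub>0\<close> and \<open>\<eta>\<close>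
  like a shear along a spatial vector, which does not change the volume form.
\<close>

section \<open>Symmetry of second derivatives\<close>

text \<open>The data \<open>(x, v)\<close> and \<open>p\<close> are not given as functions of
  \<open>z\<^sub>0\<close>. The diffeomorphism \<open>R\<close> recovers \<open>(x, v)\<close>
  smoothly from \<open>(x\<^sub>0, x\<^sub>1)\<close>, and \<open>p\<close> is then read off from
  the generating equations in directions along the fibres of the tangent bundle, which involve only
  the derivative of \<open>R\<close>. Hamiltonians that are degenerate in the momenta are thus
  covered, as they must be: \<open>H_tilde\<close> is affine in \<open>p\<^sub>t\<close>. Components
  refer to preferred charts, and these may jump from point to point. Smoothness is therefore argued
  in one fixed chart, and the full generating equation is used only at the one point where that
  chart is the preferred one. The multiple of \<open>dt\<close> is controlled by
  \<open>\<partial>H_tilde/\<partial>p\<^sub>t = 1\<close>: it forces the time velocity to be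
  \<open>h\<close>, so that old and new time are the two components of some
  \<open>RR (t, h)\<close>. A time slice need not be connected, so the new time need not be a
  function of \<open>t\<close> alone. The inverse of a slice map is for this reason obtained by
  following curves.\<close>

lemma second_difference_estimate:
  fixes g :: "'a::real_normed_vector \<Rightarrow> real"
  assumes S: "open S" "y0 \<in> S"
    and g: "\<And>y. y \<in> S \<Longrightarrow> (g has_derivative g' y) (at y)"
    and B: "((\<lambda>y. g' y u) has_derivative B) (at y0)"
    and e: "e > 0"
  shows "\<exists>d>0. \<forall>s. 0 < s \<and> s < d \<longrightarrow>
    \<bar>g (y0 + s *\<^sub>R u + s *\<^sub>R w) - g (y0 + s *\<^sub>R u) - g (y0 + s *\<^sub>R w) + g y0 - s\<^sup>2 * B w\<bar> \<le> e * s\<^sup>2"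
proof -
  \<comment> \<open>The two error terms below have lengths at most \<open>s (|u| + |w|)\<close> and
    \<open>s |u|\<close>, so together at most \<open>s * K\<close>. The summand 1 keeps
    \<open>K\<close> positive when \<open>u = w = 0\<close>.\<close>
  define K where "K = 2 * (norm u + norm w) + 1"
  have K: "K > 0" by (simp add: K_def add_nonneg_pos)
  interpret B: bounded_linear B using B by (rule has_derivative_bounded_linear)
  obtain r where r: "r > 0" "ball y0 r \<subseteq> S" using S open_contains_ball by blast
  obtain d1 where d1: "d1 > 0" and
    B': "\<And>y. norm (y - y0) < d1 \<Longrightarrow> norm (g' y u - g' y0 u - B (y - y0)) \<le> (e / K) * norm (y - y0)"
    using B e K unfolding has_derivative_at_alt by (meson divide_pos_pos)
  define d where "d = min r d1 / K"
  have "d > 0" using r d1 K by (simp add: d_def)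
  moreover have "\<bar>g (y0 + s *\<^sub>R u + s *\<^sub>R w) - g (y0 + s *\<^sub>R u) - g (y0 + s *\<^sub>R w) + g y0 - s\<^sup>2 * B w\<bar> \<le> e * s\<^sup>2"
    if s: "0 < s" "s < d" for s
  proof -
    have sK: "s * K < min r d1" using s K by (simp add: d_def pos_less_divide_eq)
    have nb: "norm (a *\<^sub>R u + b *\<^sub>R w) < min r d1" if "0 \<le> a" "a \<le> s" "0 \<le> b" "b \<le> s" for a b
    proof -
      have "norm (a *\<^sub>R u + b *\<^sub>R w) \<le> a * norm u + b * norm w"
        using that by (metis abs_of_nonneg norm_scaleR norm_triangle_ineq)
      also have "\<dots> \<le> s * norm u + s * norm w"
        using that by (intro add_mono mult_right_mono) auto
      also have "\<dots> \<le> s * K" using s unfolding K_def distrib_left[symmetric]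
        by (intro mult_left_mono) (auto simp: add_nonneg_nonneg)
      finally show ?thesis using sK by linarith
    qed
    have inS: "y0 + a *\<^sub>R u + b *\<^sub>R w \<in> S" if "0 \<le> a" "a \<le> s" "0 \<le> b" "b \<le> s" for a b
    proof -
      have "y0 + a *\<^sub>R u + b *\<^sub>R w \<in> ball y0 r"
        using nb[OF that] by (subst mem_ball, subst dist_commute) (simp add: dist_norm add.assoc)
      then show ?thesis using r by blast
    qed
    \<comment> \<open>The second difference is \<open>k s - k 0\<close>. The mean value theorem
      turns it into \<open>s\<close> times a difference of two values of \<open>g' _ u\<close>, each
      of which is compared with its linear approximation at \<open>y0\<close>.\<close>
    define k where "k a = g (y0 + a *\<^sub>R u + s *\<^sub>R w) - g (y0 + a *\<^sub>R u)" for a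
    have gd: "((\<lambda>a. g (y0 + a *\<^sub>R u + b *\<^sub>R w)) has_derivative
                (\<lambda>h. g' (y0 + a *\<^sub>R u + b *\<^sub>R w) (h *\<^sub>R u))) (at a)"
      if "0 \<le> a" "a \<le> s" "0 \<le> b" "b \<le> s" for a b
      by (rule has_derivative_compose[where g=g and f="\<lambda>a. y0 + a *\<^sub>R u + b *\<^sub>R w"])
         (auto intro!: derivative_eq_intros g[OF inS[OF that]])
    have lin: "linear (g' y)" if "y \<in> S" for y
      using g[OF that] has_derivative_linear by blast
    have "(k has_real_derivative (g' (y0 + a *\<^sub>R u + s *\<^sub>R w) u - g' (y0 + a *\<^sub>R u) u)) (at a)"
      if "0 \<le> a" "a \<le> s" for a
    proof -
      have "(k has_derivative (\<lambda>h. g' (y0 + a *\<^sub>R u + s *\<^sub>R w) (h *\<^sub>R u) - g' (y0 + a *\<^sub>R u) (h *\<^sub>R u))) (at a)"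
        unfolding k_def using gd[of a s] gd[of a 0] that s by (intro has_derivative_diff) auto
      moreover have "(\<lambda>h. g' (y0 + a *\<^sub>R u + s *\<^sub>R w) (h *\<^sub>R u) - g' (y0 + a *\<^sub>R u) (h *\<^sub>R u))
        = (*) (g' (y0 + a *\<^sub>R u + s *\<^sub>R w) u - g' (y0 + a *\<^sub>R u) u)"
        using lin[OF inS[of a s]] lin[of "y0 + a *\<^sub>R u"] inS[of a 0] that s
        by (auto simp: linear_cmul algebra_simps)
      ultimately show ?thesis by (simp add: has_field_derivative_def)
    qed
    then have "\<exists>z. 0 < z \<and> z < s \<and> k s - k 0 = (s - 0) * (g' (y0 + z *\<^sub>R u + s *\<^sub>R w) u - g' (y0 + z *\<^sub>R u) u)"
      using s by (intro MVT2) auto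
    then obtain z where z: "0 < z" "z < s"
      and kz: "k s - k 0 = s * (g' (y0 + z *\<^sub>R u + s *\<^sub>R w) u - g' (y0 + z *\<^sub>R u) u)" by auto
    have 1: "norm (g' (y0 + z *\<^sub>R u + b *\<^sub>R w) u - g' y0 u - B (z *\<^sub>R u + b *\<^sub>R w)) \<le> (e / K) * norm (z *\<^sub>R u + b *\<^sub>R w)"
      if "0 \<le> b" "b \<le> s" for b
      using B'[of "y0 + z *\<^sub>R u + b *\<^sub>R w"] nb[of z b] z that by (simp add: add.assoc)
    have n1: "norm (z *\<^sub>R u + s *\<^sub>R w) \<le> s * (norm u + norm w)"
    proof -
      have "norm (z *\<^sub>R u + s *\<^sub>R w) \<le> z * norm u + s * norm w"
        using z s by (metis abs_of_pos norm_scaleR norm_triangle_ineq)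
      also have "\<dots> \<le> s * norm u + s * norm w" using z by (intro add_mono mult_right_mono) auto
      finally show ?thesis by (simp add: algebra_simps)
    qed
    have n2: "norm (z *\<^sub>R u) \<le> s * norm u"
      using z by (simp add: mult_right_mono)
    have "norm (z *\<^sub>R u + s *\<^sub>R w) + norm (z *\<^sub>R u) \<le> s * K"
    proof -
      have "s * K = s * (norm u + norm w) + s * norm u + (s * norm w + s)"
        by (simp add: K_def algebra_simps)
      moreover have "0 \<le> s * norm w + s" using s by simp
      ultimately show ?thesis using n1 n2 by linarith
    qed
    then have n3: "(e / K) * norm (z *\<^sub>R u + s *\<^sub>R w) + (e / K) * norm (z *\<^sub>R u) \<le> (e / K) * (s * K)"
      unfolding distrib_left[symmetric] using e K by (intro mult_left_mono) auto
    have Bd: "B (z *\<^sub>R u + s *\<^sub>R w) - B (z *\<^sub>R u) = s * B w"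
      by (simp add: B.add B.scaleR)
    have "\<bar>(g' (y0 + z *\<^sub>R u + s *\<^sub>R w) u - g' (y0 + z *\<^sub>R u) u) - s * B w\<bar> \<le> (e / K) * (s * K)"
      using 1[of s] 1[of 0] n3 Bd s by (simp add: abs_le_iff)
    also have "\<dots> = e * s" using K by simp
    finally have "\<bar>(g' (y0 + z *\<^sub>R u + s *\<^sub>R w) u - g' (y0 + z *\<^sub>R u) u) - s * B w\<bar> \<le> e * s" .
    then have "s * \<bar>(g' (y0 + z *\<^sub>R u + s *\<^sub>R w) u - g' (y0 + z *\<^sub>R u) u) - s * B w\<bar> \<le> s * (e * s)"
      using s by (intro mult_left_mono) auto
    moreover have "s * \<bar>(g' (y0 + z *\<^sub>R u + s *\<^sub>R w) u - g' (y0 + z *\<^sub>R u) u) - s * B w\<bar>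
      = \<bar>(k s - k 0) - s\<^sup>2 * B w\<bar>"
    proof -
      have "s * \<bar>X\<bar> = \<bar>s * X\<bar>" for X using s by (simp add: abs_mult)
      then show ?thesis unfolding kz by (simp only: right_diff_distrib power2_eq_square mult.assoc)
    qed
    ultimately show ?thesis unfolding k_def by (simp add: power2_eq_square algebra_simps)
  qed
  ultimately show ?thesis by blast
qed

text \<open>The second difference does not change when \<open>u\<close> and \<open>w\<close> are
  swapped, while divided by \<open>s^2\<close> it tends to both values of \<open>B\<close>.
  Differentiability of the first derivative at the single point \<open>y0\<close> suffices for
  this.\<close>

lemma symmetric_second_derivative:
  fixes g :: "'a::real_normed_vector \<Rightarrow> real"
  assumes S: "open S" "y0 \<in> S"
    and g: "\<And>y. y \<in> S \<Longrightarrow> (g has_derivative g' y) (at y)"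
    and B: "\<And>u. ((\<lambda>y. g' y u) has_derivative B u) (at y0)"
  shows "B u w = B w u"
proof (rule ccontr)
  assume "B u w \<noteq> B w u"
  \<comment> \<open>Two estimates with error \<open>e * s^2\<close> each bound the discrepancy by
    \<open>2 * e\<close>, which is half of it.\<close>
  define e where "e = \<bar>B u w - B w u\<bar> / 4"
  have e: "e > 0" using \<open>B u w \<noteq> B w u\<close> by (simp add: e_def)
  obtain d1 where d1: "d1 > 0" "\<And>s. 0 < s \<Longrightarrow> s < d1 \<Longrightarrow>
    \<bar>g (y0 + s *\<^sub>R u + s *\<^sub>R w) - g (y0 + s *\<^sub>R u) - g (y0 + s *\<^sub>R w) + g y0 - s\<^sup>2 * B u w\<bar> \<le> e * s\<^sup>2"
    using second_difference_estimate[OF S g B e, of u w] by blast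
  obtain d2 where d2: "d2 > 0" "\<And>s. 0 < s \<Longrightarrow> s < d2 \<Longrightarrow>
    \<bar>g (y0 + s *\<^sub>R w + s *\<^sub>R u) - g (y0 + s *\<^sub>R w) - g (y0 + s *\<^sub>R u) + g y0 - s\<^sup>2 * B w u\<bar> \<le> e * s\<^sup>2"
    using second_difference_estimate[OF S g B e, of w u] by blast
  define s where "s = min d1 d2 / 2"
  have s: "0 < s" "s < d1" "s < d2" using d1 d2 by (auto simp: s_def)
  have swap: "y0 + s *\<^sub>R w + s *\<^sub>R u = y0 + s *\<^sub>R u + s *\<^sub>R w" by simp
  have "\<bar>s\<^sup>2 * B u w - s\<^sup>2 * B w u\<bar> \<le> 2 * (e * s\<^sup>2)"
    using d1(2)[OF s(1,2)] d2(2)[OF s(1,3)] unfolding swap by linarith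
  also have "\<dots> = s\<^sup>2 * (2 * e)" by simp
  finally have "s\<^sup>2 * \<bar>B u w - B w u\<bar> \<le> s\<^sup>2 * (2 * e)"
    by (metis abs_mult abs_power2 right_diff_distrib)
  then have "\<bar>B u w - B w u\<bar> \<le> 2 * e" using s by simp
  then show False using e by (simp add: e_def)
qed

section \<open>Calculus of smooth functions\<close>

lemma differentiable_transform_open:
  assumes "f differentiable (at x)" "open S" "x \<in> S" "\<And>y. y \<in> S \<Longrightarrow> f y = g y"
  shows "g differentiable (at x)"
proof -
  obtain f' where "(f has_derivative f') (at x)" using assms(1) by (auto simp: differentiable_def)
  then have "(g has_derivative f') (at x)"
    by (rule has_derivative_transform_within_open) (use assms in auto)
  then show ?thesis by (auto simp: differentiable_def)
qed

text \<open>Openness of \<open>S\<close> lets equality pass to the derivatives, so that the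
  induction on the order goes through.\<close>

lemma Ck_on_cong:
  assumes "open S" "\<And>x. x \<in> S \<Longrightarrow> f x = g x"
  shows "Ck_on k S f = Ck_on k S g"
  using assms(2)
proof (induction k arbitrary: f g)
  case 0
  then show ?case by (simp cong: continuous_on_cong)
next
  case (Suc k)
  have d: "f differentiable (at x) \<longleftrightarrow> g differentiable (at x)" if "x \<in> S" for x
    by (rule iffI; erule differentiable_transform_open[OF _ assms(1) that]) (simp_all add: Suc.prems)
  have "Ck_on k S (\<lambda>x. frechet_derivative f (at x) v) = Ck_on k S (\<lambda>x. frechet_derivative g (at x) v)"
    if "\<forall>x\<in>S. f differentiable (at x)" for v
  proof (rule Suc.IH)
    fix x assume "x \<in> S"
    then have "frechet_derivative f (at x) = frechet_derivative g (at x)"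
      using that Suc.prems by (intro frechet_derivative_transform_within_open[OF _ assms(1)]) auto
    then show "frechet_derivative f (at x) v = frechet_derivative g (at x) v" by simp
  qed
  then show ?case using d by auto
qed

lemma Ck_on_subset: "Ck_on k S f \<Longrightarrow> T \<subseteq> S \<Longrightarrow> Ck_on k T f"
  by (induction k arbitrary: f) (auto intro: continuous_on_subset)

lemma Ck_on_differentiable: "Ck_on (Suc k) S f \<Longrightarrow> x \<in> S \<Longrightarrow> f differentiable (at x)"
  by simp

lemma Ck_on_Suc_imp: "Ck_on (Suc k) S f \<Longrightarrow> Ck_on k S f"
proof (induction k arbitrary: f)
  case 0
  then show ?case
    by (auto intro!: continuous_at_imp_continuous_on differentiable_imp_continuous_within)
qed auto

lemma Ck_on_const: "Ck_on k S (\<lambda>x. c)"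
  by (induction k arbitrary: c) auto

lemma Ck_on_linear:
  assumes "bounded_linear f" shows "Ck_on k S f"
proof (cases k)
  case 0
  then show ?thesis by (simp add: assms linear_continuous_on)
next
  case (Suc m)
  have "frechet_derivative f (at x) = f" for x
    by (rule frechet_derivative_at[symmetric, OF bounded_linear_imp_has_derivative[OF assms]])
  then show ?thesis
    using assms Suc by (auto simp: Ck_on_const bounded_linear_imp_differentiable)
qed

lemma Ck_on_linear_compose:
  assumes L: "bounded_linear L" shows "open S \<Longrightarrow> Ck_on k S f \<Longrightarrow> Ck_on k S (\<lambda>x. L (f x))"
proof (induction k arbitrary: f)
  case 0
  then show ?case by (simp add: bounded_linear.continuous_on[OF L])
next
  case (Suc k)
  have hd: "((\<lambda>x. L (f x)) has_derivative (\<lambda>v. L (frechet_derivative f (at x) v))) (at x)" if "x \<in> S" for x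
    using Suc.prems that by (intro bounded_linear.has_derivative[OF L]) (auto simp: frechet_derivative_works)
  have "Ck_on k S (\<lambda>x. frechet_derivative (\<lambda>x. L (f x)) (at x) v)" for v
  proof (rule iffD1[OF Ck_on_cong[OF Suc.prems(1)]])
    show "Ck_on k S (\<lambda>x. L (frechet_derivative f (at x) v))"
      using Suc by auto
    show "L (frechet_derivative f (at x) v) = frechet_derivative (\<lambda>x. L (f x)) (at x) v" if "x \<in> S" for x
      using frechet_derivative_at[OF hd[OF that]] by metis
  qed
  then show ?case using hd by (auto simp: differentiable_def)
qed

lemma Ck_on_add:
  assumes "open S" shows "Ck_on k S f \<Longrightarrow> Ck_on k S g \<Longrightarrow> Ck_on k S (\<lambda>x. f x + g x)"
proof (induction k arbitrary: f g)
  case 0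
  then show ?case by (auto intro!: continuous_intros)
next
  case (Suc k)
  have hd: "((\<lambda>x. f x + g x) has_derivative
      (\<lambda>v. frechet_derivative f (at x) v + frechet_derivative g (at x) v)) (at x)" if "x \<in> S" for x
    using Suc.prems that by (intro has_derivative_add) (auto simp: frechet_derivative_works)
  have "Ck_on k S (\<lambda>x. frechet_derivative (\<lambda>x. f x + g x) (at x) v)" for v
  proof (rule iffD1[OF Ck_on_cong[OF assms]])
    show "Ck_on k S (\<lambda>x. frechet_derivative f (at x) v + frechet_derivative g (at x) v)"
      using Suc by auto
    show "frechet_derivative f (at x) v + frechet_derivative g (at x) v
      = frechet_derivative (\<lambda>x. f x + g x) (at x) v" if "x \<in> S" for x
      using frechet_derivative_at[OF hd[OF that]] by metis
  qed
  then show ?case using hd by (auto simp: differentiable_def)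
qed

lemma Ck_on_sum:
  assumes "open S" "finite A" "\<And>i. i \<in> A \<Longrightarrow> Ck_on k S (f i)"
  shows "Ck_on k S (\<lambda>x. \<Sum>i\<in>A. f i x)"
  using assms(2,3)
  by (induction A rule: finite_induct) (auto simp: Ck_on_const intro!: Ck_on_add[OF assms(1)])

text \<open>Treats scalar multiples and inner products at once. The product rule also contains
  \<open>f\<close> and \<open>g\<close> undifferentiated, hence
  \<open>Ck_on_Suc_imp\<close>.\<close>

lemma Ck_on_bilinear:
  assumes B: "bounded_bilinear B" and "open S"
  shows "Ck_on k S f \<Longrightarrow> Ck_on k S g \<Longrightarrow> Ck_on k S (\<lambda>x. B (f x) (g x))"
proof (induction k arbitrary: f g)
  case 0
  then show ?case by (simp add: bounded_bilinear.continuous_on[OF B])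
next
  case (Suc k)
  have hd: "((\<lambda>x. B (f x) (g x)) has_derivative
      (\<lambda>v. B (f x) (frechet_derivative g (at x) v) + B (frechet_derivative f (at x) v) (g x))) (at x)"
    if "x \<in> S" for x
    using Suc.prems that
    by (intro bounded_bilinear.FDERIV[OF B]) (auto simp: frechet_derivative_works)
  have "Ck_on k S (\<lambda>x. frechet_derivative (\<lambda>x. B (f x) (g x)) (at x) v)" for v
  proof (rule iffD1[OF Ck_on_cong[OF assms(2)]])
    show "Ck_on k S (\<lambda>x. B (f x) (frechet_derivative g (at x) v) + B (frechet_derivative f (at x) v) (g x))"
      using Suc Ck_on_Suc_imp[OF Suc.prems(1)] Ck_on_Suc_imp[OF Suc.prems(2)]
      by (intro Ck_on_add[OF assms(2)] Suc.IH) auto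
    show "B (f x) (frechet_derivative g (at x) v) + B (frechet_derivative f (at x) v) (g x)
      = frechet_derivative (\<lambda>x. B (f x) (g x)) (at x) v" if "x \<in> S" for x
      using frechet_derivative_at[OF hd[OF that]] by metis
  qed
  then show ?case using hd by (auto simp: differentiable_def)
qed

text \<open>The direction in which the chain rule differentiates \<open>g\<close> varies with
  \<open>x\<close>, whereas \<open>Ck_on\<close> differentiates in fixed directions. Expanding it in
  a basis leaves fixed directions \<open>b\<close>, and the induction hypothesis applies to the
  derivative of \<open>g\<close> along \<open>b\<close>.\<close>

lemma Ck_on_compose:
  fixes f :: "'a::euclidean_space \<Rightarrow> 'b::euclidean_space" and g :: "'b \<Rightarrow> 'c::real_normed_vector"
  assumes "open S" "f ` S \<subseteq> T"
  shows "Ck_on k S f \<Longrightarrow> Ck_on k T g \<Longrightarrow> Ck_on k S (\<lambda>x. g (f x))"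
proof (induction k arbitrary: g)
  case 0
  then show ?case using assms by (auto intro: continuous_on_compose2)
next
  case (Suc k)
  have fS: "Ck_on k S f" using Suc.prems(1) by (rule Ck_on_Suc_imp)
  have hd: "((\<lambda>x. g (f x)) has_derivative
      (\<lambda>v. frechet_derivative g (at (f x)) (frechet_derivative f (at x) v))) (at x)"
    if "x \<in> S" for x
    using Suc.prems that assms(2)
    by (intro has_derivative_compose[where f=f and g=g]) (auto simp: frechet_derivative_works)
  have "Ck_on k S (\<lambda>x. frechet_derivative (\<lambda>x. g (f x)) (at x) v)" for v
  proof (rule iffD1[OF Ck_on_cong[OF assms(1)]])
    show "Ck_on k S (\<lambda>x. \<Sum>b\<in>Basis. (frechet_derivative f (at x) v \<bullet> b) *\<^sub>R frechet_derivative g (at (f x)) b)"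
    proof (intro Ck_on_sum[OF assms(1)] Ck_on_bilinear[OF bounded_bilinear_scaleR assms(1)])
      show "Ck_on k S (\<lambda>x. frechet_derivative f (at x) v \<bullet> b)" for b
        using Suc.prems(1) by (intro Ck_on_linear_compose[OF bounded_linear_inner_left assms(1)]) auto
      show "Ck_on k S (\<lambda>x. frechet_derivative g (at (f x)) b)" for b
        using Suc.prems(2) fS by (intro Suc.IH) auto
    qed auto
    show "(\<Sum>b\<in>Basis. (frechet_derivative f (at x) v \<bullet> b) *\<^sub>R frechet_derivative g (at (f x)) b)
      = frechet_derivative (\<lambda>x. g (f x)) (at x) v" if "x \<in> S" for x
    proof -
      have "g differentiable (at (f x))" using Suc.prems(2) assms(2) that by auto
      then have lin: "linear (frechet_derivative g (at (f x)))" by (rule linear_frechet_derivative)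
      have "frechet_derivative g (at (f x)) (frechet_derivative f (at x) v)
        = frechet_derivative g (at (f x)) (\<Sum>b\<in>Basis. (frechet_derivative f (at x) v \<bullet> b) *\<^sub>R b)"
        by (simp add: euclidean_representation)
      also have "\<dots> = (\<Sum>b\<in>Basis. (frechet_derivative f (at x) v \<bullet> b) *\<^sub>R frechet_derivative g (at (f x)) b)"
        by (simp add: linear_sum[OF lin] linear_cmul[OF lin])
      finally show ?thesis using frechet_derivative_at[OF hd[OF that]] by metis
    qed
  qed
  then show ?case using hd by (auto simp: differentiable_def)
qed

section \<open>Closure properties and locality of smoothness\<close>

lemma smooth_on_open: "smooth_on S f \<Longrightarrow> open S"
  by (simp add: smooth_on_def)

lemma smooth_on_cong: "(\<And>x. x \<in> S \<Longrightarrow> f x = g x) \<Longrightarrow> smooth_on S f \<Longrightarrow> smooth_on S g"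
  by (auto simp: smooth_on_def dest: Ck_on_cong)

lemma smooth_on_subset: "smooth_on S f \<Longrightarrow> open T \<Longrightarrow> T \<subseteq> S \<Longrightarrow> smooth_on T f"
  by (auto simp: smooth_on_def intro: Ck_on_subset)

lemma smooth_on_compose:
  fixes f :: "'a::euclidean_space \<Rightarrow> 'b::euclidean_space"
  shows "smooth_on S f \<Longrightarrow> smooth_on T g \<Longrightarrow> f ` S \<subseteq> T \<Longrightarrow> smooth_on S (\<lambda>x. g (f x))"
  unfolding smooth_on_def using Ck_on_compose[of S f T] by blast

lemma smooth_on_linear: "bounded_linear f \<Longrightarrow> open S \<Longrightarrow> smooth_on S f"
  by (simp add: smooth_on_def Ck_on_linear)

lemma smooth_on_add: "smooth_on S f \<Longrightarrow> smooth_on S g \<Longrightarrow> smooth_on S (\<lambda>x. f x + g x)"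
  by (auto simp: smooth_on_def intro: Ck_on_add)

lemma smooth_on_const: "open S \<Longrightarrow> smooth_on S (\<lambda>x. c)"
  by (simp add: smooth_on_def Ck_on_const)

lemma smooth_on_sum:
  "open S \<Longrightarrow> finite A \<Longrightarrow> (\<And>i. i \<in> A \<Longrightarrow> smooth_on S (f i)) \<Longrightarrow> smooth_on S (\<lambda>x. \<Sum>i\<in>A. f i x)"
  by (auto simp: smooth_on_def intro: Ck_on_sum)

lemma smooth_on_bilinear:
  "bounded_bilinear B \<Longrightarrow> smooth_on S f \<Longrightarrow> smooth_on S g \<Longrightarrow> smooth_on S (\<lambda>x. B (f x) (g x))"
  unfolding smooth_on_def using Ck_on_bilinear by blast

lemma smooth_on_Pair:
  assumes f: "smooth_on S f" and g: "smooth_on S g" shows "smooth_on S (\<lambda>x. (f x, g x))"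
proof -
  have "Ck_on k S (\<lambda>x. (f x, 0) + (0, g x))" for k
    using f g by (intro Ck_on_add Ck_on_linear_compose[where L="\<lambda>y. (y, 0)"] Ck_on_linear_compose[where L="\<lambda>y. (0, y)"])
       (auto simp: smooth_on_def intro!: bounded_linear_Pair bounded_linear_ident bounded_linear_zero)
  then show ?thesis using f by (simp add: smooth_on_def)
qed

lemma smooth_on_map_prod:
  assumes f: "smooth_on S f" and g: "smooth_on T g" shows "smooth_on (S \<times> T) (map_prod f g)"
proof -
  have o: "open (S \<times> T)" using f g by (intro open_Times) (auto simp: smooth_on_def)
  have "smooth_on (S \<times> T) (\<lambda>x. (f (fst x), g (snd x)))"
    by (intro smooth_on_Pair smooth_on_compose[OF _ f] smooth_on_compose[OF _ g]
        smooth_on_linear bounded_linear_fst bounded_linear_snd o) auto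
  then show ?thesis by (rule smooth_on_cong[rotated]) auto
qed

text \<open>A composite of maps between manifolds factors through one chart of the middle manifold
  only near each point, so its smoothness has to be established locally.\<close>

lemma smooth_on_locally:
  assumes "\<And>x. x \<in> S \<Longrightarrow> \<exists>T. x \<in> T \<and> T \<subseteq> S \<and> smooth_on T f"
  shows "smooth_on S f"
proof -
  have Ck: "\<And>f. (\<And>x. x \<in> S \<Longrightarrow> \<exists>T. x \<in> T \<and> T \<subseteq> S \<and> open T \<and> Ck_on k T f) \<Longrightarrow> Ck_on k S f" for k
  proof (induction k)
    case 0
    show ?case
      unfolding Ck_on.simps
    proof (rule continuous_at_imp_continuous_on, rule ballI)
      fix x assume "x \<in> S"
      then obtain T where "x \<in> T" "open T" "Ck_on 0 T f" using 0 by blast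
      then show "isCont f x" by (simp add: continuous_on_eq_continuous_at)
    qed
  next
    case (Suc k)
    have "f differentiable at x" if "x \<in> S" for x
      using Suc.prems[OF that] by auto
    moreover have "Ck_on k S (\<lambda>x. frechet_derivative f (at x) v)" for v
    proof (rule Suc.IH)
      fix x assume "x \<in> S"
      then obtain T where "x \<in> T" "T \<subseteq> S" "open T" "Ck_on (Suc k) T f" using Suc.prems by blast
      then show "\<exists>T. x \<in> T \<and> T \<subseteq> S \<and> open T \<and> Ck_on k T (\<lambda>x. frechet_derivative f (at x) v)"
        by (intro exI[of _ T]) simp
    qed
    ultimately show ?case by auto
  qed
  have "open S"
    using assms openI smooth_on_open by (metis (no_types, lifting) openI openE subset_trans)
  moreover have "Ck_on k S f" for k
    by (rule Ck) (use assms in \<open>unfold smooth_on_def, meson\<close>)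
  ultimately show ?thesis by (simp add: smooth_on_def)
qed

lemma smooth_on_continuous_on: "smooth_on S f \<Longrightarrow> continuous_on S f"
  unfolding smooth_on_def by (metis Ck_on.simps(1))

lemma smooth_on_differentiable: "smooth_on S f \<Longrightarrow> x \<in> S \<Longrightarrow> f differentiable (at x)"
  unfolding smooth_on_def using Ck_on_differentiable by blast

lemma smooth_on_has_derivative:
  "smooth_on S f \<Longrightarrow> x \<in> S \<Longrightarrow> (f has_derivative frechet_derivative f (at x)) (at x)"
  using smooth_on_differentiable frechet_derivative_works by blast

lemma smooth_on_derivative:
  "smooth_on S f \<Longrightarrow> smooth_on S (\<lambda>x. frechet_derivative f (at x) v)"
  unfolding smooth_on_def using Ck_on.simps(2) by blast

lemma smooth_on_preimage:
  "smooth_on S f \<Longrightarrow> open T \<Longrightarrow> open (S \<inter> f -` T)"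
  using smooth_on_continuous_on smooth_on_open continuous_open_preimage by metis

section \<open>Smooth maps between manifolds\<close>

text \<open>Separates what computations in charts use from the smoothness of the transition maps in
  \<open>smooth_atlas\<close>. Tangent bundles are shown to satisfy the former, products and
  cotangent bundles both.\<close>

definition charted :: "('m, 'a::euclidean_space) mfd \<Rightarrow> bool" where
  "charted M \<longleftrightarrow> (\<forall>x. chart_at M x \<in> atlas M \<and> x \<in> fst (chart_at M x)) \<and>
     (\<forall>c\<in>atlas M. inj_on (snd c) (fst c) \<and> open (snd c ` fst c))"

definition smooth_atlas :: "('m, 'a::euclidean_space) mfd \<Rightarrow> bool" where
  "smooth_atlas M \<longleftrightarrow> charted M \<and>
     (\<forall>c\<in>atlas M. \<forall>d\<in>atlas M. smooth_on (snd c ` (fst c \<inter> fst d)) (snd d \<circ> chart_inv c))"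

lemma smooth_manifold_imp_smooth_atlas: "smooth_manifold M \<Longrightarrow> smooth_atlas M"
  by (auto simp: smooth_manifold_def smooth_atlas_def charted_def)

lemma smooth_atlas_imp_charted: "smooth_atlas M \<Longrightarrow> charted M"
  by (simp add: smooth_atlas_def)

lemma chart_at_atlas: "charted M \<Longrightarrow> chart_at M x \<in> atlas M"
  and chart_at_mem: "charted M \<Longrightarrow> x \<in> fst (chart_at M x)"
  and chart_open_image: "charted M \<Longrightarrow> c \<in> atlas M \<Longrightarrow> open (snd c ` fst c)"
  and chart_inj_on: "charted M \<Longrightarrow> c \<in> atlas M \<Longrightarrow> inj_on (snd c) (fst c)"
  by (auto simp: charted_def)

lemma chart_inv_chart: "charted M \<Longrightarrow> c \<in> atlas M \<Longrightarrow> x \<in> fst c \<Longrightarrow> chart_inv c (snd c x) = x"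
  using chart_inj_on inv_into_f_f by metis

lemma chart_eq_iff:
  "charted M \<Longrightarrow> c \<in> atlas M \<Longrightarrow> x \<in> fst c \<Longrightarrow> y \<in> fst c \<Longrightarrow> snd c x = snd c y \<longleftrightarrow> x = y"
  using chart_inj_on by (metis inj_on_eq_iff)

lemma smooth_map_onD:
  "smooth_map_on M N U f \<Longrightarrow> c \<in> atlas M \<Longrightarrow> d \<in> atlas N \<Longrightarrow>
    smooth_on (snd c ` (fst c \<inter> U \<inter> f -` fst d)) (snd d \<circ> f \<circ> chart_inv c)"
  by (simp add: smooth_map_on_def)

lemma smooth_map_on_cong:
  assumes "charted M" "smooth_map_on M N U f" "\<And>x. x \<in> U \<Longrightarrow> f x = g x"
  shows "smooth_map_on M N U g"
  unfolding smooth_map_on_def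
proof (intro conjI ballI)
  show "mopen M U" using assms(2) by (simp add: smooth_map_on_def)
  fix c d assume cd: "c \<in> atlas M" "d \<in> atlas N"
  have "fst c \<inter> U \<inter> g -` fst d = fst c \<inter> U \<inter> f -` fst d" using assms(3) by auto
  moreover have "smooth_on (snd c ` (fst c \<inter> U \<inter> f -` fst d)) (snd d \<circ> g \<circ> chart_inv c)"
    by (rule smooth_on_cong[OF _ smooth_map_onD[OF assms(2) cd]])
       (use assms(3) chart_inv_chart[OF assms(1) cd(1)] in auto)
  ultimately show "smooth_on (snd c ` (fst c \<inter> U \<inter> g -` fst d)) (snd d \<circ> g \<circ> chart_inv c)" by simp
qed

text \<open>The preferred chart \<open>d\<close> at \<open>f x\<close> covers only a neighbourhood
  of \<open>f x\<close>, so each \<open>x\<close> gets its own open set \<open>T\<close> on which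
  the representative of \<open>g \<circ> f\<close> is a composite of representatives.\<close>

lemma smooth_map_on_compose:
  assumes M: "charted M" and N: "charted N"
    and f: "smooth_map_on M N U f" and g: "smooth_map_on N P V g" and UV: "f ` U \<subseteq> V"
  shows "smooth_map_on M P U (g \<circ> f)"
  unfolding smooth_map_on_def
proof (intro conjI ballI)
  show "mopen M U" using f by (simp add: smooth_map_on_def)
  fix c e assume c: "c \<in> atlas M" and e: "e \<in> atlas P"
  show "smooth_on (snd c ` (fst c \<inter> U \<inter> (g \<circ> f) -` fst e)) (snd e \<circ> (g \<circ> f) \<circ> chart_inv c)"
  proof (rule smooth_on_locally)
    fix y assume "y \<in> snd c ` (fst c \<inter> U \<inter> (g \<circ> f) -` fst e)"
    then obtain x where x: "x \<in> fst c" "x \<in> U" "g (f x) \<in> fst e" "y = snd c x" by auto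
    define d where "d = chart_at N (f x)"
    have d: "d \<in> atlas N" "f x \<in> fst d" by (simp_all add: d_def chart_at_atlas[OF N] chart_at_mem[OF N])
    define A where "A = snd c ` (fst c \<inter> U \<inter> f -` fst d)"
    define B where "B = snd d ` (fst d \<inter> V \<inter> g -` fst e)"
    define T where "T = A \<inter> (snd d \<circ> f \<circ> chart_inv c) -` B"
    have sf: "smooth_on A (snd d \<circ> f \<circ> chart_inv c)"
      unfolding A_def by (rule smooth_map_onD[OF f c d(1)])
    have sg: "smooth_on B (snd e \<circ> g \<circ> chart_inv d)"
      unfolding B_def by (rule smooth_map_onD[OF g d(1) e])
    have oT: "open T" unfolding T_def by (rule smooth_on_preimage[OF sf smooth_on_open[OF sg]])
    \<comment> \<open>Membership of \<open>snd d (f x')\<close> in \<open>B\<close> only provides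
      some point with the same coordinates; injectivity of the chart identifies it with
      \<open>f x'\<close>.\<close>
    have T: "\<exists>x'. y' = snd c x' \<and> x' \<in> fst c \<and> x' \<in> U \<and> f x' \<in> fst d \<and> g (f x') \<in> fst e" if y': "y' \<in> T" for y'
    proof -
      obtain x' where x': "y' = snd c x'" "x' \<in> fst c" "x' \<in> U" "f x' \<in> fst d"
        using y' by (auto simp: T_def A_def)
      have "snd d (f x') \<in> B" using y' x' by (simp add: T_def chart_inv_chart[OF M c])
      then obtain z where "z \<in> fst d" "g z \<in> fst e" "snd d (f x') = snd d z" by (auto simp: B_def)
      then have "g (f x') \<in> fst e" using chart_eq_iff[OF N d(1)] x' by metis
      then show ?thesis using x' by blast
    qed
    have "smooth_on T (\<lambda>y. (snd e \<circ> g \<circ> chart_inv d) ((snd d \<circ> f \<circ> chart_inv c) y))"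
      by (rule smooth_on_compose[OF smooth_on_subset[OF sf oT] sg]) (auto simp: T_def)
    then have "smooth_on T (snd e \<circ> (g \<circ> f) \<circ> chart_inv c)"
      by (rule smooth_on_cong[rotated])
         (auto dest!: T simp: chart_inv_chart[OF M c] chart_inv_chart[OF N d(1)])
    moreover have "y \<in> T"
      using x d UV by (auto simp: T_def A_def B_def chart_inv_chart[OF M c])
    moreover have "T \<subseteq> snd c ` (fst c \<inter> U \<inter> (g \<circ> f) -` fst e)"
      by (auto dest!: T)
    ultimately show "\<exists>T. y \<in> T \<and> T \<subseteq> snd c ` (fst c \<inter> U \<inter> (g \<circ> f) -` fst e) \<and>
      smooth_on T (snd e \<circ> (g \<circ> f) \<circ> chart_inv c)" by blast
  qed
qed

lemma smooth_map_on_Pair: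
  assumes M: "charted M" and f: "smooth_map_on M N U f" and g: "smooth_map_on M P U g"
  shows "smooth_map_on M (N \<times>\<^sub>M P) U (\<lambda>x. (f x, g x))"
  unfolding smooth_map_on_def
proof (intro conjI ballI)
  show "mopen M U" using f by (simp add: smooth_map_on_def)
  fix c e assume c: "c \<in> atlas M" and "e \<in> atlas (N \<times>\<^sub>M P)"
  then obtain d d' where e: "e = prod_chart d d'" and d: "d \<in> atlas N" and d': "d' \<in> atlas P"
    by (auto simp: prod_mfd_def)
  define T where "T = snd c ` (fst c \<inter> U \<inter> (\<lambda>x. (f x, g x)) -` fst e)"
  let ?A = "snd c ` (fst c \<inter> U \<inter> f -` fst d)" and ?B = "snd c ` (fst c \<inter> U \<inter> g -` fst d')"
  have "T = ?A \<inter> ?B"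
    unfolding T_def
    by (subst inj_on_image_Int[OF chart_inj_on[OF M c], symmetric]) (auto simp: e prod_chart_def)
  then have o: "open T" "T \<subseteq> ?A" "T \<subseteq> ?B"
    using smooth_map_onD[OF f c d] smooth_map_onD[OF g c d'] by (auto dest!: smooth_on_open)
  have "smooth_on T (\<lambda>y. ((snd d \<circ> f \<circ> chart_inv c) y, (snd d' \<circ> g \<circ> chart_inv c) y))"
    by (intro smooth_on_Pair smooth_on_subset[OF smooth_map_onD[OF f c d]]
        smooth_on_subset[OF smooth_map_onD[OF g c d']] o)
  then show "smooth_on (snd c ` (fst c \<inter> U \<inter> (\<lambda>x. (f x, g x)) -` fst e)) (snd e \<circ> (\<lambda>x. (f x, g x)) \<circ> chart_inv c)"
    unfolding T_def[symmetric] by (rule smooth_on_cong[rotated]) (auto simp: e prod_chart_def)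
qed

section \<open>Products of charts and of manifolds\<close>

lemma prod_chart_inv:
  assumes "inj_on (snd c) (fst c)" "inj_on (snd d) (fst d)" "x \<in> fst c" "y \<in> fst d"
  shows "inv_into (fst c \<times> fst d) (snd (prod_chart c d)) (snd c x, snd d y) = (x, y)"
proof -
  have "inj_on (map_prod (snd c) (snd d)) (fst c \<times> fst d)"
    using assms by (intro map_prod_inj_on)
  from inv_into_f_f[OF this, of "(x, y)"] assms(3,4) show ?thesis by (simp add: prod_chart_def)
qed

lemma fst_prod_chart [simp]: "fst (prod_chart c d) = fst c \<times> fst d"
  and snd_prod_chart [simp]: "snd (prod_chart c d) z = (snd c (fst z), snd d (snd z))"
  by (simp_all add: prod_chart_def map_prod_def case_prod_beta)

lemma snd_prod_chart_image: "snd (prod_chart c d) ` (A \<times> B) = (snd c ` A) \<times> (snd d ` B)"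
  by (auto simp: prod_chart_def)

lemma atlas_prod_mfd: "atlas (M \<times>\<^sub>M N) = (\<lambda>(c, d). prod_chart c d) ` (atlas M \<times> atlas N)"
  and chart_at_prod_mfd [simp]: "chart_at (M \<times>\<^sub>M N) z = prod_chart (chart_at M (fst z)) (chart_at N (snd z))"
  by (simp_all add: prod_mfd_def case_prod_beta)

lemma charted_prod_mfd:
  assumes M: "charted M" and N: "charted N" shows "charted (M \<times>\<^sub>M N)"
  unfolding charted_def atlas_prod_mfd
proof (intro conjI allI ballI)
  fix z :: "'a \<times> 'c"
  show "chart_at (M \<times>\<^sub>M N) z \<in> (\<lambda>(c, d). prod_chart c d) ` (atlas M \<times> atlas N)"
    using chart_at_atlas[OF M] chart_at_atlas[OF N] by auto
  show "z \<in> fst (chart_at (M \<times>\<^sub>M N) z)"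
    using chart_at_mem[OF M] chart_at_mem[OF N] by (auto simp: mem_Times_iff)
next
  fix e assume "e \<in> (\<lambda>(c, d). prod_chart c d) ` (atlas M \<times> atlas N)"
  then obtain c d where e: "e = prod_chart c d" and cd: "c \<in> atlas M" "d \<in> atlas N" by auto
  show "inj_on (snd e) (fst e)"
    using chart_inj_on[OF M cd(1)] chart_inj_on[OF N cd(2)] by (auto simp: e inj_on_def)
  show "open (snd e ` fst e)"
    unfolding e fst_prod_chart snd_prod_chart_image
    by (rule open_Times[OF chart_open_image[OF M cd(1)] chart_open_image[OF N cd(2)]])
qed

lemma smooth_atlas_prod_mfd:
  assumes M: "smooth_atlas M" and N: "smooth_atlas N" shows "smooth_atlas (M \<times>\<^sub>M N)"
  unfolding smooth_atlas_def
proof (intro conjI ballI)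
  have cM: "charted M" and cN: "charted N" using M N smooth_atlas_imp_charted by auto
  show "charted (M \<times>\<^sub>M N)" by (rule charted_prod_mfd[OF cM cN])
  fix e e' assume "e \<in> atlas (M \<times>\<^sub>M N)" "e' \<in> atlas (M \<times>\<^sub>M N)"
  then obtain c d c' d' where e: "e = prod_chart c d" "e' = prod_chart c' d'"
    and cd: "c \<in> atlas M" "d \<in> atlas N" "c' \<in> atlas M" "d' \<in> atlas N"
    by (auto simp: atlas_prod_mfd)
  have "fst e \<inter> fst e' = (fst c \<inter> fst c') \<times> (fst d \<inter> fst d')" by (auto simp: e)
  then have im: "snd e ` (fst e \<inter> fst e') = snd c ` (fst c \<inter> fst c') \<times> snd d ` (fst d \<inter> fst d')"
    unfolding e by (simp only: snd_prod_chart_image)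
  have "smooth_on (snd c ` (fst c \<inter> fst c') \<times> snd d ` (fst d \<inter> fst d'))
     (map_prod (snd c' \<circ> chart_inv c) (snd d' \<circ> chart_inv d))"
    using M N cd by (intro smooth_on_map_prod) (auto simp: smooth_atlas_def)
  then show "smooth_on (snd e ` (fst e \<inter> fst e')) (snd e' \<circ> chart_inv e)"
    unfolding im
    by (rule smooth_on_cong[rotated])
       (auto simp: e prod_chart_inv chart_inj_on[OF cM] chart_inj_on[OF cN] cd
         chart_inv_chart[OF cM cd(1)] chart_inv_chart[OF cN cd(2)])
qed

lemma chart_inv_UNIV_id [simp]: "chart_inv (UNIV, id) = id"
  by (auto simp: fun_eq_iff)

lemma atlas_euclid [simp]: "atlas euclid = {(UNIV, id)}"
  and chart_at_euclid [simp]: "chart_at euclid x = (UNIV, id)"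
  by (simp_all add: euclid_def)

lemma smooth_atlas_euclid: "smooth_atlas euclid"
  by (auto simp: smooth_atlas_def charted_def id_def comp_def intro: smooth_on_linear bounded_linear_ident)

lemmas charted_euclid = smooth_atlas_imp_charted[OF smooth_atlas_euclid]

lemma mopen_Times: "mopen M U \<Longrightarrow> mopen N V \<Longrightarrow> mopen (M \<times>\<^sub>M N) (U \<times> V)"
  unfolding mopen_def atlas_prod_mfd
  by (auto simp: Times_Int_Times snd_prod_chart_image open_Times simp del: snd_prod_chart)

lemma smooth_map_on_map_prod:
  assumes M: "charted M" and N: "charted N"
    and f: "smooth_map_on M M' U f" and g: "smooth_map_on N N' V g"
  shows "smooth_map_on (M \<times>\<^sub>M N) (M' \<times>\<^sub>M N') (U \<times> V) (map_prod f g)"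
  unfolding smooth_map_on_def
proof (intro conjI ballI)
  show "mopen (M \<times>\<^sub>M N) (U \<times> V)" using f g by (intro mopen_Times) (auto simp: smooth_map_on_def)
  fix e e' assume "e \<in> atlas (M \<times>\<^sub>M N)" "e' \<in> atlas (M' \<times>\<^sub>M N')"
  then obtain c d c' d' where e: "e = prod_chart c d" "e' = prod_chart c' d'"
    and cd: "c \<in> atlas M" "d \<in> atlas N" "c' \<in> atlas M'" "d' \<in> atlas N'"
    by (auto simp: atlas_prod_mfd)
  let ?A = "fst c \<inter> U \<inter> f -` fst c'" and ?B = "fst d \<inter> V \<inter> g -` fst d'"
  have "fst e \<inter> (U \<times> V) \<inter> map_prod f g -` fst e' = ?A \<times> ?B" by (auto simp: e)
  then have im: "snd e ` (fst e \<inter> (U \<times> V) \<inter> map_prod f g -` fst e') = snd c ` ?A \<times> snd d ` ?B"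
    unfolding e by (simp only: snd_prod_chart_image)
  have "smooth_on (snd c ` ?A \<times> snd d ` ?B) (map_prod (snd c' \<circ> f \<circ> chart_inv c) (snd d' \<circ> g \<circ> chart_inv d))"
    by (intro smooth_on_map_prod smooth_map_onD[OF f cd(1,3)] smooth_map_onD[OF g cd(2,4)])
  then show "smooth_on (snd e ` (fst e \<inter> (U \<times> V) \<inter> map_prod f g -` fst e')) (snd e' \<circ> map_prod f g \<circ> chart_inv e)"
    unfolding im
    by (rule smooth_on_cong[rotated])
       (auto simp: e prod_chart_inv chart_inj_on[OF M] chart_inj_on[OF N] cd
         chart_inv_chart[OF M cd(1)] chart_inv_chart[OF N cd(2)])
qed

text \<open>
  In suitable charts these maps are represented by maps of the whole model spaces. The last clause
  of \<open>chart_pull\<close> ensures that the chart image of \<open>\<sigma> -` X\<close> is the full preimage under \<open>S\<close> of the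
  chart image of \<open>X\<close>, hence open if the latter is.
\<close>

definition chart_pull ::
  "('m, 'a::euclidean_space) mfd \<Rightarrow> ('n, 'b::euclidean_space) mfd \<Rightarrow> ('m \<Rightarrow> 'n) \<Rightarrow> bool" where
  "chart_pull M N \<sigma> \<longleftrightarrow> (\<forall>c\<in>atlas M. \<exists>d\<in>atlas N. \<exists>S. smooth_on UNIV S \<and> fst c = \<sigma> -` fst d \<and>
     (\<forall>x\<in>fst c. snd d (\<sigma> x) = S (snd c x)) \<and>
     (\<forall>x\<in>fst d. \<forall>y. snd d x = S y \<longrightarrow> (\<exists>x'. \<sigma> x' = x \<and> snd c x' = y)))"

definition chart_push ::
  "('m, 'a::euclidean_space) mfd \<Rightarrow> ('n, 'b::euclidean_space) mfd \<Rightarrow> ('m \<Rightarrow> 'n) \<Rightarrow> bool" where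
  "chart_push M N \<tau> \<longleftrightarrow> (\<forall>d\<in>atlas N. \<exists>c\<in>atlas M. \<exists>L. smooth_on UNIV L \<and> fst c = \<tau> -` fst d \<and>
     (\<forall>x\<in>fst c. snd d (\<tau> x) = L (snd c x)))"

lemma chart_pullE:
  assumes "chart_pull M N \<sigma>" "c \<in> atlas M"
  obtains d S where "d \<in> atlas N" "smooth_on UNIV S" "fst c = \<sigma> -` fst d"
    "\<And>x. x \<in> fst c \<Longrightarrow> snd d (\<sigma> x) = S (snd c x)"
    "\<And>X. X \<subseteq> fst d \<Longrightarrow> snd c ` (\<sigma> -` X) = UNIV \<inter> S -` (snd d ` X)"
proof -
  obtain d S where d: "d \<in> atlas N" "smooth_on UNIV S" "fst c = \<sigma> -` fst d"
    and S1: "\<And>x. x \<in> fst c \<Longrightarrow> snd d (\<sigma> x) = S (snd c x)"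
    and S2: "\<And>x y. x \<in> fst d \<Longrightarrow> snd d x = S y \<Longrightarrow> \<exists>x'. \<sigma> x' = x \<and> snd c x' = y"
    using assms unfolding chart_pull_def by meson
  have "snd c ` (\<sigma> -` X) = UNIV \<inter> S -` (snd d ` X)" if "X \<subseteq> fst d" for X
  proof (intro equalityI subsetI)
    fix y assume "y \<in> snd c ` (\<sigma> -` X)"
    then show "y \<in> UNIV \<inter> S -` (snd d ` X)" using that d(3) S1 by force
  next
    fix y assume "y \<in> UNIV \<inter> S -` (snd d ` X)"
    then obtain x where "x \<in> X" "snd d x = S y" by auto
    then obtain x' where "\<sigma> x' = x" "snd c x' = y" using S2 \<open>X \<subseteq> fst d\<close> by blast
    then show "y \<in> snd c ` (\<sigma> -` X)" using \<open>x \<in> X\<close> by auto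
  qed
  with d S1 that show thesis by blast
qed

lemma chart_pull_id: "chart_pull M M id"
  unfolding chart_pull_def
  by (intro ballI bexI exI[of _ id])
     (auto simp: id_def intro: smooth_on_linear bounded_linear_ident)

lemma chart_push_id: "chart_push M M id"
  unfolding chart_push_def
  by (intro ballI bexI exI[of _ id])
     (auto simp: id_def intro: smooth_on_linear bounded_linear_ident)

lemma mopen_chart_pull:
  assumes \<sigma>: "chart_pull M N \<sigma>" and U: "mopen N U"
  shows "mopen M (\<sigma> -` U)"
  unfolding mopen_def
proof
  fix c assume "c \<in> atlas M"
  from \<sigma> this obtain d S where d: "d \<in> atlas N" "smooth_on UNIV S" "fst c = \<sigma> -` fst d"
    and im: "\<And>X. X \<subseteq> fst d \<Longrightarrow> snd c ` (\<sigma> -` X) = UNIV \<inter> S -` (snd d ` X)"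
    by (rule chart_pullE) blast
  have "open (snd d ` (U \<inter> fst d))" using U d by (simp add: mopen_def)
  moreover have "\<sigma> -` U \<inter> fst c = \<sigma> -` (U \<inter> fst d)" using d by auto
  ultimately show "open (snd c ` (\<sigma> -` U \<inter> fst c))"
    using im[of "U \<inter> fst d"] smooth_on_preimage[OF d(2), of "snd d ` (U \<inter> fst d)"] by simp
qed

text \<open>The new representative is \<open>L\<close> after that of \<open>f\<close> after
  \<open>S\<close>. As \<open>S\<close> and \<open>L\<close> are smooth on the whole model spaces,
  no chart has to be chosen near each point. With \<open>f = id\<close> this also shows that the
  rearranging maps themselves are smooth.\<close>

lemma smooth_map_on_conjugate:
  assumes A: "charted A" "charted A'" and \<sigma>: "chart_pull A' A \<sigma>" and \<tau>: "chart_push B B' \<tau>"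
    and f: "smooth_map_on A B U f"
  shows "smooth_map_on A' B' (\<sigma> -` U) (\<tau> \<circ> f \<circ> \<sigma>)"
  unfolding smooth_map_on_def
proof (intro conjI ballI)
  show "mopen A' (\<sigma> -` U)" using f \<sigma> by (simp add: smooth_map_on_def mopen_chart_pull)
  fix c' d' assume c': "c' \<in> atlas A'" and d': "d' \<in> atlas B'"
  from \<sigma> c' obtain c S where c: "c \<in> atlas A" and S: "smooth_on UNIV S" and fc': "fst c' = \<sigma> -` fst c"
    and S1: "\<And>x. x \<in> fst c' \<Longrightarrow> snd c (\<sigma> x) = S (snd c' x)"
    and im: "\<And>X. X \<subseteq> fst c \<Longrightarrow> snd c' ` (\<sigma> -` X) = UNIV \<inter> S -` (snd c ` X)"
    by (rule chart_pullE) blast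
  obtain d L where d: "d \<in> atlas B" and L: "smooth_on UNIV L" and fd: "fst d = \<tau> -` fst d'"
    and L1: "\<And>x. x \<in> fst d \<Longrightarrow> snd d' (\<tau> x) = L (snd d x)"
    using \<tau> d' unfolding chart_push_def by meson
  let ?X = "fst c \<inter> U \<inter> f -` fst d"
  have rep: "smooth_on (snd c ` ?X) (snd d \<circ> f \<circ> chart_inv c)" by (rule smooth_map_onD[OF f c d])
  have X: "fst c' \<inter> \<sigma> -` U \<inter> (\<tau> \<circ> f \<circ> \<sigma>) -` fst d' = \<sigma> -` ?X" using fc' fd by auto
  have o: "open (UNIV \<inter> S -` (snd c ` ?X))" by (rule smooth_on_preimage[OF S smooth_on_open[OF rep]])
  have "smooth_on (UNIV \<inter> S -` (snd c ` ?X)) (\<lambda>y. L ((snd d \<circ> f \<circ> chart_inv c) (S y)))"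
    by (intro smooth_on_compose[OF _ L] smooth_on_compose[OF _ rep] smooth_on_subset[OF S] o) auto
  then have "smooth_on (snd c' ` (\<sigma> -` ?X)) (\<lambda>y. L ((snd d \<circ> f \<circ> chart_inv c) (S y)))"
    by (subst im) auto
  then show "smooth_on (snd c' ` (fst c' \<inter> \<sigma> -` U \<inter> (\<tau> \<circ> f \<circ> \<sigma>) -` fst d')) (snd d' \<circ> (\<tau> \<circ> f \<circ> \<sigma>) \<circ> chart_inv c')"
    unfolding X
  proof (rule smooth_on_cong[rotated])
    fix y assume "y \<in> snd c' ` (\<sigma> -` ?X)"
    then obtain x where x: "y = snd c' x" "\<sigma> x \<in> fst c" "f (\<sigma> x) \<in> fst d" by auto
    then have "x \<in> fst c'" using fc' by auto
    then show "L ((snd d \<circ> f \<circ> chart_inv c) (S y)) = (snd d' \<circ> (\<tau> \<circ> f \<circ> \<sigma>) \<circ> chart_inv c') y"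
      using x by (simp add: S1[symmetric] L1 chart_inv_chart[OF A(1) c] chart_inv_chart[OF A(2) c'])
  qed
qed

section \<open>Tangent maps\<close>

lemma smooth_map_on_rep_has_derivative:
  assumes "smooth_map_on M N U f" "charted M" "c \<in> atlas M" "d \<in> atlas N" "x \<in> U" "x \<in> fst c" "f x \<in> fst d"
  shows "((snd d \<circ> f \<circ> chart_inv c) has_derivative
    frechet_derivative (snd d \<circ> f \<circ> chart_inv c) (at (snd c x))) (at (snd c x))"
  by (rule smooth_on_has_derivative[OF smooth_map_onD[OF assms(1,3,4)]]) (use assms in auto)

lemma mderiv_has_derivative:
  assumes "smooth_map_on M N U f" "charted M" "charted N" "x \<in> U"
  shows "((snd (chart_at N (f x)) \<circ> f \<circ> chart_inv (chart_at M x)) has_derivative mderiv M N f x)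
    (at (snd (chart_at M x) x))"
  unfolding mderiv_def
  by (rule smooth_map_on_rep_has_derivative[OF assms(1,2)])
     (use assms in \<open>simp_all add: chart_at_atlas chart_at_mem\<close>)

lemma linear_mderiv:
  "smooth_map_on M N U f \<Longrightarrow> charted M \<Longrightarrow> charted N \<Longrightarrow> x \<in> U \<Longrightarrow> linear (mderiv M N f x)"
  by (rule has_derivative_linear[OF mderiv_has_derivative])

text \<open>The last coordinate map \<open>k\<close> is arbitrary, so that the chain rule for
  tangent maps, the cocycle rule for Jacobians and the change of target chart for \<open>R\<close>
  are all instances.\<close>

lemma rep_compose_has_derivative:
  assumes M: "charted M" and N: "charted N"
    and f: "smooth_map_on M N U f" and c: "c \<in> atlas M" and d: "d \<in> atlas N"
    and x: "x \<in> U" "x \<in> fst c" "f x \<in> fst d"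
    and f': "((snd d \<circ> f \<circ> chart_inv c) has_derivative f') (at (snd c x))"
    and g': "((k \<circ> g \<circ> chart_inv d) has_derivative g') (at (snd d (f x)))"
  shows "((k \<circ> (g \<circ> f) \<circ> chart_inv c) has_derivative (g' \<circ> f')) (at (snd c x))"
proof -
  let ?A = "snd c ` (fst c \<inter> U \<inter> f -` fst d)"
  have "((k \<circ> g \<circ> chart_inv d) \<circ> (snd d \<circ> f \<circ> chart_inv c) has_derivative (g' \<circ> f')) (at (snd c x))"
    using g' by (intro diff_chain_at f') (simp add: chart_inv_chart[OF M c x(2)])
  then show ?thesis
  proof (rule has_derivative_transform_within_open)
    show "open ?A" using smooth_map_onD[OF f c d] by (rule smooth_on_open)
    show "snd c x \<in> ?A" using x by auto
    show "((k \<circ> g \<circ> chart_inv d) \<circ> (snd d \<circ> f \<circ> chart_inv c)) y = (k \<circ> (g \<circ> f) \<circ> chart_inv c) y"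
      if "y \<in> ?A" for y
      using that by (auto simp: chart_inv_chart[OF M c] chart_inv_chart[OF N d])
  qed
qed

lemma mderiv_compose:
  assumes M: "charted M" and N: "charted N" and P: "charted P"
    and f: "smooth_map_on M N U f" and g: "smooth_map_on N P V g" and x: "x \<in> U" "f x \<in> V"
  shows "mderiv M P (g \<circ> f) x = mderiv N P g (f x) \<circ> mderiv M N f x"
  unfolding mderiv_def[of M P]
  using rep_compose_has_derivative[OF M N f chart_at_atlas[OF M] chart_at_atlas[OF N] x(1)
      chart_at_mem[OF M] chart_at_mem[OF N] mderiv_has_derivative[OF f M N x(1)]
      mderiv_has_derivative[OF g N P x(2)]]
  by (simp add: frechet_derivative_at[symmetric] comp_assoc)

lemma mderiv_eqI:
  assumes M: "charted M" and S: "(S has_derivative D) (at (snd (chart_at M x) x))"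
    and rep: "\<And>x'. x' \<in> fst (chart_at M x) \<Longrightarrow> snd (chart_at N (f x)) (f x') = S (snd (chart_at M x) x')"
  shows "mderiv M N f x = D"
proof -
  let ?c = "chart_at M x"
  have c: "?c \<in> atlas M" "x \<in> fst ?c" using M by (simp_all add: chart_at_atlas chart_at_mem)
  have "((snd (chart_at N (f x)) \<circ> f \<circ> chart_inv ?c) has_derivative D) (at (snd ?c x))"
    using S
  proof (rule has_derivative_transform_within_open)
    show "open (snd ?c ` fst ?c)" by (rule chart_open_image[OF M c(1)])
    show "snd ?c x \<in> snd ?c ` fst ?c" using c by auto
    show "S y = (snd (chart_at N (f x)) \<circ> f \<circ> chart_inv ?c) y" if "y \<in> snd ?c ` fst ?c" for y
      using that rep by (auto simp: chart_inv_chart[OF M c(1)])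
  qed
  then show ?thesis unfolding mderiv_def by (rule frechet_derivative_at[symmetric])
qed

section \<open>Tangent and cotangent charts\<close>

text \<open>The Jacobian of a change of chart. From the preferred chart it is the component change
  in a tangent chart; into the preferred chart, its transpose is the one in a cotangent
  chart.\<close>

definition jac ::
  "('m, 'a::euclidean_space) chart \<Rightarrow> ('m, 'a) chart \<Rightarrow> 'm \<Rightarrow> 'a \<Rightarrow> 'a" where
  "jac c d x = frechet_derivative (snd d \<circ> chart_inv c) (at (snd c x))"

lemma jac_has_derivative:
  assumes "smooth_atlas M" "c \<in> atlas M" "d \<in> atlas M" "x \<in> fst c" "x \<in> fst d"
  shows "((snd d \<circ> chart_inv c) has_derivative jac c d x) (at (snd c x))"
  unfolding jac_def
  by (rule smooth_on_has_derivative[of "snd c ` (fst c \<inter> fst d)"]) (use assms in \<open>auto simp: smooth_atlas_def\<close>)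

lemma smooth_map_id:
  assumes "smooth_atlas M" shows "smooth_map M M id"
proof -
  have "mopen M UNIV" using assms by (simp add: mopen_def smooth_atlas_def charted_def)
  moreover have "fst c \<inter> UNIV \<inter> id -` fst d = fst c \<inter> fst d" for c d :: "('a, 'b) chart" by auto
  ultimately show ?thesis using assms by (simp add: smooth_map_on_def smooth_atlas_def)
qed

lemma jac_self:
  assumes "charted M" "c \<in> atlas M" "x \<in> fst c"
  shows "jac c c x = id"
proof -
  have "((\<lambda>y. y) has_derivative (\<lambda>y. y)) (at (snd c x))" by simp
  then have "((snd c \<circ> chart_inv c) has_derivative (\<lambda>y. y)) (at (snd c x))"
    by (rule has_derivative_transform_within_open[OF _ chart_open_image[OF assms(1,2)]])
       (use assms in \<open>auto simp: chart_inv_chart\<close>)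
  then show ?thesis by (simp add: jac_def frechet_derivative_at[symmetric] id_def)
qed

context
  fixes M :: "('m, 'a::euclidean_space) mfd"
  assumes M: "smooth_atlas M"
begin

lemma charted: "charted M" using M by (rule smooth_atlas_imp_charted)

text \<open>The cocycle rule, obtained from the chain rule for \<open>id \<circ> id\<close>.\<close>

lemma jac_jac:
  assumes c: "c \<in> atlas M" and d: "d \<in> atlas M" and e: "e \<in> atlas M"
    and x: "x \<in> fst c" "x \<in> fst d" "x \<in> fst e"
  shows "jac d e x (jac c d x v) = jac c e x v"
proof -
  have "((snd e \<circ> (id \<circ> id) \<circ> chart_inv c) has_derivative (jac d e x \<circ> jac c d x)) (at (snd c x))"
    by (rule rep_compose_has_derivative[OF charted charted smooth_map_id[OF M] c d])
       (use x jac_has_derivative[OF M c d x(1,2)] jac_has_derivative[OF M d e x(2,3)] in auto)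
  then have "jac c e x = jac d e x \<circ> jac c d x"
    unfolding jac_def[of c e] by (simp add: frechet_derivative_at[symmetric])
  then show ?thesis by simp
qed

lemma linear_jac:
  assumes "c \<in> atlas M" "d \<in> atlas M" "x \<in> fst c" "x \<in> fst d" shows "linear (jac c d x)"
  using jac_has_derivative[OF M assms] by (rule has_derivative_linear)

lemma jac_inverse:
  assumes "c \<in> atlas M" "d \<in> atlas M" "x \<in> fst c" "x \<in> fst d" shows "jac d c x (jac c d x v) = v"
  using jac_jac[OF assms(1,2,1,3,4,3)] jac_self[OF charted assms(1,3)] by simp

lemma adjoint_jac_inner:
  assumes "c \<in> atlas M" "d \<in> atlas M" "x \<in> fst c" "x \<in> fst d"
  shows "adjoint (jac c d x) p \<bullet> v = p \<bullet> jac c d x v"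
  by (rule adjoint_clauses(2)[OF linear_jac[OF assms]])

lemma adjoint_jac_jac:
  assumes c: "c \<in> atlas M" and d: "d \<in> atlas M" and x: "x \<in> fst c" "x \<in> fst d"
  shows "adjoint (jac c d x) (adjoint (jac d c x) p) = p"
  by (rule vector_eq_rdot[THEN iffD1, rule_format])
     (simp add: adjoint_jac_inner[OF c d x] adjoint_jac_inner[OF d c x(2,1)] jac_inverse[OF c d x])

end

lemma fst_tangent_chart [simp]: "fst (tangent_chart M c) = fst c \<times> UNIV"
  and fst_cotangent_chart [simp]: "fst (cotangent_chart M c) = fst c \<times> UNIV"
  by (simp_all add: tangent_chart_def cotangent_chart_def)

lemma snd_tangent_chart: "snd (tangent_chart M c) z =
    (snd c (fst z), jac (chart_at M (fst z)) c (fst z) (snd z))"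
  and snd_cotangent_chart: "snd (cotangent_chart M c) z =
    (snd c (fst z), adjoint (jac c (chart_at M (fst z)) (fst z)) (snd z))"
  by (simp_all add: tangent_chart_def cotangent_chart_def jac_def case_prod_beta)

lemma atlas_tangent: "atlas (tangent M) = tangent_chart M ` atlas M"
  and chart_at_tangent [simp]: "chart_at (tangent M) z = tangent_chart M (chart_at M (fst z))"
  by (simp_all add: tangent_def case_prod_beta)

lemma atlas_cotangent: "atlas (cotangent M) = cotangent_chart M ` atlas M"
  and chart_at_cotangent [simp]: "chart_at (cotangent M) z = cotangent_chart M (chart_at M (fst z))"
  by (simp_all add: cotangent_def case_prod_beta)

lemma adjoint_id: "adjoint id = (id :: 'a::euclidean_space \<Rightarrow> 'a)"
  by (rule adjoint_unique) simp

lemma snd_tangent_chart_at: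
  "charted M \<Longrightarrow> snd (tangent_chart M (chart_at M (fst z))) z = (snd (chart_at M (fst z)) (fst z), snd z)"
  by (simp add: snd_tangent_chart jac_self chart_at_atlas chart_at_mem)

lemma snd_cotangent_chart_at:
  "charted M \<Longrightarrow> snd (cotangent_chart M (chart_at M (fst z))) z = (snd (chart_at M (fst z)) (fst z), snd z)"
  by (simp add: snd_cotangent_chart jac_self chart_at_atlas chart_at_mem adjoint_id)

lemma charted_tangent:
  assumes M: "smooth_atlas M" shows "charted (tangent M)"
  unfolding charted_def atlas_tangent
proof (intro conjI allI ballI)
  have cM: "charted M" using M by (rule smooth_atlas_imp_charted)
  note at = chart_at_atlas[OF cM] chart_at_mem[OF cM]
  show "chart_at (tangent M) z \<in> tangent_chart M ` atlas M" for z using at by simp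
  show "z \<in> fst (chart_at (tangent M) z)" for z using at by (simp add: mem_Times_iff)
  fix C assume "C \<in> tangent_chart M ` atlas M"
  then obtain c where C: "C = tangent_chart M c" and c: "c \<in> atlas M" by auto
  show "inj_on (snd C) (fst C)"
  proof (rule inj_onI)
    fix z w assume z: "z \<in> fst C" and w: "w \<in> fst C" and eq: "snd C z = snd C w"
    have "fst z = fst w" using eq z w chart_eq_iff[OF cM c] by (auto simp: C snd_tangent_chart)
    moreover have "snd z = snd w"
      using eq z w jac_inverse[OF M at(1) c at(2)] unfolding C snd_tangent_chart
      by (metis calculation fst_tangent_chart mem_Times_iff prod.inject)
    ultimately show "z = w" by (rule prod_eqI)
  qed
  have "snd C ` fst C = snd c ` fst c \<times> UNIV"
  proof (intro equalityI subsetI)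
    fix y assume "y \<in> snd c ` fst c \<times> (UNIV :: 'b set)"
    then obtain x w where x: "x \<in> fst c" "y = (snd c x, w)" by auto
    then have "snd C (x, jac c (chart_at M x) x w) = y"
      by (simp add: C snd_tangent_chart jac_inverse[OF M c at(1) _ at(2)])
    then show "y \<in> snd C ` fst C" by (rule image_eqI[OF sym]) (simp add: C x)
  qed (auto simp: C snd_tangent_chart)
  then show "open (snd C ` fst C)" using chart_open_image[OF cM c] by (simp add: open_Times)
qed

lemma charted_cotangent:
  assumes M: "smooth_atlas M" shows "charted (cotangent M)"
  unfolding charted_def atlas_cotangent
proof (intro conjI allI ballI)
  have cM: "charted M" using M by (rule smooth_atlas_imp_charted)
  note at = chart_at_atlas[OF cM] chart_at_mem[OF cM]
  show "chart_at (cotangent M) z \<in> cotangent_chart M ` atlas M" for z using at by simp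
  show "z \<in> fst (chart_at (cotangent M) z)" for z using at by (simp add: mem_Times_iff)
  fix C assume "C \<in> cotangent_chart M ` atlas M"
  then obtain c where C: "C = cotangent_chart M c" and c: "c \<in> atlas M" by auto
  show "inj_on (snd C) (fst C)"
  proof (rule inj_onI)
    fix z w assume z: "z \<in> fst C" and w: "w \<in> fst C" and eq: "snd C z = snd C w"
    have "fst z = fst w" using eq z w chart_eq_iff[OF cM c] by (auto simp: C snd_cotangent_chart)
    moreover have "snd z = snd w"
      using eq z w adjoint_jac_jac[OF M at(1) c at(2)] unfolding C snd_cotangent_chart
      by (metis calculation fst_cotangent_chart mem_Times_iff prod.inject)
    ultimately show "z = w" by (rule prod_eqI)
  qed
  have "snd C ` fst C = snd c ` fst c \<times> UNIV"
  proof (intro equalityI subsetI)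
    fix y assume "y \<in> snd c ` fst c \<times> (UNIV :: 'b set)"
    then obtain x w where x: "x \<in> fst c" "y = (snd c x, w)" by auto
    then have "snd C (x, adjoint (jac (chart_at M x) c x) w) = y"
      by (simp add: C snd_cotangent_chart adjoint_jac_jac[OF M c at(1) _ at(2)])
    then show "y \<in> snd C ` fst C" by (rule image_eqI[OF sym]) (simp add: C x)
  qed (auto simp: C snd_cotangent_chart)
  then show "open (snd C ` fst C)" using chart_open_image[OF cM c] by (simp add: open_Times)
qed

text \<open>By the cocycle rule the preferred chart cancels: covector components change by the
  transpose of the derivative of the inverse transition \<open>\<kappa>'\<close>, taken at the new
  base point. Written out in a basis this is a smooth expression.\<close>

lemma smooth_atlas_cotangent:
  assumes M: "smooth_atlas M" shows "smooth_atlas (cotangent M)"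
  unfolding smooth_atlas_def
proof (intro conjI ballI)
  show cC: "charted (cotangent M)" by (rule charted_cotangent[OF M])
  have cM: "charted M" using M by (rule smooth_atlas_imp_charted)
  note at = chart_at_atlas[OF cM] chart_at_mem[OF cM]
  fix C D assume CD: "C \<in> atlas (cotangent M)" "D \<in> atlas (cotangent M)"
  then obtain c d where C: "C = cotangent_chart M c" and D: "D = cotangent_chart M d"
    and c: "c \<in> atlas M" and d: "d \<in> atlas M" by (auto simp: atlas_cotangent)
  define \<kappa> where "\<kappa> = snd d \<circ> chart_inv c"
  define \<kappa>' where "\<kappa>' = snd c \<circ> chart_inv d"
  define S where "S = snd c ` (fst c \<inter> fst d) \<times> (UNIV :: 'b set)"
  have \<kappa>: "smooth_on (snd c ` (fst c \<inter> fst d)) \<kappa>" and \<kappa>': "smooth_on (snd d ` (fst c \<inter> fst d)) \<kappa>'"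
    using M c d unfolding smooth_atlas_def \<kappa>_def \<kappa>'_def by (simp, metis Int_commute)
  have o: "open S" unfolding S_def using smooth_on_open[OF \<kappa>] by (simp add: open_Times)
  have s1: "smooth_on S (\<lambda>y. \<kappa> (fst y))"
    by (rule smooth_on_compose[OF smooth_on_linear[OF bounded_linear_fst o] \<kappa>]) (auto simp: S_def)
  have s2: "smooth_on S (\<lambda>y. frechet_derivative \<kappa>' (at (\<kappa> (fst y))) b)" for b
    by (rule smooth_on_compose[OF s1 smooth_on_derivative[OF \<kappa>']])
       (auto simp: S_def \<kappa>_def chart_inv_chart[OF cM c])
  have "smooth_on S (\<lambda>y. (\<kappa> (fst y), \<Sum>b\<in>Basis. (snd y \<bullet> frechet_derivative \<kappa>' (at (\<kappa> (fst y))) b) *\<^sub>R b))"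
    by (intro smooth_on_Pair s1 s2 smooth_on_sum o smooth_on_bilinear[OF bounded_bilinear_scaleR]
        smooth_on_bilinear[OF bounded_bilinear_inner] smooth_on_const smooth_on_linear[OF bounded_linear_snd]) auto
  moreover have img: "snd C ` (fst C \<inter> fst D) = S"
  proof (intro equalityI subsetI)
    fix y assume "y \<in> S"
    then obtain x w where x: "x \<in> fst c" "x \<in> fst d" "y = (snd c x, w)" by (auto simp: S_def)
    then have "snd C (x, adjoint (jac (chart_at M x) c x) w) = y"
      by (simp add: C snd_cotangent_chart adjoint_jac_jac[OF M c at(1) _ at(2)])
    then show "y \<in> snd C ` (fst C \<inter> fst D)" by (rule image_eqI[OF sym]) (simp add: C D x)
  qed (auto simp: C D S_def snd_cotangent_chart)
  ultimately have "smooth_on (snd C ` (fst C \<inter> fst D))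
    (\<lambda>y. (\<kappa> (fst y), \<Sum>b\<in>Basis. (snd y \<bullet> frechet_derivative \<kappa>' (at (\<kappa> (fst y))) b) *\<^sub>R b))" by simp
  then show "smooth_on (snd C ` (fst C \<inter> fst D)) (snd D \<circ> chart_inv C)"
  proof (rule smooth_on_cong[rotated])
    fix y assume "y \<in> snd C ` (fst C \<inter> fst D)"
    then obtain z where z: "z \<in> fst C" "z \<in> fst D" "y = snd C z" by auto
    define x where "x = fst z"
    have x: "x \<in> fst c" "x \<in> fst d" using z by (auto simp: C D x_def)
    let ?e = "chart_at M x"
    have y: "fst y = snd c x" "snd y = adjoint (jac c ?e x) (snd z)" "\<kappa> (fst y) = snd d x"
      using x by (simp_all add: z(3) C snd_cotangent_chart x_def \<kappa>_def chart_inv_chart[OF cM c])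
    have "snd y \<bullet> frechet_derivative \<kappa>' (at (\<kappa> (fst y))) b = adjoint (jac d ?e x) (snd z) \<bullet> b" for b
    proof -
      have "snd y \<bullet> frechet_derivative \<kappa>' (at (\<kappa> (fst y))) b = adjoint (jac c ?e x) (snd z) \<bullet> jac d c x b"
        unfolding y(2,3) by (simp add: jac_def \<kappa>'_def)
      also have "\<dots> = snd z \<bullet> jac d ?e x b"
        by (simp add: adjoint_jac_inner[OF M c at(1) x(1) at(2)] jac_jac[OF M d c at(1) x(2,1) at(2)])
      finally show ?thesis by (simp add: adjoint_jac_inner[OF M d at(1) x(2) at(2)])
    qed
    then have "(\<kappa> (fst y), \<Sum>b\<in>Basis. (snd y \<bullet> frechet_derivative \<kappa>' (at (\<kappa> (fst y))) b) *\<^sub>R b) = snd D z"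
      by (simp add: euclidean_representation y(3) D snd_cotangent_chart x_def)
    then show "(\<kappa> (fst y), \<Sum>b\<in>Basis. (snd y \<bullet> frechet_derivative \<kappa>' (at (\<kappa> (fst y))) b) *\<^sub>R b)
        = (snd D \<circ> chart_inv C) y"
      using z chart_inv_chart[OF cC CD(1) z(1)] by simp
  qed
qed

lemma chart_inv_tangent:
  assumes M: "smooth_atlas M" and c: "c \<in> atlas M" "x \<in> fst c"
  shows "chart_inv (tangent_chart M c) (snd c x, w) = (x, jac c (chart_at M x) x w)"
proof -
  have cM: "charted M" using M by (rule smooth_atlas_imp_charted)
  have "snd (tangent_chart M c) (x, jac c (chart_at M x) x w) = (snd c x, w)"
    using c by (simp add: snd_tangent_chart jac_inverse[OF M] chart_at_atlas[OF cM] chart_at_mem[OF cM])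
  moreover have "tangent_chart M c \<in> atlas (tangent M)" using c by (simp add: atlas_tangent)
  ultimately show ?thesis
    using chart_inv_chart[OF charted_tangent[OF M], of "tangent_chart M c" "(x, jac c (chart_at M x) x w)"] c
    by simp
qed

text \<open>Covector components change by the transposed inverse of the Jacobian, which cancels in
  the pairing. The term \<open>p \<bullet> v\<close> of the generating function can thus be computed
  in a fixed chart.\<close>

lemma chart_pairing:
  assumes M: "smooth_atlas M" and c: "c \<in> atlas M" "x \<in> fst c"
  shows "snd (snd (cotangent_chart M c) (x, p)) \<bullet> snd (snd (tangent_chart M c) (x, v)) = p \<bullet> v"
proof -
  have cM: "charted M" using M by (rule smooth_atlas_imp_charted)
  note at = chart_at_atlas[OF cM] chart_at_mem[OF cM]
  show ?thesis
    using c by (simp add: snd_tangent_chart snd_cotangent_chart adjoint_jac_inner[OF M c(1) at(1) c(2) at(2)]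
        jac_inverse[OF M at(1) c(1) at(2) c(2)])
qed

lemma covector_inner:
  fixes l :: "'a::euclidean_space \<Rightarrow> real"
  assumes "linear l" shows "covector l \<bullet> v = l v"
proof -
  have "l v = l (\<Sum>b\<in>Basis. (v \<bullet> b) *\<^sub>R b)" by (simp add: euclidean_representation)
  also have "\<dots> = (\<Sum>b\<in>Basis. (v \<bullet> b) * l b)" by (simp add: linear_sum[OF assms] linear_cmul[OF assms])
  also have "\<dots> = covector l \<bullet> v" by (simp add: covector_def inner_sum_left inner_commute[of v] mult.commute)
  finally show ?thesis by simp
qed

lemma jac_prod_chart:
  assumes M: "smooth_atlas M" and N: "smooth_atlas N"
    and c: "c \<in> atlas M" "c' \<in> atlas M" "x \<in> fst c" "x \<in> fst c'"
    and d: "d \<in> atlas N" "d' \<in> atlas N" "y \<in> fst d" "y \<in> fst d'"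
  shows "jac (prod_chart c d) (prod_chart c' d') (x, y) = map_prod (jac c c' x) (jac d d' y)"
proof -
  have cM: "charted M" and cN: "charted N" using M N smooth_atlas_imp_charted by auto
  have "(map_prod (snd c' \<circ> chart_inv c) (snd d' \<circ> chart_inv d) has_derivative
      map_prod (jac c c' x) (jac d d' y)) (at (snd c x, snd d y))"
    unfolding map_prod_def case_prod_beta
    by (intro has_derivative_Pair has_derivative_compose[OF has_derivative_fst[OF has_derivative_ident]]
        has_derivative_compose[OF has_derivative_snd[OF has_derivative_ident]])
       (use jac_has_derivative[OF M c] jac_has_derivative[OF N d] in \<open>simp_all add: comp_def\<close>)
  then have "((snd (prod_chart c' d') \<circ> chart_inv (prod_chart c d)) has_derivative
      map_prod (jac c c' x) (jac d d' y)) (at (snd c x, snd d y))"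
  proof (rule has_derivative_transform_within_open)
    show "open (snd c ` fst c \<times> snd d ` fst d)"
      by (rule open_Times[OF chart_open_image[OF cM c(1)] chart_open_image[OF cN d(1)]])
    show "(snd c x, snd d y) \<in> snd c ` fst c \<times> snd d ` fst d" using c d by auto
    show "map_prod (snd c' \<circ> chart_inv c) (snd d' \<circ> chart_inv d) z =
        (snd (prod_chart c' d') \<circ> chart_inv (prod_chart c d)) z"
      if "z \<in> snd c ` fst c \<times> snd d ` fst d" for z
      using that by (auto simp: prod_chart_inv chart_inj_on[OF cM c(1)] chart_inj_on[OF cN d(1)]
          chart_inv_chart[OF cM c(1)] chart_inv_chart[OF cN d(1)])
  qed
  then show ?thesis by (simp add: jac_def frechet_derivative_at[symmetric])
qed

text \<open>\<open>g \<circ> f\<close> is known to be the identity on \<open>U\<close> only, so its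
  representative is compared with the identity on the open chart image of \<open>U\<close>.\<close>

lemma mderiv_left_inverse:
  assumes M: "charted M" and N: "charted N" and f: "smooth_map_on M N U f"
    and g: "smooth_map_on N M V g" and x: "x \<in> U" "f x \<in> V" and gf: "\<And>x. x \<in> U \<Longrightarrow> g (f x) = x"
  shows "mderiv N M g (f x) \<circ> mderiv M N f x = id"
proof -
  let ?c = "chart_at M x"
  have c: "?c \<in> atlas M" "x \<in> fst ?c" using M by (simp_all add: chart_at_atlas chart_at_mem)
  have "((snd (chart_at M (g (f x))) \<circ> (g \<circ> f) \<circ> chart_inv ?c) has_derivative
      mderiv N M g (f x) \<circ> mderiv M N f x) (at (snd ?c x))"
    by (rule rep_compose_has_derivative[OF M N f c(1) chart_at_atlas[OF N] x(1) c(2) chart_at_mem[OF N]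
      mderiv_has_derivative[OF f M N x(1)] mderiv_has_derivative[OF g N M x(2)]])
  then have "((\<lambda>y. y) has_derivative mderiv N M g (f x) \<circ> mderiv M N f x) (at (snd ?c x))"
  proof (rule has_derivative_transform_within_open)
    show "open (snd ?c ` (U \<inter> fst ?c))" using f c by (simp add: smooth_map_on_def mopen_def)
    show "snd ?c x \<in> snd ?c ` (U \<inter> fst ?c)" using x c by auto
    show "(snd (chart_at M (g (f x))) \<circ> (g \<circ> f) \<circ> chart_inv ?c) y = y" if "y \<in> snd ?c ` (U \<inter> fst ?c)" for y
      using that x by (auto simp: gf chart_inv_chart[OF M c(1)])
  qed
  from has_derivative_unique[OF this has_derivative_ident] show ?thesis by (simp add: id_def)
qed

section \<open>Symplecticity of discretized Hamiltonian flows\<close>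

text \<open>Formulated over an arbitrary base manifold and Hamiltonian, since symplecticity of
  \<open>\<Psi>\<close> does not depend on the splitting into space and time.\<close>

locale discrete_flow =
  fixes N :: "('m, 'a::euclidean_space) mfd" and U :: "('m \<times> 'a) set" and R :: "'m \<times> 'a \<Rightarrow> 'm \<times> 'm"
    and h :: real and f :: "'m \<times> 'a \<Rightarrow> real" and \<Psi> :: "'m \<times> 'a \<Rightarrow> 'm \<times> 'a"
  assumes N: "smooth_atlas N"
    and R: "diffeo_onto_image (tangent N) (N \<times>\<^sub>M N) U R"
    and f: "smooth_map (cotangent N) euclid f"
    and \<Psi>: "smooth_map (cotangent N) (cotangent N) \<Psi>"
    and rel: "\<And>z. (z, \<Psi> z) \<in> discrete_relation N U R h f"
begin

lemma charted_N: "charted N" using N by (rule smooth_atlas_imp_charted)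

lemmas at_N = chart_at_atlas[OF charted_N] chart_at_mem[OF charted_N]
lemmas charted_T = charted_tangent[OF N]
lemmas charted_C = charted_cotangent[OF N]
lemmas atlas_NN = smooth_atlas_prod_mfd[OF N N]
lemmas charted_NN = smooth_atlas_imp_charted[OF atlas_NN]

lemma R_smooth: "smooth_map_on (tangent N) (N \<times>\<^sub>M N) U R"
  and R_inj: "inj_on R U"
  and R_inv_smooth: "smooth_map_on (N \<times>\<^sub>M N) (tangent N) (R ` U) (inv_into U R)"
  using R by (simp_all add: diffeo_onto_image_def)

abbreviation "df \<equiv> mderiv (cotangent N) euclid f"
abbreviation "TR \<equiv> mderiv (tangent N) (N \<times>\<^sub>M N) R"

lemma linear_df: "linear (df \<zeta>)"
  by (rule linear_mderiv[OF f charted_C charted_euclid]) simp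

lemma linear_TR: "\<xi> \<in> U \<Longrightarrow> linear (TR \<xi>)"
  by (rule linear_mderiv[OF R_smooth charted_T charted_NN])

lemma inj_TR:
  assumes "\<xi> \<in> U" shows "inj (TR \<xi>)"
proof -
  have "mderiv (N \<times>\<^sub>M N) (tangent N) (inv_into U R) (R \<xi>) \<circ> TR \<xi> = id"
    by (rule mderiv_left_inverse[OF charted_T charted_NN R_smooth R_inv_smooth assms])
       (use assms R_inj in auto)
  then show ?thesis by (metis inj_on_id inj_on_imageI2)
qed

section \<open>The generating point, velocity and momentum of a pair\<close>

definition gen_point :: "'m \<times> 'a \<Rightarrow> 'm" where
  "gen_point z = fst (inv_into U R (fst z, fst (\<Psi> z)))"

definition gen_velocity :: "'m \<times> 'a \<Rightarrow> 'a" where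
  "gen_velocity z = snd (inv_into U R (fst z, fst (\<Psi> z)))"

text \<open>The clauses are \<open>v = h \<partial>f/\<partial>p\<close> and the cotangent lift of
  \<open>R\<close> tested on \<open>\<xi>\<close>. At \<open>\<xi> = (0, b)\<close> the right side
  of the second is \<open>p \<bullet> b\<close>, so the chosen momentum is unique.\<close>

definition gen_momentum :: "'m \<times> 'a \<Rightarrow> 'a" where
  "gen_momentum z = (SOME p. (\<forall>b. gen_velocity z \<bullet> b = h * df (gen_point z, p) (0, b)) \<and>
     (\<forall>\<xi>. (- snd z, snd (\<Psi> z)) \<bullet> TR (gen_point z, gen_velocity z) \<xi>
       = p \<bullet> snd \<xi> - h * df (gen_point z, p) (fst \<xi>, 0)))"

text \<open>The lift contains the inverse of \<open>TR\<close>; since \<open>TR\<close> is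
  injective, testing on vectors \<open>TR (x, v) \<xi>\<close> removes it. The minus signs come from
  \<open>I_tangent\<close>, giving \<open>- h \<partial>f/\<partial>x\<close>, and from
  \<open>Phi\<close>, giving \<open>- p\<^sub>0\<close>.\<close>

lemma gen_exists:
  "(gen_point z, gen_velocity z) \<in> U"
  "R (gen_point z, gen_velocity z) = (fst z, fst (\<Psi> z))"
  "\<exists>p. (\<forall>b. gen_velocity z \<bullet> b = h * df (gen_point z, p) (0, b)) \<and>
     (\<forall>\<xi>. (- snd z, snd (\<Psi> z)) \<bullet> TR (gen_point z, gen_velocity z) \<xi>
       = p \<bullet> snd \<xi> - h * df (gen_point z, p) (fst \<xi>, 0))"
proof -
  obtain x p where eq: "Phi (z, \<Psi> z) =
      cotangent_lift (tangent N) (N \<times>\<^sub>M N) R (I_tangent (scaled_differential (cotangent N) h f (x, p)))"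
    and mem: "fst (I_tangent (scaled_differential (cotangent N) h f (x, p))) \<in> U"
    using rel[of z] unfolding discrete_relation_def by auto
  define m where "m = covector (df (x, p))"
  define v where "v = h *\<^sub>R snd m"
  have m: "m \<bullet> w = df (x, p) w" for w unfolding m_def by (rule covector_inner[OF linear_df])
  have I: "I_tangent (scaled_differential (cotangent N) h f (x, p)) = ((x, v), (- (h *\<^sub>R fst m), p))"
    by (simp add: I_tangent_def scaled_differential_def m_def v_def case_prod_beta)
  have xv: "(x, v) \<in> U" using mem I by simp
  have Rxv: "R (x, v) = (fst z, fst (\<Psi> z))"
    and cov: "(- snd z, snd (\<Psi> z)) = covector (\<lambda>w. (- (h *\<^sub>R fst m), p) \<bullet> inv (TR (x, v)) w)"
    using eq unfolding I by (simp_all add: Phi_def cotangent_lift_def case_prod_beta)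
  have inv: "inv_into U R (fst z, fst (\<Psi> z)) = (x, v)"
    using inv_into_f_f[OF R_inj xv] Rxv by simp
  have pv: "gen_point z = x" "gen_velocity z = v" by (simp_all add: gen_point_def gen_velocity_def inv)
  show "(gen_point z, gen_velocity z) \<in> U" "R (gen_point z, gen_velocity z) = (fst z, fst (\<Psi> z))"
    using xv Rxv by (simp_all add: pv)
  have lin: "linear (inv (TR (x, v)))"
    by (rule inj_linear_imp_inv_linear[OF linear_TR[OF xv] inj_TR[OF xv]])
  have "linear (\<lambda>w. (- (h *\<^sub>R fst m), p) \<bullet> inv (TR (x, v)) w)"
    by (rule linear_compose[OF lin, unfolded comp_def, of "\<lambda>w. (- (h *\<^sub>R fst m), p) \<bullet> w"])
       (intro bounded_linear.linear bounded_linear_inner_right)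
  from covector_inner[OF this]
  have "(- snd z, snd (\<Psi> z)) \<bullet> TR (x, v) \<xi> = (- (h *\<^sub>R fst m), p) \<bullet> \<xi>" for \<xi>
    by (simp add: cov inv_f_f[OF inj_TR[OF xv]])
  moreover have "fst m \<bullet> a = df (x, p) (a, 0)" for a using m[of "(a, 0)"] by (simp add: inner_prod_def)
  moreover have "snd m \<bullet> b = df (x, p) (0, b)" for b using m[of "(0, b)"] by (simp add: inner_prod_def)
  ultimately show "\<exists>p. (\<forall>b. gen_velocity z \<bullet> b = h * df (gen_point z, p) (0, b)) \<and>
     (\<forall>\<xi>. (- snd z, snd (\<Psi> z)) \<bullet> TR (gen_point z, gen_velocity z) \<xi>
       = p \<bullet> snd \<xi> - h * df (gen_point z, p) (fst \<xi>, 0))"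
    unfolding pv by (intro exI[of _ p]) (simp add: v_def inner_prod_def)
qed

abbreviation "gen z \<equiv> (gen_point z, gen_momentum z)"

lemma gen_velocity_inner: "gen_velocity z \<bullet> b = h * df (gen z) (0, b)"
  and gen_equation: "(- snd z, snd (\<Psi> z)) \<bullet> TR (gen_point z, gen_velocity z) \<xi>
    = gen_momentum z \<bullet> snd \<xi> - h * df (gen z) (fst \<xi>, 0)"
  using someI_ex[OF gen_exists(3)[of z]] unfolding gen_momentum_def by blast+

lemma inv_R_gen: "inv_into U R (fst z, fst (\<Psi> z)) = (gen_point z, gen_velocity z)"
  by (simp add: gen_point_def gen_velocity_def)

section \<open>The generating equations in charts around the two base points\<close>

context
  fixes d0 d1 assumes d0: "d0 \<in> atlas N" and d1: "d1 \<in> atlas N"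
begin

definition rep_R :: "('m, 'a) chart \<Rightarrow> 'a \<times> 'a \<Rightarrow> 'a \<times> 'a" where
  "rep_R c = snd (prod_chart d0 d1) \<circ> R \<circ> chart_inv (tangent_chart N c)"

lemma target_chart: "prod_chart d0 d1 \<in> atlas (N \<times>\<^sub>M N)"
  using d0 d1 by (auto simp: atlas_prod_mfd)

lemma rep_R_smooth:
  assumes "c \<in> atlas N"
  shows "smooth_on (snd (tangent_chart N c) ` (fst (tangent_chart N c) \<inter> U \<inter> R -` fst (prod_chart d0 d1))) (rep_R c)"
  unfolding rep_R_def
  by (rule smooth_map_onD[OF R_smooth _ target_chart]) (simp add: atlas_tangent assms)

lemma rep_R_has_derivative:
  assumes "c \<in> atlas N" "gen_point z \<in> fst c" "fst z \<in> fst d0" "fst (\<Psi> z) \<in> fst d1"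
  shows "(rep_R c has_derivative frechet_derivative (rep_R c)
      (at (snd (tangent_chart N c) (gen_point z, gen_velocity z))))
    (at (snd (tangent_chart N c) (gen_point z, gen_velocity z)))"
  by (rule smooth_on_has_derivative[OF rep_R_smooth[OF assms(1)]])
     (use assms gen_exists(1,2)[of z] in auto)

text \<open>The target charts \<open>d0\<close> and \<open>d1\<close> change \<open>TR\<close> by
  Jacobians and the covectors by their transposed inverses, so the pairing is that of
  \<open>gen_equation\<close>. The source chart stays the preferred one at the generating
  point.\<close>

lemma derivative_rep_R:
  assumes z: "fst z \<in> fst d0" "fst (\<Psi> z) \<in> fst d1"
  defines "c \<equiv> chart_at N (gen_point z)"
  shows "(- snd (snd (cotangent_chart N d0) z), snd (snd (cotangent_chart N d1) (\<Psi> z)))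
      \<bullet> frechet_derivative (rep_R c) (at (snd (tangent_chart N c) (gen_point z, gen_velocity z))) \<xi>
    = gen_momentum z \<bullet> snd \<xi> - h * df (gen z) (fst \<xi>, 0)"
proof -
  let ?e0 = "chart_at N (fst z)" and ?e1 = "chart_at N (fst (\<Psi> z))"
  let ?xv = "(gen_point z, gen_velocity z)"
  have Rxv: "R ?xv = (fst z, fst (\<Psi> z))" and xv: "?xv \<in> U" by (rule gen_exists)+
  have "((snd (prod_chart d0 d1) \<circ> id \<circ> chart_inv (prod_chart ?e0 ?e1)) has_derivative
      jac (prod_chart ?e0 ?e1) (prod_chart d0 d1) (fst z, fst (\<Psi> z)))
      (at (snd (prod_chart ?e0 ?e1) (R ?xv)))"
    unfolding Rxv comp_id
    by (rule jac_has_derivative[OF atlas_NN]) (use at_N z d0 d1 in \<open>auto simp: atlas_prod_mfd\<close>)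
  then have "((snd (prod_chart d0 d1) \<circ> (id \<circ> R) \<circ> chart_inv (tangent_chart N c)) has_derivative
      jac (prod_chart ?e0 ?e1) (prod_chart d0 d1) (fst z, fst (\<Psi> z)) \<circ> TR ?xv)
      (at (snd (tangent_chart N c) ?xv))"
    using mderiv_has_derivative[OF R_smooth charted_T charted_NN xv]
    by (intro rep_compose_has_derivative[OF charted_T charted_NN R_smooth _ _ xv, where d="prod_chart ?e0 ?e1"])
       (use at_N Rxv in \<open>auto simp: atlas_prod_mfd atlas_tangent c_def\<close>)
  then have "frechet_derivative (rep_R c) (at (snd (tangent_chart N c) ?xv)) =
      map_prod (jac ?e0 d0 (fst z)) (jac ?e1 d1 (fst (\<Psi> z))) \<circ> TR ?xv"
    by (simp add: rep_R_def frechet_derivative_at[symmetric]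
        jac_prod_chart[OF N N at_N(1) d0 at_N(2) z(1) at_N(1) d1 at_N(2) z(2)])
  then have "(- snd (snd (cotangent_chart N d0) z), snd (snd (cotangent_chart N d1) (\<Psi> z)))
      \<bullet> frechet_derivative (rep_R c) (at (snd (tangent_chart N c) ?xv)) \<xi>
    = (- snd z, snd (\<Psi> z)) \<bullet> TR ?xv \<xi>"
    by (simp add: snd_cotangent_chart inner_prod_def
        adjoint_jac_inner[OF N d0 at_N(1) z(1) at_N(2)] adjoint_jac_inner[OF N d1 at_N(1) z(2) at_N(2)]
        jac_inverse[OF N at_N(1) d0 at_N(2) z(1)] jac_inverse[OF N at_N(1) d1 at_N(2) z(2)])
  then show ?thesis using gen_equation by simp
qed

text \<open>
  Along the fibres of the tangent bundle a change of chart is linear, so this equation holds in any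
  chart, whereas the preceding one would acquire second derivatives of the transition map.
\<close>

lemma vertical_derivative_rep_R:
  assumes z: "fst z \<in> fst d0" "fst (\<Psi> z) \<in> fst d1"
    and c: "c \<in> atlas N" "gen_point z \<in> fst c"
  shows "(- snd (snd (cotangent_chart N d0) z), snd (snd (cotangent_chart N d1) (\<Psi> z)))
      \<bullet> frechet_derivative (rep_R c) (at (snd (tangent_chart N c) (gen_point z, gen_velocity z))) (0, b)
    = snd (snd (cotangent_chart N c) (gen z)) \<bullet> b"
proof -
  let ?x = "gen_point z" and ?v = "gen_velocity z"
  let ?e = "chart_at N ?x"
  let ?y = "\<lambda>c. snd (tangent_chart N c) (?x, ?v)"
  let ?r = "\<lambda>c. frechet_derivative (rep_R c) (at (?y c))"
  have lin: "((\<lambda>w. (snd c' ?x, L w)) has_derivative (\<lambda>w. (0, L w))) (at w0)" if "linear L"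
    for c' :: "('m, 'a) chart" and L :: "'a \<Rightarrow> 'a" and w0
    using that by (intro has_derivative_Pair has_derivative_const linear_imp_has_derivative)
  have y: "?y c = (snd c ?x, snd (?y c))" "?y ?e = (snd ?e ?x, jac c ?e ?x (snd (?y c)))"
    by (simp_all add: snd_tangent_chart jac_self[OF charted_N at_N] jac_inverse[OF N at_N(1) c(1) at_N(2) c(2)])
  have "((\<lambda>w. rep_R c (snd c ?x, id w)) has_derivative (\<lambda>w. ?r c (0, id w))) (at (snd (?y c)))"
    by (rule has_derivative_compose[OF lin[OF linear_id], where g="rep_R c"])
       (use rep_R_has_derivative[OF c z] y(1) in auto)
  moreover have "((\<lambda>w. rep_R ?e (snd ?e ?x, jac c ?e ?x w)) has_derivative (\<lambda>w. ?r ?e (0, jac c ?e ?x w))) (at (snd (?y c)))"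
    by (rule has_derivative_compose[OF lin[OF linear_jac[OF N c(1) at_N(1) c(2) at_N(2)]], where g="rep_R ?e"])
       (use rep_R_has_derivative[OF at_N z] y(2) in auto)
  moreover have "rep_R ?e (snd ?e ?x, jac c ?e ?x w) = rep_R c (snd c ?x, id w)" for w
    by (simp add: rep_R_def chart_inv_tangent[OF N] c at_N jac_self[OF charted_N at_N] del: fst_tangent_chart)
  ultimately have "?r c (0, b) = ?r ?e (0, jac c ?e ?x b)"
    by (auto dest: has_derivative_unique simp: fun_eq_iff)
  moreover have "df (gen z) (0, 0) = 0" using linear_0[OF linear_df] by (simp add: zero_prod_def)
  ultimately show ?thesis
    using derivative_rep_R[OF z, of "(0, jac c ?e ?x b)"]
    by (simp add: snd_cotangent_chart adjoint_jac_inner[OF N c(1) at_N(1) c(2) at_N(2)])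
qed

definition rep_\<Psi> :: "'a \<times> 'a \<Rightarrow> 'a \<times> 'a" where
  "rep_\<Psi> = snd (cotangent_chart N d1) \<circ> \<Psi> \<circ> chart_inv (cotangent_chart N d0)"

definition dom_\<Psi> :: "('a \<times> 'a) set" where
  "dom_\<Psi> = snd (cotangent_chart N d0) ` (fst (cotangent_chart N d0) \<inter> \<Psi> -` fst (cotangent_chart N d1))"

lemma rep_\<Psi>_smooth: "smooth_on dom_\<Psi> rep_\<Psi>"
  using smooth_map_onD[OF \<Psi>, of "cotangent_chart N d0" "cotangent_chart N d1"] d0 d1
  by (simp add: dom_\<Psi>_def rep_\<Psi>_def atlas_cotangent)

text \<open>The discrete action, kept as a function of the phase point \<open>z\<^sub>0\<close> so
  that the base points \<open>(x\<^sub>0, x\<^sub>1)\<close> need not be coordinates on the graph of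
  \<open>\<Psi>\<close>.\<close>

definition gen_function :: "'a \<times> 'a \<Rightarrow> real" where
  "gen_function = (\<lambda>z. gen_momentum z \<bullet> gen_velocity z - h * f (gen z)) \<circ> chart_inv (cotangent_chart N d0)"

text \<open>In \<open>d (p \<bullet> v - h f)\<close> the terms \<open>v dp\<close> and
  \<open>h \<partial>f/\<partial>p dp\<close> cancel. What is left,
  \<open>p dv - h \<partial>f/\<partial>x dx\<close>, is by \<open>derivative_rep_R\<close> the
  pairing of \<open>(- p\<^sub>0, p\<^sub>1)\<close> with the derivative of \<open>R\<close> on
  \<open>(dx, dv)\<close>, that is, with \<open>(dx\<^sub>0, dx\<^sub>1)\<close>.\<close>

lemma gen_function_has_derivative:
  assumes "y0 \<in> dom_\<Psi>"
  shows "(gen_function has_derivative (\<lambda>u. snd (rep_\<Psi> y0) \<bullet> fst (frechet_derivative rep_\<Psi> (at y0) u)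
    - snd y0 \<bullet> fst u)) (at y0)"
proof -
  let ?C0 = "cotangent_chart N d0" and ?C1 = "cotangent_chart N d1" and ?D = "prod_chart d0 d1"
  have C0: "?C0 \<in> atlas (cotangent N)" "?C1 \<in> atlas (cotangent N)" using d0 d1 by (auto simp: atlas_cotangent)
  have inv_dom: "\<exists>z. y = snd ?C0 z \<and> chart_inv ?C0 y = z \<and> fst z \<in> fst d0 \<and> fst (\<Psi> z) \<in> fst d1" if "y \<in> dom_\<Psi>" for y
    using that chart_inv_chart[OF charted_C C0(1)] by (fastforce simp: dom_\<Psi>_def mem_Times_iff)
  obtain z where z: "y0 = snd ?C0 z" "chart_inv ?C0 y0 = z" "fst z \<in> fst d0" "fst (\<Psi> z) \<in> fst d1"
    using inv_dom[OF assms] by blast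
  \<comment> \<open>\<open>c\<close> stays fixed while \<open>y\<close> varies. At \<open>y0\<close>
    it is the preferred chart of the generating point, so \<open>derivative_rep_R\<close> is
    available there; elsewhere only the vertical equation is used.\<close>
  define c where "c = chart_at N (gen_point z)"
  have c: "c \<in> atlas N" "gen_point z \<in> fst c" by (simp_all add: c_def at_N)
  let ?T = "tangent_chart N c"
  have T: "?T \<in> atlas (tangent N)" using c by (simp add: atlas_tangent)
  define Sd where "Sd = snd ?D ` (fst ?D \<inter> R ` U \<inter> inv_into U R -` fst ?T)"
  define s0 where "s0 = snd ?T \<circ> inv_into U R \<circ> chart_inv ?D"
  have s0: "smooth_on Sd s0" unfolding Sd_def s0_def by (rule smooth_map_onD[OF R_inv_smooth target_chart T])
  \<comment> \<open>Coordinates of \<open>(x\<^sub>0, x\<^sub>1)\<close>, from which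
    \<open>s0\<close> produces those of \<open>(x, v)\<close>.\<close>
  define \<alpha> where "\<alpha> y = (fst y, fst (rep_\<Psi> y))" for y
  have odom: "open dom_\<Psi>" by (rule smooth_on_open[OF rep_\<Psi>_smooth])
  have \<alpha>: "smooth_on dom_\<Psi> \<alpha>" unfolding \<alpha>_def
    by (intro smooth_on_Pair smooth_on_linear[OF bounded_linear_fst] odom
        smooth_on_compose[OF rep_\<Psi>_smooth smooth_on_linear[OF bounded_linear_fst open_UNIV]]) auto
  \<comment> \<open>The region where the generating point lies in the domain of the fixed chart
    \<open>c\<close>.\<close>
  define W where "W = dom_\<Psi> \<inter> \<alpha> -` Sd"
  have oW: "open W" unfolding W_def by (rule smooth_on_preimage[OF \<alpha> smooth_on_open[OF s0]])
  define s where "s y = s0 (\<alpha> y)" for y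
  have s: "smooth_on W s" unfolding s_def
    by (rule smooth_on_compose[OF smooth_on_subset[OF \<alpha> oW] s0]) (auto simp: W_def)
  have \<alpha>_eq: "\<alpha> (snd ?C0 z) = snd ?D (fst z, fst (\<Psi> z))" if "fst z \<in> fst d0" for z
    using that chart_inv_chart[OF charted_C C0(1), of z]
    by (simp add: \<alpha>_def rep_\<Psi>_def snd_cotangent_chart mem_Times_iff)
  have s_eq: "s (snd ?C0 z) = snd ?T (gen_point z, gen_velocity z)"
    if "fst z \<in> fst d0" "fst (\<Psi> z) \<in> fst d1" for z
    using that chart_inv_chart[OF charted_NN target_chart, of "(fst z, fst (\<Psi> z))"]
    by (simp add: s_def \<alpha>_eq s0_def inv_R_gen del: snd_prod_chart)
  have y0W: "y0 \<in> W"
    unfolding W_def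
  proof (intro IntI assms)
    have "(fst z, fst (\<Psi> z)) \<in> R ` U" by (metis gen_exists(1,2) imageI)
    then show "y0 \<in> \<alpha> -` Sd"
      using z c by (auto simp: Sd_def \<alpha>_eq inv_R_gen simp del: snd_prod_chart)
  qed
  have inv_W: "\<exists>z. y = snd ?C0 z \<and> chart_inv ?C0 y = z \<and> fst z \<in> fst d0 \<and> fst (\<Psi> z) \<in> fst d1 \<and> gen_point z \<in> fst c"
    if "y \<in> W" for y
  proof -
    obtain z where z: "y = snd ?C0 z" "chart_inv ?C0 y = z" "fst z \<in> fst d0" "fst (\<Psi> z) \<in> fst d1"
      using inv_dom[of y] \<open>y \<in> W\<close> by (auto simp: W_def)
    have "\<alpha> y \<in> Sd" using \<open>y \<in> W\<close> by (simp add: W_def)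
    then obtain w where w: "w \<in> fst ?D" "inv_into U R w \<in> fst ?T" "snd ?D (fst z, fst (\<Psi> z)) = snd ?D w"
      by (auto simp: Sd_def z(1) \<alpha>_eq[OF z(3)] simp del: snd_prod_chart)
    then have "w = (fst z, fst (\<Psi> z))"
      using chart_eq_iff[OF charted_NN target_chart] z by (metis SigmaI fst_prod_chart)
    then show ?thesis using z w by (intro exI[of _ z]) (simp add: inv_R_gen)
  qed
  let ?r = "rep_R c" and ?Rd = "snd ?T ` (fst ?T \<inter> U \<inter> R -` fst ?D)"
  have sR: "s y \<in> ?Rd" and rs: "?r (s y) = \<alpha> y" if "y \<in> W" for y
  proof -
    obtain z where z: "y = snd ?C0 z" "fst z \<in> fst d0" "fst (\<Psi> z) \<in> fst d1" "gen_point z \<in> fst c"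
      using inv_W[OF \<open>y \<in> W\<close>] by blast
    have "s y = snd ?T (gen_point z, gen_velocity z)" using s_eq z by simp
    moreover have "(gen_point z, gen_velocity z) \<in> fst ?T \<inter> U \<inter> R -` fst ?D"
      using z gen_exists(1,2)[of z] by auto
    ultimately show "s y \<in> ?Rd" "?r (s y) = \<alpha> y"
      using z \<alpha>_eq[OF z(2)] gen_exists(2)[of z] chart_inv_chart[OF charted_T T]
      by (auto simp: rep_R_def simp del: snd_prod_chart)
  qed
  \<comment> \<open>The momentum in the chart \<open>c\<close>, rebuilt from vertical derivatives of
    \<open>R\<close>. It is visibly smooth in \<open>y\<close>, whereas \<open>gen_momentum\<close>
    refers to preferred charts that may jump.\<close>
  define \<pi> where "\<pi> y = (\<Sum>b\<in>Basis. ((- snd y, snd (rep_\<Psi> y)) \<bullet> frechet_derivative ?r (at (s y)) (0, b)) *\<^sub>R b)" for y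
  have W\<Psi>: "smooth_on W rep_\<Psi>" by (rule smooth_on_subset[OF rep_\<Psi>_smooth oW]) (auto simp: W_def)
  have "smooth_on W (\<lambda>y. (- snd y, snd (rep_\<Psi> y)))"
    by (intro smooth_on_Pair smooth_on_linear oW bounded_linear_minus[OF bounded_linear_snd]
        smooth_on_compose[OF W\<Psi> smooth_on_linear[OF bounded_linear_snd open_UNIV]]) auto
  moreover have "smooth_on W (\<lambda>y. frechet_derivative ?r (at (s y)) v)" for v
    by (rule smooth_on_compose[OF s smooth_on_derivative[OF rep_R_smooth[OF c(1)]]]) (use sR in auto)
  ultimately have \<pi>: "smooth_on W \<pi>"
    unfolding \<pi>_def
    by (intro smooth_on_sum oW smooth_on_bilinear[OF bounded_bilinear_scaleR]
        smooth_on_bilinear[OF bounded_bilinear_inner] smooth_on_const) auto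
  have \<pi>_eq: "\<pi> (snd ?C0 z) = snd (snd (cotangent_chart N c) (gen z))"
    if z: "fst z \<in> fst d0" "fst (\<Psi> z) \<in> fst d1" "gen_point z \<in> fst c" for z
  proof -
    have "rep_\<Psi> (snd ?C0 z) = snd ?C1 (\<Psi> z)"
      using z chart_inv_chart[OF charted_C C0(1), of z] by (simp add: rep_\<Psi>_def mem_Times_iff)
    then show ?thesis
      using vertical_derivative_rep_R[OF z(1,2) c(1) z(3)]
      by (simp add: \<pi>_def s_eq[OF z(1,2)] euclidean_representation)
  qed
  define K where "K = snd (UNIV, id) \<circ> f \<circ> chart_inv (cotangent_chart N c)"
  have gen_eq: "gen_function y = \<pi> y \<bullet> snd (s y) - h * K (fst (s y), \<pi> y)" if "y \<in> W" for y
  proof -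
    obtain z where z: "y = snd ?C0 z" "chart_inv ?C0 y = z" "fst z \<in> fst d0" "fst (\<Psi> z) \<in> fst d1" "gen_point z \<in> fst c"
      using inv_W[OF \<open>y \<in> W\<close>] by blast
    have 1: "\<pi> y \<bullet> snd (s y) = gen_momentum z \<bullet> gen_velocity z"
      by (simp add: z(1) \<pi>_eq[OF z(3-5)] s_eq[OF z(3,4)] chart_pairing[OF N c(1) z(5)])
    have "(fst (s y), \<pi> y) = snd (cotangent_chart N c) (gen z)"
      unfolding z(1) \<pi>_eq[OF z(3-5)] s_eq[OF z(3,4)] by (simp add: snd_tangent_chart snd_cotangent_chart)
    then have "K (fst (s y), \<pi> y) = f (gen z)"
      using chart_inv_chart[OF charted_C, of "cotangent_chart N c" "gen z"] z c
      by (simp add: K_def atlas_cotangent)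
    then show ?thesis using 1 z by (simp add: gen_function_def)
  qed
  have \<pi>0: "\<pi> y0 = gen_momentum z" and s1: "s y0 = snd ?T (gen_point z, gen_velocity z)"
    and s2: "snd (s y0) = gen_velocity z"
    using z c \<pi>_eq[of z] s_eq[of z] snd_tangent_chart_at[OF charted_N, of "(gen_point z, gen_velocity z)"]
      snd_cotangent_chart_at[OF charted_N, of "gen z"]
    by (simp_all add: c_def)
  have K': "(K has_derivative df (gen z)) (at (fst (s y0), \<pi> y0))"
    using mderiv_has_derivative[OF f charted_C charted_euclid, of "gen z"]
      snd_tangent_chart_at[OF charted_N, of "(gen_point z, gen_velocity z)"]
      snd_cotangent_chart_at[OF charted_N, of "gen z"]
    by (simp add: K_def s1 \<pi>0 c_def)
  let ?s' = "frechet_derivative s (at y0)" and ?\<pi>' = "frechet_derivative \<pi> (at y0)"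
  have s': "(s has_derivative ?s') (at y0)" and \<pi>': "(\<pi> has_derivative ?\<pi>') (at y0)"
    using smooth_on_has_derivative s \<pi> y0W by blast+
  let ?r' = "frechet_derivative ?r (at (s y0))" and ?\<Psi>' = "frechet_derivative rep_\<Psi> (at y0)"
  \<comment> \<open>Differentiating \<open>R (x, v) = (x\<^sub>0, x\<^sub>1)\<close>: the derivative
    of \<open>R\<close> sends \<open>(dx, dv)\<close> to
    \<open>(dx\<^sub>0, dx\<^sub>1)\<close>.\<close>
  have "((\<lambda>y. ?r (s y)) has_derivative (\<lambda>u. ?r' (?s' u))) (at y0)"
    by (rule has_derivative_compose[OF s', where g="?r"])
       (rule smooth_on_has_derivative[OF rep_R_smooth[OF c(1)] sR[OF y0W]])
  then have "(\<alpha> has_derivative (\<lambda>u. ?r' (?s' u))) (at y0)"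
    by (rule has_derivative_transform_within_open[OF _ oW y0W rs])
  moreover have "(\<alpha> has_derivative (\<lambda>u. (fst u, fst (?\<Psi>' u)))) (at y0)"
    unfolding \<alpha>_def
    by (intro has_derivative_Pair has_derivative_fst has_derivative_ident
        smooth_on_has_derivative[OF W\<Psi> y0W])
  ultimately have "(\<lambda>u. ?r' (?s' u)) = (\<lambda>u. (fst u, fst (?\<Psi>' u)))"
    by (rule has_derivative_unique)
  then have r's': "?r' (?s' u) = (fst u, fst (?\<Psi>' u))" for u by (rule fun_cong)
  have "((\<lambda>y. K (fst (s y), \<pi> y)) has_derivative (\<lambda>u. df (gen z) (fst (?s' u), ?\<pi>' u))) (at y0)"
    by (rule has_derivative_compose[where g=K and f="\<lambda>y. (fst (s y), \<pi> y)", OF _ K'])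
       (intro has_derivative_Pair has_derivative_fst s' \<pi>')
  then have "((\<lambda>y. \<pi> y \<bullet> snd (s y) - h * K (fst (s y), \<pi> y)) has_derivative
     (\<lambda>u. (\<pi> y0 \<bullet> snd (?s' u) + ?\<pi>' u \<bullet> snd (s y0)) - h * df (gen z) (fst (?s' u), ?\<pi>' u))) (at y0)"
    by (intro has_derivative_diff has_derivative_inner \<pi>' has_derivative_snd s' has_derivative_mult_right)
  moreover have "(\<pi> y0 \<bullet> snd (?s' u) + ?\<pi>' u \<bullet> snd (s y0)) - h * df (gen z) (fst (?s' u), ?\<pi>' u)
    = snd (rep_\<Psi> y0) \<bullet> fst (?\<Psi>' u) - snd y0 \<bullet> fst u" for u
  proof -
    have "df (gen z) (fst (?s' u), ?\<pi>' u) = df (gen z) (fst (?s' u), 0) + df (gen z) (0, ?\<pi>' u)"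
      by (simp flip: linear_add[OF linear_df])
    \<comment> \<open>By \<open>v = h \<partial>f/\<partial>p\<close> the momentum part of
      \<open>h df\<close> is \<open>v dp\<close>, which cancels against a term of the product
      rule.\<close>
    then have "h * df (gen z) (fst (?s' u), ?\<pi>' u) = h * df (gen z) (fst (?s' u), 0) + gen_velocity z \<bullet> ?\<pi>' u"
      by (simp add: gen_velocity_inner distrib_left)
    then have "(\<pi> y0 \<bullet> snd (?s' u) + ?\<pi>' u \<bullet> snd (s y0)) - h * df (gen z) (fst (?s' u), ?\<pi>' u)
      = gen_momentum z \<bullet> snd (?s' u) - h * df (gen z) (fst (?s' u), 0)"
      by (simp add: \<pi>0 s2 inner_commute)
    also have "\<dots> = (- snd (snd ?C0 z), snd (snd ?C1 (\<Psi> z))) \<bullet> ?r' (?s' u)"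
      using derivative_rep_R[OF z(3,4), of "?s' u"] by (simp add: s1 c_def)
    also have "\<dots> = snd (rep_\<Psi> y0) \<bullet> fst (?\<Psi>' u) - snd y0 \<bullet> fst u"
    proof -
      have "rep_\<Psi> y0 = snd ?C1 (\<Psi> z)" using z(2) by (simp add: rep_\<Psi>_def)
      then show ?thesis unfolding r's' z(1)[symmetric] by (simp add: inner_prod_def)
    qed
    finally show ?thesis .
  qed
  ultimately have "((\<lambda>y. \<pi> y \<bullet> snd (s y) - h * K (fst (s y), \<pi> y)) has_derivative
     (\<lambda>u. snd (rep_\<Psi> y0) \<bullet> fst (?\<Psi>' u) - snd y0 \<bullet> fst u)) (at y0)" by simp
  then show ?thesis
    by (rule has_derivative_transform_within_open[OF _ oW y0W]) (simp add: gen_eq)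
qed

end

theorem symplectic: "form_eq 2 (pullback (cotangent N) (cotangent N) \<Psi> omega_can) omega_can"
  unfolding form_eq_def
proof (intro allI impI)
  fix z :: "'m \<times> 'a" and vs :: "('a \<times> 'a) list" assume "length vs = 2"
  then obtain u w where vs: "vs = [u, w]" by (auto simp: length_Suc_conv numeral_2_eq_2)
  let ?d0 = "chart_at N (fst z)" and ?d1 = "chart_at N (fst (\<Psi> z))"
  note d = at_N(1)[of "fst z"] at_N(1)[of "fst (\<Psi> z)"]
  define y0 where "y0 = snd (cotangent_chart N ?d0) z"
  let ?D = "dom_\<Psi> ?d0 ?d1" and ?\<psi> = "rep_\<Psi> ?d0 ?d1"
  have \<psi>: "smooth_on ?D ?\<psi>" by (rule rep_\<Psi>_smooth[OF d])
  have D: "open ?D" by (rule smooth_on_open[OF \<psi>])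
  have y0: "y0 \<in> ?D" unfolding dom_\<Psi>_def[OF d] y0_def using at_N(2) by (auto simp: mem_Times_iff)
  let ?d\<psi> = "\<lambda>y. frechet_derivative ?\<psi> (at y)"
  have d\<psi>: "(?\<psi> has_derivative ?d\<psi> y) (at y)" if "y \<in> ?D" for y
    using that by (rule smooth_on_has_derivative[OF \<psi>])
  have dd\<psi>: "((\<lambda>y. ?d\<psi> y u) has_derivative frechet_derivative (\<lambda>y. ?d\<psi> y u) (at y0)) (at y0)" for u
    by (rule smooth_on_has_derivative[OF smooth_on_derivative[OF \<psi>] y0])
  \<comment> \<open>Differentiating \<open>p\<^sub>1 dx\<^sub>1\<close> produces a term with second
    derivatives of \<open>x\<^sub>1\<close>. With \<open>p\<^sub>1\<close> frozen at
    \<open>y0\<close> it is the second derivative of a function, hence symmetric, and cancels in the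
    comparison; the terms in \<open>dp\<^sub>1\<close>, \<open>dx\<^sub>1\<close> and
    \<open>dp\<^sub>0\<close>, \<open>dx\<^sub>0\<close> remain.\<close>
  let ?dd = "\<lambda>u w. snd (?\<psi> y0) \<bullet> fst (frechet_derivative (\<lambda>y. ?d\<psi> y u) (at y0) w)"
  have "?dd u w = ?dd w u"
    by (rule symmetric_second_derivative[OF D y0, where g="\<lambda>y. snd (?\<psi> y0) \<bullet> fst (?\<psi> y)"
          and g'="\<lambda>y u. snd (?\<psi> y0) \<bullet> fst (?d\<psi> y u)"])
       (intro has_derivative_inner_right has_derivative_fst d\<psi> dd\<psi>; assumption)+
  moreover have "(?dd u w + snd (?d\<psi> y0 w) \<bullet> fst (?d\<psi> y0 u)) - snd w \<bullet> fst u
    = (?dd w u + snd (?d\<psi> y0 u) \<bullet> fst (?d\<psi> y0 w)) - snd u \<bullet> fst w"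
    by (rule symmetric_second_derivative[OF D y0 gen_function_has_derivative[OF d],
        where B="\<lambda>u w. (?dd u w + snd (?d\<psi> y0 w) \<bullet> fst (?d\<psi> y0 u)) - snd w \<bullet> fst u"])
       (assumption, intro has_derivative_diff has_derivative_inner has_derivative_inner_left
          has_derivative_snd has_derivative_fst has_derivative_ident d\<psi>[OF y0] dd\<psi>)
  moreover have "mderiv (cotangent N) (cotangent N) \<Psi> z = ?d\<psi> y0"
    by (simp add: mderiv_def rep_\<Psi>_def[OF d] y0_def)
  ultimately show "pullback (cotangent N) (cotangent N) \<Psi> omega_can z vs = omega_can z vs"
    by (simp add: pullback_def omega_can_def vs inner_commute)
qed

end

section \<open>The extended phase space\<close>

lemma smooth_on_UNIV_linear: "linear f \<Longrightarrow> smooth_on UNIV f" for f :: "'a::euclidean_space \<Rightarrow> 'b::euclidean_space"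
  by (intro smooth_on_linear open_UNIV linear_conv_bounded_linear[THEN iffD1])

abbreviation (input) time_ext :: "('q, 'a::euclidean_space) mfd \<Rightarrow> ('q \<times> real, 'a \<times> real) mfd" where
  "time_ext Q \<equiv> Q \<times>\<^sub>M euclid"

abbreviation (input) time_chart :: "('q, 'a) chart \<Rightarrow> ('q \<times> real, 'a \<times> real) chart" where
  "time_chart c \<equiv> prod_chart c (UNIV, id)"

definition insert_pt :: "real \<Rightarrow> ('q \<times> 'a) \<times> real \<Rightarrow> ('q \<times> real) \<times> ('a \<times> real)" where
  "insert_pt s = (\<lambda>((q, p), t). ((q, t), (p, s)))"

text \<open>Identifies the tangent bundle of a product with the product of tangent bundles, and the
  square of a product with the product of squares.\<close>

definition swap_middle :: "('a \<times> 'b) \<times> ('c \<times> 'd) \<Rightarrow> ('a \<times> 'c) \<times> ('b \<times> 'd)" where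
  "swap_middle = (\<lambda>((a, b), (c, d)). ((a, c), (b, d)))"

lemma forget_pt_simp [simp]: "forget_pt ((q, t), (p, s)) = ((q, p), t)"
  and insert_pt_simp [simp]: "insert_pt s ((q, p), t) = ((q, t), (p, s))"
  and swap_middle_simp [simp]: "swap_middle ((a, b), (c, d)) = ((a, c), (b, d))"
  by (simp_all add: forget_pt_def insert_pt_def swap_middle_def)

lemma forget_insert_pt [simp]: "forget_pt (insert_pt s x) = x"
  by (auto simp: forget_pt_def insert_pt_def split: prod.splits)

lemma insert_forget_pt: "insert_pt (snd (snd z)) (forget_pt z) = z"
  by (auto simp: forget_pt_def insert_pt_def split: prod.splits)

lemma swap_middle_swap_middle [simp]: "swap_middle (swap_middle z) = z"
  by (auto simp: swap_middle_def split: prod.splits)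

lemma fst_forget_pt [simp]: "fst (fst (forget_pt z)) = fst (fst z)"
  and fst_insert_pt [simp]: "fst (fst (insert_pt s x)) = fst (fst x)"
  and snd_forget_pt [simp]: "snd (forget_pt z) = snd (fst z)"
  and snd_insert_pt [simp]: "snd (snd (insert_pt s x)) = s"
  and snd_fst_insert_pt [simp]: "snd (fst (insert_pt s x)) = snd x"
  by (auto simp: forget_pt_def insert_pt_def split: prod.splits)

lemma linear_forget_pt: "linear (forget_pt :: ('a::euclidean_space \<times> real) \<times> ('a \<times> real) \<Rightarrow> _)"
  by (rule linearI) (auto simp: forget_pt_def split: prod.splits)

lemma linear_insert_pt: "linear (insert_pt 0 :: ('a::euclidean_space \<times> 'a) \<times> real \<Rightarrow> _)"
  by (rule linearI) (auto simp: insert_pt_def split: prod.splits)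

lemma linear_swap_middle:
  "linear (swap_middle :: ('a::euclidean_space \<times> 'b::euclidean_space) \<times> ('c::euclidean_space \<times> 'd::euclidean_space) \<Rightarrow> _)"
  by (rule linearI) (auto simp: swap_middle_def split: prod.splits)

text \<open>\<open>insert_pt s\<close> is merely affine for \<open>s \<noteq> 0\<close>; its linear
  part is \<open>insert_pt 0\<close>.\<close>

lemma insert_pt_eq: "insert_pt s x = insert_pt 0 x + ((0, 0), (0, s))"
  for x :: "('a::euclidean_space \<times> 'a) \<times> real"
  by (auto simp: insert_pt_def split: prod.splits)

lemma atlas_time_ext: "atlas (time_ext Q) = time_chart ` atlas Q"
  by (auto simp: atlas_prod_mfd)

lemma adjoint_map_prod_id:
  fixes L :: "'a::euclidean_space \<Rightarrow> 'a"
  assumes "linear L" shows "adjoint (map_prod L id) = map_prod (adjoint L) (id :: 'b::euclidean_space \<Rightarrow> 'b)"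
  by (rule adjoint_unique) (auto simp: inner_prod_def adjoint_clauses[OF assms])

context
  fixes Q :: "('q, 'a::euclidean_space) mfd"
  assumes Q: "smooth_atlas Q"
begin

lemma charted_Q: "charted Q" using Q by (rule smooth_atlas_imp_charted)

lemmas smooth_atlas_time_ext = smooth_atlas_prod_mfd[OF Q smooth_atlas_euclid]
lemmas charted_cotangent_time_ext = charted_cotangent[OF smooth_atlas_time_ext]
lemmas charted_cotangent_Q = charted_cotangent[OF Q]
lemmas charted_ext_phase = charted_prod_mfd[OF charted_cotangent_Q charted_euclid]

lemma jac_time_chart:
  assumes "c \<in> atlas Q" "d \<in> atlas Q" "q \<in> fst c" "q \<in> fst d"
  shows "jac (time_chart c) (time_chart d) (q, t) = map_prod (jac c d q) id"
  using jac_prod_chart[OF Q smooth_atlas_euclid assms(1,2,3,4), of "(UNIV, id)" "(UNIV, id)" t]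
    jac_self[OF charted_euclid, of "(UNIV, id)" t]
  by simp

text \<open>Changes of chart on \<open>Q\<close> affect neither \<open>t\<close> nor
  \<open>p\<^sub>t\<close>. Hence \<open>forget_pt\<close> and \<open>insert_pt\<close> have the
  same formula in coordinates as on points, and \<open>forget_pt\<close> is its own tangent
  map.\<close>

lemma cotangent_time_chart:
  assumes "c \<in> atlas Q" "q \<in> fst c"
  shows "snd (cotangent_chart (time_ext Q) (time_chart c)) ((q, t), (p, s))
    = insert_pt s (snd (prod_chart (cotangent_chart Q c) (UNIV, id)) ((q, p), t))"
  using assms
  by (simp add: snd_cotangent_chart jac_time_chart chart_at_atlas[OF charted_Q] chart_at_mem[OF charted_Q]
      adjoint_map_prod_id[OF linear_jac[OF Q]])

lemma tangent_time_chart: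
  assumes "c \<in> atlas Q" "q \<in> fst c"
  shows "snd (tangent_chart (time_ext Q) (time_chart c)) ((q, t), (v, s))
    = swap_middle (snd (prod_chart (tangent_chart Q c) (UNIV, id)) ((q, v), (t, s)))"
  using assms
  by (simp add: snd_tangent_chart jac_time_chart chart_at_atlas[OF charted_Q] chart_at_mem[OF charted_Q])

lemma chart_push_forget_pt: "chart_push (cotangent (time_ext Q)) (ext_phase Q) forget_pt"
  unfolding chart_push_def
proof
  fix d assume "d \<in> atlas (ext_phase Q)"
  then obtain c where d: "d = prod_chart (cotangent_chart Q c) (UNIV, id)" and c: "c \<in> atlas Q"
    by (auto simp: atlas_prod_mfd atlas_cotangent)
  show "\<exists>C\<in>atlas (cotangent (time_ext Q)). \<exists>L. smooth_on UNIV L \<and> fst C = forget_pt -` fst d \<and>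
     (\<forall>x\<in>fst C. snd d (forget_pt x) = L (snd C x))"
    by (intro bexI[of _ "cotangent_chart (time_ext Q) (time_chart c)"] exI[of _ forget_pt] conjI
        smooth_on_UNIV_linear linear_forget_pt)
       (auto simp: c atlas_cotangent atlas_time_ext d cotangent_time_chart[OF c] simp del: snd_prod_chart)
qed

lemma chart_pull_insert_pt: "chart_pull (ext_phase Q) (cotangent (time_ext Q)) (insert_pt s)"
  unfolding chart_pull_def
proof
  fix d assume "d \<in> atlas (ext_phase Q)"
  then obtain c where d: "d = prod_chart (cotangent_chart Q c) (UNIV, id)" and c: "c \<in> atlas Q"
    by (auto simp: atlas_prod_mfd atlas_cotangent)
  let ?C = "cotangent_chart (time_ext Q) (time_chart c)"
  have sm: "smooth_on UNIV (insert_pt s :: ('a \<times> 'a) \<times> real \<Rightarrow> _)"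
    by (subst insert_pt_eq[abs_def]) (intro smooth_on_add smooth_on_const open_UNIV smooth_on_UNIV_linear linear_insert_pt)
  \<comment> \<open>Coordinates of the form \<open>insert_pt s y\<close> force
    \<open>p\<^sub>t = s\<close>, because the charts leave \<open>p\<^sub>t\<close>
    unchanged.\<close>
  have "\<exists>x. insert_pt s x = z \<and> snd d x = y"
    if "z \<in> (fst c \<times> UNIV) \<times> UNIV" "snd ?C z = insert_pt s y" for z y
  proof -
    obtain q t p r where z: "z = ((q, t), (p, r))" by (metis prod.exhaust)
    have "insert_pt r (snd d ((q, p), t)) = insert_pt s y"
      using that c by (auto simp: z d cotangent_time_chart simp del: snd_prod_chart)
    then have "r = s" "snd d ((q, p), t) = y" by (auto simp: insert_pt_def split: prod.splits)
    then show ?thesis by (intro exI[of _ "((q, p), t)"]) (simp add: z)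
  qed
  then show "\<exists>C\<in>atlas (cotangent (time_ext Q)). \<exists>S. smooth_on UNIV S \<and> fst d = insert_pt s -` fst C \<and>
     (\<forall>x\<in>fst d. snd C (insert_pt s x) = S (snd d x)) \<and>
     (\<forall>x\<in>fst C. \<forall>y. snd C x = S y \<longrightarrow> (\<exists>x'. insert_pt s x' = x \<and> snd d x' = y))"
    by (intro bexI[of _ ?C] exI[of _ "insert_pt s"] conjI sm)
       (auto simp: c atlas_cotangent atlas_time_ext d cotangent_time_chart[OF c] simp del: snd_prod_chart)
qed

lemma mderiv_forget_pt: "mderiv (cotangent (time_ext Q)) (ext_phase Q) forget_pt z = forget_pt"
  by (rule mderiv_eqI[OF charted_cotangent_time_ext linear_imp_has_derivative[OF linear_forget_pt]])
     (auto simp: cotangent_time_chart chart_at_atlas[OF charted_Q] simp del: snd_prod_chart)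

lemma smooth_map_forget_pt: "smooth_map (cotangent (time_ext Q)) (ext_phase Q) forget_pt"
  using smooth_map_on_conjugate[OF charted_cotangent_time_ext charted_cotangent_time_ext chart_pull_id
      chart_push_forget_pt smooth_map_id[OF smooth_atlas_cotangent[OF smooth_atlas_time_ext]]]
  by simp

lemma smooth_map_insert_pt: "smooth_map (ext_phase Q) (cotangent (time_ext Q)) (insert_pt s)"
  using smooth_map_on_conjugate[OF charted_cotangent_time_ext charted_ext_phase chart_pull_insert_pt
      chart_push_id smooth_map_id[OF smooth_atlas_cotangent[OF smooth_atlas_time_ext]]]
  by simp

lemma smooth_map_pt: "smooth_map (cotangent (time_ext Q)) euclid (\<lambda>z. snd (snd z))"
  unfolding smooth_map_on_def
proof (intro conjI ballI)
  show "mopen (cotangent (time_ext Q)) UNIV"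
    by (simp add: mopen_def chart_open_image[OF charted_cotangent_time_ext])
  fix C and d :: "(real, real) chart" assume C: "C \<in> atlas (cotangent (time_ext Q))" and "d \<in> atlas euclid"
  then obtain c where c: "C = cotangent_chart (time_ext Q) (time_chart c)" "c \<in> atlas Q" and d: "d = (UNIV, id)"
    by (auto simp: atlas_time_ext atlas_cotangent)
  have "smooth_on (snd C ` fst C) (\<lambda>z. snd (snd z))"
    by (rule smooth_on_linear[OF _ chart_open_image[OF charted_cotangent_time_ext C]])
       (intro bounded_linear_snd_comp bounded_linear_snd)
  then have "smooth_on (snd C ` fst C) (snd d \<circ> (\<lambda>z. snd (snd z)) \<circ> chart_inv C)"
  proof (rule smooth_on_cong[rotated])
    fix y assume "y \<in> snd C ` fst C"
    then obtain z where z: "z \<in> fst C" "y = snd C z" by auto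
    then show "snd (snd y) = (snd d \<circ> (\<lambda>z. snd (snd z)) \<circ> chart_inv C) y"
      using chart_inv_chart[OF charted_cotangent_time_ext C z(1)] c
      by (cases z) (auto simp: d cotangent_time_chart)
  qed
  then show "smooth_on (snd C ` (fst C \<inter> UNIV \<inter> (\<lambda>z. snd (snd z)) -` fst d)) (snd d \<circ> (\<lambda>z. snd (snd z)) \<circ> chart_inv C)"
    by (simp add: d)
qed

lemma mderiv_pt: "mderiv (cotangent (time_ext Q)) euclid (\<lambda>z. snd (snd z)) z = (\<lambda>v. snd (snd v))"
  by (rule mderiv_eqI[OF charted_cotangent_time_ext, where S="\<lambda>v. snd (snd v)"])
     (auto intro!: derivative_eq_intros simp: cotangent_time_chart chart_at_atlas[OF charted_Q])

end

lemma smooth_map_add_real: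
  assumes "smooth_map M euclid f" "smooth_map M euclid g"
  shows "smooth_map M euclid (\<lambda>x. f x + g x :: real)"
  using assms unfolding smooth_map_on_def
  by (auto intro: smooth_on_add[THEN smooth_on_cong[rotated]])

lemma smooth_map_H_tilde:
  assumes "smooth_atlas Q" "smooth_map (ext_phase Q) euclid H"
  shows "smooth_map (cotangent (time_ext Q)) euclid (H_tilde H)"
  using smooth_map_add_real[OF smooth_map_on_compose[OF charted_cotangent_time_ext[OF assms(1)]
        charted_ext_phase[OF assms(1)] smooth_map_forget_pt[OF assms(1)] assms(2)] smooth_map_pt[OF assms(1)]]
  by (simp add: H_tilde_def[abs_def])

section \<open>Product discretizations\<close>

lemma bij_swap_middle_image: "swap_middle -` A = swap_middle ` A"
  by (force simp: image_iff intro: swap_middle_swap_middle[symmetric])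

text \<open>\<open>swap_middle\<close> is its own inverse, which yields the point demanded by the
  last clause of \<open>chart_pull\<close>.\<close>

lemma chart_pull_swap_middleI:
  assumes "\<And>c. c \<in> atlas M \<Longrightarrow> \<exists>d\<in>atlas N. fst c = swap_middle -` fst d \<and>
     (\<forall>x\<in>fst c. snd d (swap_middle x) = swap_middle (snd c x))"
  shows "chart_pull M N swap_middle"
  unfolding chart_pull_def
proof
  fix c assume "c \<in> atlas M"
  then obtain d where d: "d \<in> atlas N" "fst c = swap_middle -` fst d"
    and *: "\<And>x. x \<in> fst c \<Longrightarrow> snd d (swap_middle x) = swap_middle (snd c x)" using assms by meson
  have "\<exists>x'. swap_middle x' = x \<and> snd c x' = y" if "x \<in> fst d" "snd d x = swap_middle y" for x y
    using *[of "swap_middle x"] that d by (intro exI[of _ "swap_middle x"]) (auto, metis swap_middle_swap_middle)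
  then show "\<exists>d\<in>atlas N. \<exists>S. smooth_on UNIV S \<and> fst c = swap_middle -` fst d \<and>
     (\<forall>x\<in>fst c. snd d (swap_middle x) = S (snd c x)) \<and>
     (\<forall>x\<in>fst d. \<forall>y. snd d x = S y \<longrightarrow> (\<exists>x'. swap_middle x' = x \<and> snd c x' = y))"
    using d * by (intro bexI[of _ d] exI[of _ swap_middle] conjI smooth_on_UNIV_linear linear_swap_middle) auto
qed

lemma chart_push_swap_middleI:
  assumes "\<And>d. d \<in> atlas N \<Longrightarrow> \<exists>c\<in>atlas M. fst c = swap_middle -` fst d \<and>
     (\<forall>x\<in>fst c. snd d (swap_middle x) = swap_middle (snd c x))"
  shows "chart_push M N swap_middle"
  unfolding chart_push_def
  using assms smooth_on_UNIV_linear[OF linear_swap_middle] by meson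

lemma tangent_euclid_chart: "snd (tangent_chart euclid (UNIV, id)) = id"
  using jac_self[OF charted_euclid, of "(UNIV, id)"] by (auto simp: snd_tangent_chart fun_eq_iff)

lemma chart_pull_tangent_time_ext:
  assumes Q: "smooth_atlas Q"
  shows "chart_pull (tangent (time_ext Q)) (tangent Q \<times>\<^sub>M tangent euclid) swap_middle"
proof (rule chart_pull_swap_middleI)
  fix C assume "C \<in> atlas (tangent (time_ext Q))"
  then obtain c where C: "C = tangent_chart (time_ext Q) (time_chart c)" and c: "c \<in> atlas Q"
    by (auto simp: atlas_time_ext atlas_tangent)
  show "\<exists>d\<in>atlas (tangent Q \<times>\<^sub>M tangent euclid). fst C = swap_middle -` fst d \<and>
     (\<forall>x\<in>fst C. snd d (swap_middle x) = swap_middle (snd C x))"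
    by (intro bexI[of _ "prod_chart (tangent_chart Q c) (tangent_chart euclid (UNIV, id))"])
       (auto simp: c atlas_tangent atlas_prod_mfd C tangent_time_chart[OF Q c] tangent_euclid_chart)
qed

lemma chart_push_tangent_time_ext:
  assumes Q: "smooth_atlas Q"
  shows "chart_push (tangent Q \<times>\<^sub>M tangent euclid) (tangent (time_ext Q)) swap_middle"
proof (rule chart_push_swap_middleI)
  fix C assume "C \<in> atlas (tangent (time_ext Q))"
  then obtain c where C: "C = tangent_chart (time_ext Q) (time_chart c)" and c: "c \<in> atlas Q"
    by (auto simp: atlas_time_ext atlas_tangent)
  show "\<exists>d\<in>atlas (tangent Q \<times>\<^sub>M tangent euclid). fst d = swap_middle -` fst C \<and>
     (\<forall>x\<in>fst d. snd C (swap_middle x) = swap_middle (snd d x))"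
    by (intro bexI[of _ "prod_chart (tangent_chart Q c) (tangent_chart euclid (UNIV, id))"])
       (auto simp: c atlas_tangent atlas_prod_mfd C tangent_time_chart[OF Q c] tangent_euclid_chart)
qed

lemma prod_chart_atlas: "c \<in> atlas M \<Longrightarrow> d \<in> atlas N \<Longrightarrow> prod_chart c d \<in> atlas (M \<times>\<^sub>M N)"
  by (auto simp: atlas_prod_mfd)

lemma chart_push_time_ext_square:
  "chart_push ((Q \<times>\<^sub>M Q) \<times>\<^sub>M (euclid \<times>\<^sub>M euclid)) (time_ext Q \<times>\<^sub>M time_ext Q) swap_middle"
proof (rule chart_push_swap_middleI)
  fix C assume "C \<in> atlas (time_ext Q \<times>\<^sub>M time_ext Q)"
  then obtain c d where C: "C = prod_chart (time_chart c) (time_chart d)" and c: "c \<in> atlas Q" "d \<in> atlas Q"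
    by (auto simp: atlas_prod_mfd)
  show "\<exists>d\<in>atlas ((Q \<times>\<^sub>M Q) \<times>\<^sub>M (euclid \<times>\<^sub>M euclid)). fst d = swap_middle -` fst C \<and>
     (\<forall>x\<in>fst d. snd C (swap_middle x) = swap_middle (snd d x))"
    by (intro bexI[of _ "prod_chart (prod_chart c d) (prod_chart (UNIV, id) (UNIV, id))"])
       (auto simp: c C prod_chart_atlas)
qed

lemma chart_pull_time_ext_square:
  "chart_pull (time_ext Q \<times>\<^sub>M time_ext Q) ((Q \<times>\<^sub>M Q) \<times>\<^sub>M (euclid \<times>\<^sub>M euclid)) swap_middle"
proof (rule chart_pull_swap_middleI)
  fix C assume "C \<in> atlas (time_ext Q \<times>\<^sub>M time_ext Q)"
  then obtain c d where C: "C = prod_chart (time_chart c) (time_chart d)" and c: "c \<in> atlas Q" "d \<in> atlas Q"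
    by (auto simp: atlas_prod_mfd)
  show "\<exists>d\<in>atlas ((Q \<times>\<^sub>M Q) \<times>\<^sub>M (euclid \<times>\<^sub>M euclid)). fst C = swap_middle -` fst d \<and>
     (\<forall>x\<in>fst C. snd d (swap_middle x) = swap_middle (snd C x))"
    by (intro bexI[of _ "prod_chart (prod_chart c d) (prod_chart (UNIV, id) (UNIV, id))"])
       (auto simp: c C prod_chart_atlas)
qed

lemma prod_discretization_eq: "prod_discretization RQ RR = swap_middle \<circ> map_prod RQ RR \<circ> swap_middle"
  by (auto simp: fun_eq_iff prod_discretization_def swap_middle_def split: prod.splits)

lemma prod_domain_eq: "prod_domain UQ UR = swap_middle -` (UQ \<times> UR)"
  by (auto simp: prod_domain_def)

text \<open>Up to \<open>swap_middle\<close> on both sides the map is \<open>map_prod RQ RR\<close>,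
  and its inverse is the product of the inverses. The inverses are compared on the image only, since
  \<open>inv_into\<close> is arbitrary elsewhere.\<close>

lemma diffeo_prod_discretization:
  assumes Q: "smooth_atlas Q"
    and RQ: "diffeo_onto_image (tangent Q) (Q \<times>\<^sub>M Q) UQ RQ"
    and RR: "diffeo_onto_image (tangent euclid) (euclid \<times>\<^sub>M euclid) UR RR"
  shows "diffeo_onto_image (tangent (time_ext Q)) (time_ext Q \<times>\<^sub>M time_ext Q)
    (prod_domain UQ UR) (prod_discretization RQ RR)"
proof -
  let ?U = "prod_domain UQ UR" and ?R = "prod_discretization RQ RR"
  have cQ: "charted Q" using Q by (rule smooth_atlas_imp_charted)
  note cT = charted_tangent[OF Q] charted_tangent[OF smooth_atlas_euclid]
  note cP = charted_prod_mfd[OF cQ cQ] charted_prod_mfd[OF charted_euclid charted_euclid]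
  note cM = charted_prod_mfd[OF cQ charted_euclid]
  note cTM = charted_tangent[OF smooth_atlas_prod_mfd[OF Q smooth_atlas_euclid]]
  have inj: "inj_on RQ UQ" "inj_on RR UR" using RQ RR by (auto simp: diffeo_onto_image_def)
  have injR: "inj_on ?R ?U"
  proof (rule inj_onI)
    fix z w assume "z \<in> ?U" "w \<in> ?U" and "?R z = ?R w"
    then have "map_prod RQ RR (swap_middle z) = map_prod RQ RR (swap_middle w)"
      unfolding prod_discretization_eq by (metis comp_apply swap_middle_swap_middle)
    moreover have "swap_middle z \<in> UQ \<times> UR" "swap_middle w \<in> UQ \<times> UR"
      using \<open>z \<in> ?U\<close> \<open>w \<in> ?U\<close> by (auto simp: prod_domain_eq)
    ultimately have "swap_middle z = swap_middle w"
      using map_prod_inj_on[OF inj] by (metis inj_onD)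
    then show "z = w" by (metis swap_middle_swap_middle)
  qed
  have "smooth_map_on (tangent (time_ext Q)) (time_ext Q \<times>\<^sub>M time_ext Q) ?U ?R"
    unfolding prod_discretization_eq prod_domain_eq
    using RQ RR
    by (intro smooth_map_on_conjugate[OF charted_prod_mfd[OF cT] cTM chart_pull_tangent_time_ext[OF Q]
      chart_push_time_ext_square] smooth_map_on_map_prod[OF cT]) (auto simp: diffeo_onto_image_def)
  moreover have "smooth_map_on (time_ext Q \<times>\<^sub>M time_ext Q) (tangent (time_ext Q)) (?R ` ?U) (inv_into ?U ?R)"
  proof (rule smooth_map_on_cong[OF charted_prod_mfd[OF cM cM]])
    have im: "?R ` ?U = swap_middle -` (RQ ` UQ \<times> RR ` UR)"
      unfolding bij_swap_middle_image prod_discretization_eq prod_domain_eq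
      by (auto simp: image_image map_prod_image[symmetric])
    show "smooth_map_on (time_ext Q \<times>\<^sub>M time_ext Q) (tangent (time_ext Q)) (?R ` ?U)
        (swap_middle \<circ> map_prod (inv_into UQ RQ) (inv_into UR RR) \<circ> swap_middle)"
      unfolding im using RQ RR
      by (intro smooth_map_on_conjugate[OF charted_prod_mfd[OF cP] charted_prod_mfd[OF cM cM]
        chart_pull_time_ext_square chart_push_tangent_time_ext[OF Q]] smooth_map_on_map_prod[OF cP])
        (auto simp: diffeo_onto_image_def)
    fix y assume "y \<in> ?R ` ?U"
    then obtain q v t s where q: "(q, v) \<in> UQ" "(t, s) \<in> UR" "y = ?R ((q, t), (v, s))"
      by (auto simp: prod_domain_def)
    then have "inv_into ?U ?R y = ((q, t), (v, s))"
      using inv_into_f_f[OF injR, of "((q, t), (v, s))"] by (auto simp: prod_domain_def)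
    then show "(swap_middle \<circ> map_prod (inv_into UQ RQ) (inv_into UR RR) \<circ> swap_middle) y = inv_into ?U ?R y"
      using q by (simp add: prod_discretization_eq inv_into_f_f[OF inj(1)] inv_into_f_f[OF inj(2)])
  qed
  ultimately show ?thesis using injR by (simp add: diffeo_onto_image_def)
qed

section \<open>Alternating forms\<close>

text \<open>Multilinearity for functions of lists, restricted to length \<open>k\<close> because a
  form is meaningless on lists of other lengths.\<close>

definition slotwise_linear :: "nat \<Rightarrow> ('a::real_vector list \<Rightarrow> real) \<Rightarrow> bool" where
  "slotwise_linear k F \<longleftrightarrow> (\<forall>vs i. length vs = k \<longrightarrow> i < k \<longrightarrow> linear (\<lambda>v. F (vs[i := v])))"

lemma permute_list_update:
  assumes "\<sigma> permutes {..<length vs}"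
  shows "permute_list \<sigma> (vs[i := v]) = (permute_list \<sigma> vs)[inv \<sigma> i := v]"
proof (rule nth_equalityI)
  show "length (permute_list \<sigma> (vs[i := v])) = length ((permute_list \<sigma> vs)[inv \<sigma> i := v])" by simp
  fix j assume "j < length (permute_list \<sigma> (vs[i := v]))"
  then have j: "j < length vs" by simp
  have "i = \<sigma> j \<longleftrightarrow> inv \<sigma> i = j" using permutes_inv_eq[OF assms] by metis
  moreover have "\<sigma> j < length vs" using permutes_in_image[OF assms, of j] j by simp
  moreover have "permute_list \<sigma> (vs[i := v]) ! j = (vs[i := v]) ! \<sigma> j"
    using assms j by (intro permute_list_nth) auto
  ultimately show "permute_list \<sigma> (vs[i := v]) ! j = (permute_list \<sigma> vs)[inv \<sigma> i := v] ! j"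
    using permute_list_nth[OF assms j] j by (auto simp: nth_list_update)
qed

text \<open>In the summand of \<open>\<sigma>\<close> the entry \<open>i\<close> sits at position
  \<open>inv \<sigma> i\<close>, hence in the argument of exactly one of the two factors.\<close>

lemma slotwise_linear_wedge:
  fixes \<alpha> \<beta> :: "('m, 'v::real_vector) form"
  assumes \<alpha>: "slotwise_linear k (\<alpha> x)" and \<beta>: "slotwise_linear l (\<beta> x)"
  shows "slotwise_linear (k + l) (wedge k l \<alpha> \<beta> x)"
  unfolding slotwise_linear_def
proof (intro allI impI)
  fix vs :: "'v list" and i assume vs: "length vs = k + l" and i: "i < k + l"
  let ?t = "\<lambda>\<sigma> vs. \<alpha> x (take k (permute_list \<sigma> vs)) * \<beta> x (drop k (permute_list \<sigma> vs))"
  have "linear (\<lambda>v. of_int (sign \<sigma>) * ?t \<sigma> (vs[i := v]))" if \<sigma>: "\<sigma> permutes {..<k + l}" for \<sigma>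
  proof -
    let ?j = "inv \<sigma> i" and ?ws = "permute_list \<sigma> vs"
    have upd: "permute_list \<sigma> (vs[i := v]) = ?ws[?j := v]" for v
      using \<sigma> vs by (intro permute_list_update) simp
    have j: "?j < k + l" using permutes_in_image[OF permutes_inv[OF \<sigma>], of i] i by simp
    have "linear (\<lambda>v. ?t \<sigma> (vs[i := v]))"
    proof (cases "?j < k")
      case True
      then have "linear (\<lambda>v. \<alpha> x ((take k ?ws)[?j := v]))"
        using \<alpha> vs by (simp add: slotwise_linear_def)
      then have "linear (\<lambda>v. \<beta> x (drop k ?ws) *\<^sub>R \<alpha> x ((take k ?ws)[?j := v]))"
        by (rule linear_compose_scale_right)
      then show ?thesis using True by (simp add: upd take_update_swap mult.commute)
    next
      case False
      then have "linear (\<lambda>v. \<beta> x ((drop k ?ws)[?j - k := v]))"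
        using \<beta> vs j by (simp add: slotwise_linear_def)
      then have "linear (\<lambda>v. \<alpha> x (take k ?ws) *\<^sub>R \<beta> x ((drop k ?ws)[?j - k := v]))"
        by (rule linear_compose_scale_right)
      then show ?thesis using False by (simp add: upd drop_update_swap)
    qed
    from linear_compose_scale_right[OF this, of "of_int (sign \<sigma>)"] show ?thesis by simp
  qed
  then have "linear (\<lambda>v. \<Sum>\<sigma> | \<sigma> permutes {..<k + l}. of_int (sign \<sigma>) * ?t \<sigma> (vs[i := v]))"
    by (intro linear_compose_sum) simp
  from linear_compose_scale_right[OF this, of "1 / (fact k * fact l)"]
  show "linear (\<lambda>v. wedge k l \<alpha> \<beta> x (vs[i := v]))" by (simp add: wedge_def)
qed

text \<open>The sum over all permutations makes a wedge product alternating even if its factors are not.\<close>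

lemma wedge_alternating:
  assumes vs: "length vs = k + l" and ij: "i < k + l" "j < k + l" "i \<noteq> j" "vs ! i = vs ! j"
  shows "wedge k l \<alpha> \<beta> x vs = 0"
proof -
  let ?T = "Transposition.transpose i j"
  let ?t = "\<lambda>\<sigma>. \<alpha> x (take k (permute_list \<sigma> vs)) * \<beta> x (drop k (permute_list \<sigma> vs))"
  have T: "?T permutes {..<k + l}" using ij by (intro permutes_swap_id) auto
  let ?S = "\<Sum>\<sigma> | \<sigma> permutes {..<k + l}. of_int (sign \<sigma>) * ?t \<sigma>"
  have "vs ! ?T m = vs ! m" for m using ij by (simp add: Transposition.transpose_def)
  then have "permute_list (?T \<circ> \<sigma>) vs = permute_list \<sigma> vs" for \<sigma> by (simp add: permute_list_def)
  moreover have "sign (?T \<circ> \<sigma>) = - sign \<sigma>" if "\<sigma> permutes {..<k + l}" for \<sigma>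
    using that T ij by (subst sign_compose) (auto simp: permutation_permutes sign_swap_id)
  \<comment> \<open>Reindexing by the transposition leaves the permuted lists unchanged and flips
    all signs, so the sum is its own negative.\<close>
  ultimately have "?S = (\<Sum>\<sigma> | \<sigma> permutes {..<k + l}. - (of_int (sign \<sigma>) * ?t \<sigma>))"
    by (subst setum_permutations_compose_left[OF T]) (intro sum.cong, auto)
  then have "?S = 0" by (simp add: sum_negf)
  then show ?thesis by (simp add: wedge_def)
qed

text \<open>Adding a multiple of entry \<open>k\<close> to another entry changes \<open>F\<close> by
  a multiple of its value on a list with two equal entries. The condition \<open>c k = 0\<close>
  keeps entry \<open>k\<close> intact while the others are treated one by one.\<close>

lemma alternating_row_operations:
  assumes lin: "slotwise_linear n F"
    and alt: "\<And>vs i j. length vs = n \<Longrightarrow> i < n \<Longrightarrow> j < n \<Longrightarrow> i \<noteq> j \<Longrightarrow> vs ! i = vs ! j \<Longrightarrow> F vs = 0"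
    and vs: "length vs = n" and k: "k < n" "c k = 0"
  shows "F (map (\<lambda>i. vs ! i + c i *\<^sub>R vs ! k) [0..<n]) = F vs"
proof -
  \<comment> \<open>The list after its first \<open>m\<close> entries have been treated.\<close>
  define ws where "ws m = map (\<lambda>i. if i < m then vs ! i + c i *\<^sub>R vs ! k else vs ! i) [0..<n]" for m
  have ws: "F (ws m) = F vs" if "m \<le> n" for m
    using that
  proof (induction m)
    case 0
    have "ws 0 = vs" by (rule nth_equalityI) (simp_all add: ws_def vs)
    then show ?case by simp
  next
    case (Suc m)
    let ?w = "ws m"
    have w: "length ?w = n" "?w ! m = vs ! m" "?w ! k = vs ! k" using Suc.prems k by (simp_all add: ws_def)
    have eq: "ws (Suc m) = ?w[m := vs ! m + c m *\<^sub>R vs ! k]"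
      by (rule nth_equalityI) (use Suc.prems in \<open>auto simp: ws_def nth_list_update less_Suc_eq\<close>)
    show ?case
    proof (cases "m = k")
      case True
      then have "ws (Suc m) = ?w" using w k eq by (metis add.right_neutral list_update_id scale_zero_left)
      then show ?thesis using Suc by simp
    next
      case False
      have l: "linear (\<lambda>v. F (?w[m := v]))" using lin w Suc.prems by (simp add: slotwise_linear_def)
      have "F (ws (Suc m)) = F (?w[m := vs ! m]) + c m * F (?w[m := vs ! k])"
        unfolding eq using linear_add[OF l, of "vs ! m" "c m *\<^sub>R vs ! k"] linear_cmul[OF l, of "c m" "vs ! k"]
        by simp
      moreover have "F (?w[m := vs ! k]) = 0"
        using alt[of "?w[m := vs ! k]" m k] w False Suc.prems k by simp
      moreover have "?w[m := vs ! m] = ?w" using w by (metis list_update_id)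
      ultimately show ?thesis using Suc by simp
    qed
  qed
  have "ws n = map (\<lambda>i. vs ! i + c i *\<^sub>R vs ! k) [0..<n]" by (simp add: ws_def)
  then show ?thesis using ws[of n] by simp
qed

text \<open>
  Row operations reduce to the case that \<open>\<eta>\<close> vanishes on all vectors but one; then the shear only
  adds a list of vectors in the kernel of \<open>\<eta>\<close>.
\<close>

lemma alternating_shear_invariant:
  fixes F :: "'a::real_vector list \<Rightarrow> real" and \<eta> :: "'a \<Rightarrow> real"
  assumes lin: "slotwise_linear n F"
    and alt: "\<And>vs i j. length vs = n \<Longrightarrow> i < n \<Longrightarrow> j < n \<Longrightarrow> i \<noteq> j \<Longrightarrow> vs ! i = vs ! j \<Longrightarrow> F vs = 0"
    and zero: "\<And>vs. length vs = n \<Longrightarrow> (\<And>v. v \<in> set vs \<Longrightarrow> \<eta> v = 0) \<Longrightarrow> F vs = 0"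
    and \<eta>: "linear \<eta>" "\<eta> c = 0" and vs: "length vs = n"
  shows "F (map (\<lambda>v. v + \<eta> v *\<^sub>R c) vs) = F vs"
proof (cases "\<forall>v\<in>set vs. \<eta> v = 0")
  case True
  then have "map (\<lambda>v. v + \<eta> v *\<^sub>R c) vs = vs" by (intro map_idI) simp
  then show ?thesis by simp
next
  case False
  let ?S = "\<lambda>v. v + \<eta> v *\<^sub>R c"
  obtain k where k: "k < n" "\<eta> (vs ! k) \<noteq> 0" using False vs by (metis in_set_conv_nth)
  \<comment> \<open>These multiples make \<open>\<eta>\<close> vanish on every entry except the one
    at \<open>k\<close>.\<close>
  define a where "a i = (if i = k then 0 else - \<eta> (vs ! i) / \<eta> (vs ! k))" for i
  define ws where "ws = map (\<lambda>i. vs ! i + a i *\<^sub>R vs ! k) [0..<n]"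
  have ak: "a k = 0" by (simp add: a_def)
  have ws: "length ws = n" "ws ! k = vs ! k" using k by (simp_all add: ws_def ak)
  have 1: "F ws = F vs" unfolding ws_def by (rule alternating_row_operations[where c=a, OF lin _ vs k(1) ak]) (metis alt)
  \<comment> \<open>The shear is linear, so the same row operations carry the sheared list to the
    shear of the reduced list.\<close>
  have "F (map (\<lambda>i. map ?S vs ! i + a i *\<^sub>R map ?S vs ! k) [0..<n]) = F (map ?S vs)"
    by (rule alternating_row_operations[where c=a, OF lin _ _ k(1) ak]) (metis alt, simp add: vs)
  moreover have "map (\<lambda>i. map ?S vs ! i + a i *\<^sub>R map ?S vs ! k) [0..<n] = map ?S ws"
    using k vs by (auto simp: ws_def linear_add[OF \<eta>(1)] linear_cmul[OF \<eta>(1)] algebra_simps)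
  ultimately have 2: "F (map ?S vs) = F (map ?S ws)" by simp
  have \<eta>0: "\<eta> (ws ! i) = 0" if "i < n" "i \<noteq> k" for i
    using that k by (simp add: ws_def a_def linear_diff[OF \<eta>(1)] linear_cmul[OF \<eta>(1)])
  have 3: "map ?S ws = ws[k := ws ! k + \<eta> (ws ! k) *\<^sub>R c]"
    by (rule nth_equalityI) (auto simp: ws k nth_list_update \<eta>0)
  have l: "linear (\<lambda>v. F (ws[k := v]))" using lin ws k by (simp add: slotwise_linear_def)
  have "F (map ?S ws) = F (ws[k := ws ! k]) + \<eta> (ws ! k) * F (ws[k := c])"
    unfolding 3 using linear_add[OF l, of "ws ! k" "\<eta> (ws ! k) *\<^sub>R c"] linear_cmul[OF l, of "\<eta> (ws ! k)" c]
    by simp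
  moreover have "F (ws[k := c]) = 0"
  proof (rule zero)
    fix v assume "v \<in> set (ws[k := c])"
    then obtain i where "i < n" "v = ws[k := c] ! i" by (metis in_set_conv_nth length_list_update ws(1))
    then show "\<eta> v = 0" using \<eta>0 \<eta>(2) ws by (cases "i = k") auto
  qed (simp add: ws)
  ultimately show ?thesis using 1 2 by simp
qed

text \<open>Permuting, taking and dropping commute with \<open>map\<close>, so agreement of both
  factors passes to the product. It serves to exchange the tangent map of \<open>\<phi>\<close>,
  with values over another point, for a shear.\<close>

lemma wedge_map_cong:
  assumes "\<And>us. length us = k \<Longrightarrow> \<alpha> y (map B us) = \<alpha> x (map S us)"
    and "\<And>us. length us = l \<Longrightarrow> \<beta> y (map B us) = \<beta> x (map S us)"
    and "length vs = k + l"
  shows "wedge k l \<alpha> \<beta> y (map B vs) = wedge k l \<alpha> \<beta> x (map S vs)"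
  unfolding wedge_def
  by (rule arg_cong[where f="\<lambda>s. s / _"], rule sum.cong)
     (use assms in \<open>auto simp: permute_list_map take_map drop_map\<close>)

lemma wedge_power_map_cong:
  assumes "\<And>us. length us = 2 \<Longrightarrow> \<omega> y (map B us) = \<omega> x (map S us)"
  shows "length vs = 2 * m \<Longrightarrow> wedge_power m \<omega> y (map B vs) = wedge_power m \<omega> x (map S vs)"
proof (induction m arbitrary: vs)
  case (Suc m)
  then show ?case unfolding wedge_power.simps by (intro wedge_map_cong assms) auto
qed simp

lemma slotwise_linear_wedge_power:
  "slotwise_linear 2 (\<omega> x) \<Longrightarrow> slotwise_linear (2 * m) (wedge_power m \<omega> x)"
proof (induction m)
  case (Suc m)
  then show ?case using slotwise_linear_wedge[of 2 \<omega> x "2 * m" "wedge_power m \<omega>"] by simp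
qed (simp add: slotwise_linear_def)

section \<open>The cosymplectic structure\<close>

abbreviation om :: "'a::euclidean_space \<times> 'a \<Rightarrow> 'a \<times> 'a \<Rightarrow> real" where
  "om u w \<equiv> fst u \<bullet> snd w - fst w \<bullet> snd u"

lemma om_nondegenerate:
  fixes u w :: "'a::euclidean_space \<times> 'a"
  assumes "\<And>v. om u v = om w v" shows "u = w"
proof (rule prod_eqI)
  show "fst u = fst w" by (rule vector_eq_rdot[THEN iffD1, rule_format]) (use assms[of "(0, _)"] in simp)
  show "snd u = snd w" by (rule vector_eq_ldot[THEN iffD1, rule_format]) (use assms[of "(_, 0)"] in simp)
qed

lemma om_preserving_imp_bij:
  fixes A :: "'a::euclidean_space \<times> 'a \<Rightarrow> 'a \<times> 'a"
  assumes A: "linear A" and om: "\<And>u w. om (A u) (A w) = om u w" shows "bij A"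
proof -
  have "inj A" by (rule injI, rule om_nondegenerate) (metis om)
  then show ?thesis using linear_injective_imp_surjective[OF A] by (simp add: bij_def)
qed

lemma om_representation:
  assumes "linear l" obtains X where "\<And>u. om X u = l u"
proof
  fix u :: "'a \<times> 'a"
  let ?m = "covector l"
  \<comment> \<open>A functional with components \<open>(a, b)\<close> is represented through
    \<open>om\<close> by the rotated vector \<open>(b, - a)\<close>.\<close>
  have "om (snd ?m, - fst ?m) u = ?m \<bullet> u" by (simp add: inner_prod_def inner_commute)
  then show "om (snd ?m, - fst ?m) u = l u" by (simp add: covector_inner[OF assms])
qed

lemma DERIV_mderiv:
  fixes g :: "real \<Rightarrow> real"
  assumes "smooth_map euclid euclid g"
  shows "(g has_real_derivative mderiv euclid euclid g t 1) (at t)"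
proof -
  have "(g has_derivative mderiv euclid euclid g t) (at t)"
    using mderiv_has_derivative[OF assms charted_euclid charted_euclid, of t] by simp
  moreover have "mderiv euclid euclid g t = (*) (mderiv euclid euclid g t 1)"
  proof
    fix r
    show "mderiv euclid euclid g t r = mderiv euclid euclid g t 1 * r"
      using linear_cmul[OF linear_mderiv[OF assms charted_euclid charted_euclid, of t], of r 1] by simp
  qed
  ultimately show ?thesis by (simp add: has_field_derivative_def)
qed

context
  fixes Q :: "('q, 'a::euclidean_space) mfd"
  assumes Q: "smooth_atlas Q"
begin

lemma mderiv_fst_ext_phase: "mderiv (ext_phase Q) (cotangent Q) fst x = fst"
  by (rule mderiv_eqI[OF charted_ext_phase[OF Q], where S=fst]) (auto intro!: derivative_eq_intros)

lemma mderiv_snd_ext_phase: "mderiv (ext_phase Q) euclid snd x = snd"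
  by (rule mderiv_eqI[OF charted_ext_phase[OF Q], where S=snd]) (auto intro!: derivative_eq_intros)

lemma omega0_eq: "omega0 Q x [u, w] = om (fst u) (fst w)"
  and eta_eq: "vs \<noteq> [] \<Longrightarrow> eta Q x vs = snd (vs ! 0)"
  by (simp_all add: omega0_def eta_def pullback_def mderiv_fst_ext_phase mderiv_snd_ext_phase omega_can_def)

lemma omega0_length_2: "length vs = 2 \<Longrightarrow> omega0 Q x vs = om (fst (vs ! 0)) (fst (vs ! 1))"
  by (auto simp: omega0_eq length_Suc_conv numeral_2_eq_2)

lemma slotwise_linear_omega0: "slotwise_linear 2 (omega0 Q x)"
  unfolding slotwise_linear_def
proof (intro allI impI)
  fix vs :: "(('a \<times> 'a) \<times> real) list" and i :: nat assume "length vs = 2" "i < 2"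
  then obtain u w where vs: "vs = [u, w]" by (auto simp: length_Suc_conv numeral_2_eq_2)
  have i: "i = 0 \<or> i = 1" using \<open>i < 2\<close> by auto
  have "linear (\<lambda>v. om (fst v) (fst w))" "linear (\<lambda>v. om (fst u) (fst v))"
    by (auto intro!: linearI simp: inner_add_left inner_add_right algebra_simps)
  then show "linear (\<lambda>v. omega0 Q x (vs[i := v]))" using vs i by (auto simp: omega0_eq)
qed

lemma slotwise_linear_eta: "slotwise_linear 1 (eta Q x)"
  unfolding slotwise_linear_def
proof (intro allI impI)
  fix vs :: "(('a \<times> 'a) \<times> real) list" and i :: nat assume "length vs = 1" "i < 1"
  then have "eta Q x (vs[i := v]) = snd v" for v by (cases vs) (auto simp: eta_eq)
  then show "linear (\<lambda>v. eta Q x (vs[i := v]))" by (simp add: linear_snd)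
qed

text \<open>Every summand contains \<open>\<eta>\<close> evaluated at one of the vectors. This is
  the vanishing condition asked for by \<open>alternating_shear_invariant\<close>.\<close>

lemma vol0_zero:
  assumes "length vs = 2 * DIM('a) + 1" "\<And>v. v \<in> set vs \<Longrightarrow> snd v = 0"
  shows "vol0 Q x vs = 0"
proof -
  have "eta Q x (drop (2 * DIM('a)) (permute_list \<sigma> vs)) = 0" if "\<sigma> permutes {..<2 * DIM('a) + 1}" for \<sigma>
  proof -
    let ?w = "drop (2 * DIM('a)) (permute_list \<sigma> vs)"
    have ne: "?w \<noteq> []" using assms(1) by simp
    then have "?w ! 0 \<in> set (permute_list \<sigma> vs)" by (metis in_set_dropD length_greater_0_conv nth_mem)
    then have "?w ! 0 \<in> set vs" using set_permute_list[of \<sigma> vs] that assms(1) by (metis)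
    then show ?thesis using eta_eq[OF ne] assms(2) by simp
  qed
  then show ?thesis unfolding vol0_def wedge_def by simp
qed

lemma vol0_preserved:
  assumes B: "linear B" and time: "\<And>v. snd (B v) = snd v"
    and symp: "\<And>u w. om (fst (B (u, 0))) (fst (B (w, 0))) = om u w"
    and vs: "length vs = 2 * DIM('a) + 1"
  shows "vol0 Q y (map B vs) = vol0 Q x vs"
proof -
  let ?n = "2 * DIM('a)"
  define A where "A u = fst (B (u, 0))" for u
  have lA: "linear A"
    unfolding A_def
    by (rule linear_compose[OF linear_compose[OF _ B] linear_fst, unfolded comp_def]) (rule linearI; simp)
  obtain c where c: "A c = fst (B (0, 1))"
    using surjD[OF bij_is_surj[OF om_preserving_imp_bij[OF lA symp[folded A_def]]], of "fst (B (0, 1))"]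
    by (auto dest: sym)
  define S where "S v = v + snd v *\<^sub>R (c, 0::real)" for v :: "('a \<times> 'a) \<times> real"
  have BS: "fst (B v) = A (fst (S v))" for v
  proof -
    have "v = (fst v, 0) + snd v *\<^sub>R (0, 1)" by (simp add: prod_eq_iff)
    then have "B v = B (fst v, 0) + snd v *\<^sub>R B (0, 1)" by (metis linear_add[OF B] linear_cmul[OF B])
    then show ?thesis by (simp add: S_def linear_add[OF lA] linear_cmul[OF lA] c) (simp add: A_def)
  qed
  have "vol0 Q y (map B vs) = vol0 Q x (map S vs)"
    unfolding vol0_def
  proof (rule wedge_map_cong)
    fix us :: "(('a \<times> 'a) \<times> real) list"
    show "wedge_power DIM('a) (omega0 Q) y (map B us) = wedge_power DIM('a) (omega0 Q) x (map S us)"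
      if "length us = 2 * DIM('a)"
    proof (rule wedge_power_map_cong[OF _ that])
      fix us :: "(('a \<times> 'a) \<times> real) list" assume "length us = 2"
      then show "omega0 Q y (map B us) = omega0 Q x (map S us)"
        using symp[folded A_def] by (simp add: omega0_length_2 BS)
    qed
    show "eta Q y (map B us) = eta Q x (map S us)" if "length us = 1"
      using that by (cases us) (auto simp: eta_eq time S_def)
  qed (use vs in simp)
  also have "\<dots> = vol0 Q x vs"
    unfolding S_def
  proof (rule alternating_shear_invariant[where \<eta>=snd and n="?n + 1"])
    show "slotwise_linear (?n + 1) (vol0 Q x)"
      unfolding vol0_def
      by (intro slotwise_linear_wedge slotwise_linear_wedge_power slotwise_linear_omega0 slotwise_linear_eta)
    show "vol0 Q x vs = 0" if "length vs = ?n + 1" "i < ?n + 1" "j < ?n + 1" "i \<noteq> j" "vs ! i = vs ! j" for vs i j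
      unfolding vol0_def using that by (intro wedge_alternating)
  qed (use vs vol0_zero in \<open>auto simp: linear_snd\<close>)
  finally show ?thesis .
qed

section \<open>Time curves, slices and Hamiltonian vector fields\<close>

lemma smooth_map_time_curve: "smooth_map euclid (ext_phase Q) (\<lambda>\<tau>. (z, \<tau>))"
  unfolding smooth_map_on_def
proof (intro conjI ballI)
  show "mopen (euclid :: (real, real) mfd) UNIV" by (simp add: mopen_def)
  fix c :: "(real, real) chart" and e assume "c \<in> atlas euclid" "e \<in> atlas (ext_phase Q)"
  then obtain d where c: "c = (UNIV, id)" and e: "e = prod_chart d (UNIV, id)"
    by (auto simp: atlas_prod_mfd)
  \<comment> \<open>The first component is constant along the curve, so the domain of the
    representative is everything or empty.\<close>
  have "smooth_on (if z \<in> fst d then UNIV else {}) (\<lambda>\<tau>::real. (snd d z, \<tau>))"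
    by (intro smooth_on_Pair smooth_on_const smooth_on_linear bounded_linear_ident) auto
  moreover have "snd c ` (fst c \<inter> UNIV \<inter> (\<lambda>\<tau>. (z, \<tau>)) -` fst e) = (if z \<in> fst d then UNIV else {})"
    by (auto simp: c e)
  ultimately show "smooth_on (snd c ` (fst c \<inter> UNIV \<inter> (\<lambda>\<tau>. (z, \<tau>)) -` fst e)) (snd e \<circ> (\<lambda>\<tau>. (z, \<tau>)) \<circ> chart_inv c)"
    by (simp add: c e comp_def)
qed

lemma mderiv_time_curve: "mderiv euclid (ext_phase Q) (\<lambda>\<tau>. (z, \<tau>)) t = (\<lambda>\<tau>. (0, \<tau>))"
  by (rule mderiv_eqI[OF charted_euclid, where S="\<lambda>\<tau>. (snd (cotangent_chart Q (chart_at Q (fst z))) z, \<tau>)"])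
     (auto intro!: derivative_eq_intros)

lemma mderiv_slice: "mderiv (cotangent Q) (ext_phase Q) (\<lambda>z. (z, t)) z = (\<lambda>u. (u, 0))"
  by (rule mderiv_eqI[OF charted_cotangent_Q[OF Q], where S="\<lambda>u. (u, t)"])
     (auto intro!: derivative_eq_intros)

lemma chart_pull_slice: "chart_pull (cotangent Q) (ext_phase Q) (\<lambda>z. (z, t))"
  unfolding chart_pull_def
proof
  fix c assume c: "c \<in> atlas (cotangent Q)"
  have "smooth_on UNIV (\<lambda>u::'a \<times> 'a. (u, t))"
    by (intro smooth_on_Pair smooth_on_const smooth_on_linear bounded_linear_ident open_UNIV)
  then show "\<exists>d\<in>atlas (ext_phase Q). \<exists>S. smooth_on UNIV S \<and> fst c = (\<lambda>z. (z, t)) -` fst d \<and>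
     (\<forall>x\<in>fst c. snd d (x, t) = S (snd c x)) \<and>
     (\<forall>x\<in>fst d. \<forall>y. snd d x = S y \<longrightarrow> (\<exists>x'. (x', t) = x \<and> snd c x' = y))"
    using c by (intro bexI[of _ "prod_chart c (UNIV, id)"] exI[of _ "\<lambda>u. (u, t)"]) (auto simp: prod_chart_atlas)
qed

lemma chart_push_fst: "chart_push (ext_phase Q) (cotangent Q) fst"
  unfolding chart_push_def
proof
  fix c assume c: "c \<in> atlas (cotangent Q)"
  show "\<exists>d\<in>atlas (ext_phase Q). \<exists>L. smooth_on UNIV L \<and> fst d = fst -` fst c \<and>
     (\<forall>x\<in>fst d. snd c (fst x) = L (snd d x))"
    using c by (intro bexI[of _ "prod_chart c (UNIV, id)"] exI[of _ fst])
      (auto simp: prod_chart_atlas intro: smooth_on_linear bounded_linear_fst)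
qed

lemma smooth_map_snd: "smooth_map (ext_phase Q) euclid snd"
  unfolding smooth_map_on_def
proof (intro conjI ballI)
  note ch = charted_ext_phase[OF Q]
  show "mopen (ext_phase Q) UNIV" by (simp add: mopen_def chart_open_image[OF ch])
  fix c and d :: "(real, real) chart" assume c: "c \<in> atlas (ext_phase Q)" and "d \<in> atlas euclid"
  then have d: "d = (UNIV, id)" by simp
  have "smooth_on (snd c ` fst c) snd"
    by (rule smooth_on_linear[OF bounded_linear_snd chart_open_image[OF ch c]])
  then have "smooth_on (snd c ` fst c) (snd d \<circ> snd \<circ> chart_inv c)"
  proof (rule smooth_on_cong[rotated])
    fix y assume "y \<in> snd c ` fst c"
    then obtain z where z: "z \<in> fst c" "y = snd c z" by auto
    then show "snd y = (snd d \<circ> snd \<circ> chart_inv c) y"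
      using chart_inv_chart[OF ch c z(1)] c by (auto simp: d atlas_prod_mfd)
  qed
  then show "smooth_on (snd c ` (fst c \<inter> UNIV \<inter> snd -` fst d)) (snd d \<circ> snd \<circ> chart_inv c)"
    by (simp add: d)
qed

lemma smooth_map_slice: "smooth_map (cotangent Q) (ext_phase Q) (\<lambda>z. (z, t))"
  using smooth_map_on_conjugate[OF charted_ext_phase[OF Q] charted_cotangent_Q[OF Q] chart_pull_slice chart_push_id
      smooth_map_id[OF smooth_atlas_prod_mfd[OF smooth_atlas_cotangent[OF Q] smooth_atlas_euclid]]]
  by simp

lemma smooth_map_fst: "smooth_map (ext_phase Q) (cotangent Q) fst"
  using smooth_map_on_conjugate[OF charted_ext_phase[OF Q] charted_ext_phase[OF Q] chart_pull_id chart_push_fst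
      smooth_map_id[OF smooth_atlas_prod_mfd[OF smooth_atlas_cotangent[OF Q] smooth_atlas_euclid]]]
  by simp

text \<open>Links the ordinary \<open>deriv\<close> in \<open>hamiltonian_vf\<close> to the tangent
  map of \<open>f\<close> in the time direction.\<close>

lemma time_derivative:
  assumes "smooth_map (ext_phase Q) euclid f"
  shows "((\<lambda>\<tau>. f (z, \<tau>)) has_real_derivative mderiv (ext_phase Q) euclid f (z, t) (0, 1)) (at t)"
proof -
  note comp = smooth_map_on_compose[OF charted_euclid charted_ext_phase[OF Q] smooth_map_time_curve assms, of z]
  have "mderiv euclid euclid (f \<circ> (\<lambda>\<tau>. (z, \<tau>))) t 1 = mderiv (ext_phase Q) euclid f (z, t) (0, 1)"
    by (subst mderiv_compose[OF charted_euclid charted_ext_phase[OF Q] charted_euclid smooth_map_time_curve assms])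
       (simp_all add: mderiv_time_curve)
  with DERIV_mderiv[OF comp, of t] show ?thesis by (simp add: comp_def)
qed

text \<open>Subtracting the \<open>\<eta>\<close> term cancels the time part of \<open>df\<close>
  and leaves its restriction to the slice. Nondegeneracy of \<open>om\<close> then fixes the spatial
  part of the field, and \<open>\<eta>\<close> its time part.\<close>

lemma hamiltonian_vf_unique:
  assumes f: "smooth_map (ext_phase Q) euclid f"
    and X: "\<And>u. om X u = mderiv (ext_phase Q) euclid f x (u, 0)"
  shows "hamiltonian_vf Q f x = (X, 0)"
proof -
  let ?D = "mderiv (ext_phase Q) euclid f x"
  have lin: "linear ?D"
    by (rule linear_mderiv[OF f charted_ext_phase[OF Q] charted_euclid]) simp
  have time: "deriv (\<lambda>\<tau>. f (fst x, \<tau>)) (snd x) = ?D (0, 1)"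
    using DERIV_imp_deriv[OF time_derivative[OF f, of "fst x" "snd x"]] by simp
  have split: "?D v = ?D (fst v, 0) + snd v * ?D (0, 1)" for v
  proof -
    have "v = (fst v, 0) + snd v *\<^sub>R (0, 1)" by (simp add: prod_eq_iff)
    then show ?thesis by (metis linear_add[OF lin] linear_cmul[OF lin] real_scaleR_def)
  qed
  have eq: "?D v - deriv (\<lambda>\<tau>. f (fst x, \<tau>)) (snd x) * eta Q x [v] = ?D (fst v, 0)" for v
    using split[of v] time eta_eq[of "[v]" x] by simp
  show ?thesis
    unfolding hamiltonian_vf_def eq
  proof (rule the_equality)
    show "(\<forall>v. omega0 Q x [(X, 0), v] = ?D (fst v, 0)) \<and> eta Q x [(X, 0)] = 0"
      using X by (simp add: omega0_eq eta_eq)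
    fix Y assume Y: "(\<forall>v. omega0 Q x [Y, v] = ?D (fst v, 0)) \<and> eta Q x [Y] = 0"
    have "om (fst Y) u = om X u" for u using Y X[of u] by (auto simp: omega0_eq dest: spec[of _ "(u, 0)"])
    then show "Y = (X, 0)" using om_nondegenerate[of "fst Y" X] Y by (auto simp: eta_eq prod_eq_iff)
  qed
qed

lemma hamiltonian_vf_om:
  assumes f: "smooth_map (ext_phase Q) euclid f"
  shows "om (fst (hamiltonian_vf Q f x)) u = mderiv (ext_phase Q) euclid f x (u, 0)"
proof -
  have "linear (mderiv (ext_phase Q) euclid f x)"
    by (rule linear_mderiv[OF f charted_ext_phase[OF Q] charted_euclid]) simp
  then have "linear (\<lambda>u. mderiv (ext_phase Q) euclid f x (u, 0))"
    by (rule linear_compose[unfolded comp_def, rotated]) (rule linearI; simp)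
  then obtain X where X: "\<And>u. om X u = mderiv (ext_phase Q) euclid f x (u, 0)" using om_representation by blast
  show ?thesis by (simp add: hamiltonian_vf_unique[OF f X] X)
qed

text \<open>The bracket involves slice derivatives only, and on slices the tangent map is a linear
  symplectic bijection \<open>A\<close>. Testing on vectors \<open>A u\<close> shows that
  \<open>A\<close> carries the Hamiltonian vector field of \<open>f \<circ> \<phi>\<close> to that
  of \<open>f\<close>; a rescaling of time does not enter.\<close>

lemma poisson0_preserved:
  assumes \<phi>: "smooth_map (ext_phase Q) (ext_phase Q) \<phi>"
    and time: "\<And>x u. snd (mderiv (ext_phase Q) (ext_phase Q) \<phi> x (u, 0)) = 0"
    and symp: "\<And>x u w. om (fst (mderiv (ext_phase Q) (ext_phase Q) \<phi> x (u, 0)))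
      (fst (mderiv (ext_phase Q) (ext_phase Q) \<phi> x (w, 0))) = om u w"
    and f: "smooth_map (ext_phase Q) euclid f" and g: "smooth_map (ext_phase Q) euclid g"
  shows "poisson0 Q (f \<circ> \<phi>) (g \<circ> \<phi>) = poisson0 Q f g \<circ> \<phi>"
proof
  fix x
  note ch = charted_ext_phase[OF Q]
  define A where "A u = fst (mderiv (ext_phase Q) (ext_phase Q) \<phi> x (u, 0))" for u
  have B: "mderiv (ext_phase Q) (ext_phase Q) \<phi> x (u, 0) = (A u, 0)" for u
    using time[of x u] by (simp add: A_def prod_eq_iff)
  have A: "om (A u) (A w) = om u w" for u w unfolding A_def by (rule symp)
  have lA: "linear A"
    unfolding A_def
    by (rule linear_compose[OF linear_compose[OF _ linear_mderiv[OF \<phi> ch ch]] linear_fst, unfolded comp_def])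
       (auto intro: linearI)
  have bA: "surj A" using om_preserving_imp_bij[OF lA A] by (rule bij_is_surj)
  have *: "A (fst (hamiltonian_vf Q (f \<circ> \<phi>) x)) = fst (hamiltonian_vf Q f (\<phi> x))"
    if f: "smooth_map (ext_phase Q) euclid f" for f
  proof (rule om_nondegenerate)
    fix v
    obtain u where v: "v = A u" using bA by (meson surjE)
    have f\<phi>: "smooth_map (ext_phase Q) euclid (f \<circ> \<phi>)" by (rule smooth_map_on_compose[OF ch ch \<phi> f]) simp
    have "mderiv (ext_phase Q) euclid (f \<circ> \<phi>) x (u, 0) = mderiv (ext_phase Q) euclid f (\<phi> x) (A u, 0)"
      by (simp add: mderiv_compose[OF ch ch charted_euclid \<phi> f] B)
    then show "om (A (fst (hamiltonian_vf Q (f \<circ> \<phi>) x))) v = om (fst (hamiltonian_vf Q f (\<phi> x))) v"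
      unfolding v A hamiltonian_vf_om[OF f] hamiltonian_vf_om[OF f\<phi>] .
  qed
  have "poisson0 Q (f \<circ> \<phi>) (g \<circ> \<phi>) x = om (A (fst (hamiltonian_vf Q (f \<circ> \<phi>) x))) (A (fst (hamiltonian_vf Q (g \<circ> \<phi>) x)))"
    unfolding A by (simp add: poisson0_def omega0_eq)
  then show "poisson0 Q (f \<circ> \<phi>) (g \<circ> \<phi>) x = (poisson0 Q f g \<circ> \<phi>) x"
    by (simp add: *[OF f] *[OF g] poisson0_def omega0_eq)
qed

end

section \<open>Projection of symplectic maps to the extended phase space\<close>

context
  fixes Q :: "('q, 'a::euclidean_space) mfd"
  assumes Q: "smooth_atlas Q"
begin

lemma smooth_map_pt_curve: "smooth_map euclid (cotangent (time_ext Q)) (\<lambda>s. insert_pt s x)"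
  unfolding smooth_map_on_def
proof (intro conjI ballI)
  show "mopen (euclid :: (real, real) mfd) UNIV" by (simp add: mopen_def)
  fix c :: "(real, real) chart" and C assume "c \<in> atlas euclid" "C \<in> atlas (cotangent (time_ext Q))"
  then obtain d where c: "c = (UNIV, id)" and C: "C = cotangent_chart (time_ext Q) (time_chart d)" and d: "d \<in> atlas Q"
    by (auto simp: atlas_time_ext atlas_cotangent)
  let ?y = "snd (prod_chart (cotangent_chart Q d) (UNIV, id)) x"
  have "smooth_on (if fst (fst x) \<in> fst d then UNIV else {}) (\<lambda>s::real. insert_pt 0 ?y + ((0, 0), (0, s)))"
    by (intro smooth_on_add smooth_on_Pair smooth_on_const smooth_on_linear[OF bounded_linear_ident]) auto
  moreover have "snd c ` (fst c \<inter> UNIV \<inter> (\<lambda>s. insert_pt s x) -` fst C) = (if fst (fst x) \<in> fst d then UNIV else {})"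
    by (simp add: c C vimage_def mem_Times_iff)
  moreover have "insert_pt 0 ?y + ((0, 0), (0, s)) = snd C (insert_pt s x)" if "fst (fst x) \<in> fst d" for s
    using cotangent_time_chart[OF Q d that, of "snd x" "snd (fst x)" s] insert_pt_eq[of s ?y]
    by (cases x) (auto simp: C simp del: snd_prod_chart)
  ultimately show "smooth_on (snd c ` (fst c \<inter> UNIV \<inter> (\<lambda>s. insert_pt s x) -` fst C))
      (snd C \<circ> (\<lambda>s. insert_pt s x) \<circ> chart_inv c)"
    by (auto simp: c comp_def split: if_splits elim!: smooth_on_cong[rotated])
qed

lemma mderiv_pt_curve: "mderiv euclid (cotangent (time_ext Q)) (\<lambda>s. insert_pt s x) s = (\<lambda>r. ((0, 0), (0, r)))"
proof (rule mderiv_eqI[OF charted_euclid])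
  let ?c = "chart_at Q (fst (fst x))"
  let ?y = "snd (prod_chart (cotangent_chart Q ?c) (UNIV, id)) x"
  have c: "?c \<in> atlas Q" "fst (fst x) \<in> fst ?c"
    using charted_Q[OF Q] by (simp_all add: chart_at_atlas chart_at_mem)
  show "((\<lambda>s. insert_pt 0 ?y + ((0, 0), (0, s))) has_derivative (\<lambda>r. ((0, 0), (0, r)))) (at (snd (chart_at euclid s) s))"
    by (auto intro!: derivative_eq_intros simp: zero_prod_def)
  show "snd (chart_at (cotangent (time_ext Q)) (insert_pt s x)) (insert_pt s' x)
    = insert_pt 0 ?y + ((0, 0), (0, snd (chart_at euclid s) s'))" for s'
    using cotangent_time_chart[OF Q c, of "snd x" "snd (fst x)" s'] insert_pt_eq[of s' ?y]
    by (cases x) (auto simp del: snd_prod_chart)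
qed

end

text \<open>Isolates what the statements about \<open>\<phi>\<close> take from
  \<open>\<Psi>\<close>: symplecticity and compatibility with \<open>forget_pt\<close>. The
  discretization returns only through the time step.\<close>

locale projected_flow =
  fixes Q :: "('q, 'a::euclidean_space) mfd"
    and \<Psi> :: "('q \<times> real) \<times> ('a \<times> real) \<Rightarrow> ('q \<times> real) \<times> ('a \<times> real)"
    and \<phi> :: "('q \<times> 'a) \<times> real \<Rightarrow> ('q \<times> 'a) \<times> real"
  assumes Q: "smooth_atlas Q"
    and \<Psi>: "smooth_map (cotangent (time_ext Q)) (cotangent (time_ext Q)) \<Psi>"
    and symplectic: "form_eq 2 (pullback (cotangent (time_ext Q)) (cotangent (time_ext Q)) \<Psi> omega_can) omega_can"
    and proj: "forget_pt \<circ> \<Psi> = \<phi> \<circ> forget_pt"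
begin

abbreviation "CM \<equiv> cotangent (time_ext Q)"
abbreviation "EP \<equiv> ext_phase Q"

lemmas cCM = charted_cotangent_time_ext[OF Q]
lemmas cEP = charted_ext_phase[OF Q]
lemmas cCQ = charted_cotangent_Q[OF Q]
lemmas forget = smooth_map_forget_pt[OF Q]
lemmas insert = smooth_map_insert_pt[OF Q]

lemma smooth_map_comp:
  "charted A \<Longrightarrow> charted B \<Longrightarrow> smooth_map A B f \<Longrightarrow> smooth_map B C g \<Longrightarrow> smooth_map A C (g \<circ> f)"
  by (rule smooth_map_on_compose) auto

lemma mderiv_comp:
  "charted A \<Longrightarrow> charted B \<Longrightarrow> charted C \<Longrightarrow> smooth_map A B f \<Longrightarrow> smooth_map B C g \<Longrightarrow>
    mderiv A C (g \<circ> f) x v = mderiv B C g (f x) (mderiv A B f x v)"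
  by (simp add: mderiv_compose)

abbreviation "D\<Psi> \<equiv> mderiv CM CM \<Psi>"
abbreviation "D\<phi> \<equiv> mderiv EP EP \<phi>"

lemma proj_apply: "\<phi> (forget_pt z) = forget_pt (\<Psi> z)"
  using proj by (metis comp_apply)

lemma \<phi>_eq: "\<phi> = forget_pt \<circ> \<Psi> \<circ> insert_pt 0"
  by (simp add: fun_eq_iff proj_apply[symmetric])

lemma smooth_\<phi>: "smooth_map EP EP \<phi>"
  unfolding \<phi>_eq comp_assoc
  by (intro smooth_map_comp[OF cEP cCM _ forget] smooth_map_comp[OF cEP cCM insert \<Psi>])

lemma linear_D\<phi>: "linear (D\<phi> x)"
  by (rule linear_mderiv[OF smooth_\<phi> cEP cEP]) simp

lemma D\<phi>_forget: "D\<phi> (forget_pt z) (forget_pt v) = forget_pt (D\<Psi> z v)"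
  using mderiv_comp[OF cCM cCM cEP \<Psi> forget, of z v] mderiv_comp[OF cCM cEP cEP forget smooth_\<phi>, of z v]
  by (simp add: proj mderiv_forget_pt[OF Q])

lemma D\<Psi>_symplectic:
  "fst (D\<Psi> z u) \<bullet> snd (D\<Psi> z v) - fst (D\<Psi> z v) \<bullet> snd (D\<Psi> z u) = fst u \<bullet> snd v - fst v \<bullet> snd u"
  using symplectic[unfolded form_eq_def, rule_format, of "[u, v]" z] by (simp add: pullback_def omega_can_def)

definition fibre_rate :: "('q \<times> real) \<times> ('a \<times> real) \<Rightarrow> real" where
  "fibre_rate z = snd (snd (D\<Psi> z ((0, 0), (0, 1))))"

text \<open>\<open>forget_pt\<close> annihilates the fibre direction, and
  \<open>D\<phi>_forget\<close> passes this on to its image, which therefore points along the fibre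
  again.\<close>

lemma D\<Psi>_fibre: "D\<Psi> z ((0, 0), (0, 1)) = ((0, 0), (0, fibre_rate z))"
proof -
  have "forget_pt (D\<Psi> z ((0, 0), (0, 1))) = 0"
    using D\<phi>_forget[of z "((0, 0), (0, 1))"] linear_0[OF linear_D\<phi>, of "forget_pt z"]
    by (simp add: zero_prod_def)
  then show ?thesis
    using insert_forget_pt[of "D\<Psi> z ((0, 0), (0, 1))"] by (simp add: fibre_rate_def zero_prod_def)
qed

text \<open>Under the canonical form the fibre direction picks out minus the time component of the
  other vector. Comparing this before and after \<open>D\<Psi>\<close> gives the relation between
  old and new time.\<close>

lemma D\<phi>_time: "fibre_rate (insert_pt s x) * snd (D\<phi> x w) = snd w"
proof -
  let ?z = "insert_pt s x"
  have "snd (D\<phi> x w) = snd (fst (D\<Psi> ?z (insert_pt 0 w)))"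
    using D\<phi>_forget[of ?z "insert_pt 0 w"] by simp
  moreover have "snd (fst (insert_pt 0 w)) = snd w" by (metis forget_insert_pt snd_forget_pt)
  ultimately show ?thesis
    using D\<Psi>_symplectic[of ?z "((0, 0), (0, 1))" "insert_pt 0 w"]
    by (simp add: D\<Psi>_fibre inner_prod_def mult.commute)
qed

lemma fibre_rate_nz: "fibre_rate (insert_pt s x) \<noteq> 0"
  using D\<phi>_time[of s x "(0, 1)"] by auto

lemma D\<phi>_slice: "snd (D\<phi> x (u, 0)) = 0"
  using D\<phi>_time[of 0 x "(u, 0)"] fibre_rate_nz by simp

lemma D\<phi>_time_nz: "snd (D\<phi> x (0, 1)) \<noteq> 0"
  using D\<phi>_time[of 0 x "(0, 1)"] by auto

text \<open>Since \<open>s\<close> does not occur on the right, the stretching is constant along a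
  fibre, so that \<open>\<Psi>\<close> is affine there.\<close>

lemma fibre_rate_eq: "fibre_rate (insert_pt s x) = 1 / snd (D\<phi> x (0, 1))"
  using D\<phi>_time[of s x "(0, 1)"] D\<phi>_time_nz[of x] by (simp add: field_simps)

text \<open>Lift the slice vectors with zero \<open>p\<^sub>t\<close> component. Neither the lifts
  nor their images have a time component, so the \<open>dt \<and> dp\<^sub>t\<close> part of the
  canonical form contributes nothing.\<close>

lemma D\<phi>_slice_symplectic: "om (fst (D\<phi> x (u, 0))) (fst (D\<phi> x (w, 0))) = om u w"
proof -
  let ?z = "insert_pt 0 x"
  have D: "forget_pt (D\<Psi> ?z (insert_pt 0 (u, 0))) = D\<phi> x (u, 0)" for u
    using D\<phi>_forget[of ?z "insert_pt 0 (u, 0)"] by simp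
  have eq: "fst v \<bullet> snd w - fst w \<bullet> snd v = om (fst (forget_pt v)) (fst (forget_pt w))"
    if "snd (forget_pt v) = 0" "snd (forget_pt w) = 0" for v w :: "('a \<times> real) \<times> ('a \<times> real)"
    using that by (cases v; cases w) (auto simp: inner_prod_def forget_pt_def split: prod.splits)
  show ?thesis
    using D\<Psi>_symplectic[of ?z "insert_pt 0 (u, 0)" "insert_pt 0 (w, 0)"] by (simp add: eq D D\<phi>_slice)
qed

lemma symplectic_map_slice: "symplectic_map Q (fst \<circ> \<phi> \<circ> (\<lambda>z. (z, t)))"
proof -
  note sl = smooth_map_slice[OF Q, of t] and fs = smooth_map_fst[OF Q]
  note \<phi>sl = smooth_map_comp[OF cCQ cEP sl smooth_\<phi>]
  have sm: "smooth_map (cotangent Q) (cotangent Q) (fst \<circ> (\<phi> \<circ> (\<lambda>z. (z, t))))"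
    by (rule smooth_map_comp[OF cCQ cEP \<phi>sl fs])
  have D: "mderiv (cotangent Q) (cotangent Q) (fst \<circ> (\<phi> \<circ> (\<lambda>z. (z, t)))) z u = fst (D\<phi> (z, t) (u, 0))" for z u
    by (subst mderiv_comp[OF cCQ cEP cCQ \<phi>sl fs], subst mderiv_comp[OF cCQ cEP cEP sl smooth_\<phi>])
       (simp add: mderiv_fst_ext_phase[OF Q] mderiv_slice[OF Q])
  have "form_eq 2 (pullback (cotangent Q) (cotangent Q) (fst \<circ> (\<phi> \<circ> (\<lambda>z. (z, t)))) omega_can) omega_can"
    unfolding form_eq_def
  proof (intro allI impI)
    fix z :: "'q \<times> 'a" and vs :: "('a \<times> 'a) list" assume "length vs = 2"
    then obtain u w where "vs = [u, w]" by (auto simp: length_Suc_conv numeral_2_eq_2)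
    then show "pullback (cotangent Q) (cotangent Q) (fst \<circ> (\<phi> \<circ> (\<lambda>z. (z, t)))) omega_can z vs = omega_can z vs"
      using D\<phi>_slice_symplectic[of "(z, t)" u w] by (simp add: pullback_def omega_can_def D)
  qed
  then show ?thesis using sm by (simp add: symplectic_map_def comp_assoc)
qed

lemma poisson_preserved:
  "smooth_map EP euclid f \<Longrightarrow> smooth_map EP euclid g \<Longrightarrow> poisson0 Q (f \<circ> \<phi>) (g \<circ> \<phi>) = poisson0 Q f g \<circ> \<phi>"
  by (rule poisson0_preserved[OF Q smooth_\<phi> D\<phi>_slice D\<phi>_slice_symplectic])

lemma volume_preserved:
  assumes step: "\<And>x. snd (\<phi> x) = snd x + h"
  shows "form_eq (2 * DIM('a) + 1) (pullback EP EP \<phi> (vol0 Q)) (vol0 Q)"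
  unfolding form_eq_def pullback_def
proof (intro allI impI)
  fix x and vs :: "(('a \<times> 'a) \<times> real) list" assume vs: "length vs = 2 * DIM('a) + 1"
  have "mderiv EP euclid (snd \<circ> \<phi>) x = snd"
    by (rule mderiv_eqI[OF cEP, where S="\<lambda>v. snd v + h"]) (auto intro!: derivative_eq_intros simp: step)
  then have "snd (D\<phi> x v) = snd v" for v
    using mderiv_comp[OF cEP cEP charted_euclid smooth_\<phi> smooth_map_snd[OF Q], of x v]
    by (simp add: mderiv_snd_ext_phase[OF Q])
  then show "vol0 Q (\<phi> x) (map (D\<phi> x) vs) = vol0 Q x vs"
    by (rule vol0_preserved[OF Q linear_D\<phi> _ D\<phi>_slice_symplectic vs])
qed

text \<open>Along the fibre over \<open>x\<close> the \<open>p\<^sub>t\<close> component of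
  \<open>\<Psi>\<close> has the constant nonzero derivative \<open>m\<close>, hence takes every
  value.\<close>

lemma fibre_surj: "\<exists>s. \<Psi> (insert_pt s x) = insert_pt r (\<phi> x)"
proof -
  let ?k = "\<lambda>s. snd (snd (\<Psi> (insert_pt s x)))"
  define m where "m = 1 / snd (D\<phi> x (0, 1))"
  have m: "m \<noteq> 0" using D\<phi>_time_nz by (simp add: m_def)
  note cv = smooth_map_pt_curve[OF Q, of x] and pt = smooth_map_pt[OF Q]
  note \<Psi>cv = smooth_map_comp[OF charted_euclid cCM cv \<Psi>]
  let ?K = "(\<lambda>z. snd (snd z)) \<circ> (\<Psi> \<circ> (\<lambda>s. insert_pt s x))"
  have "mderiv euclid euclid ?K s 1 = m" for s
    by (subst mderiv_comp[OF charted_euclid cCM charted_euclid \<Psi>cv pt],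
        subst mderiv_comp[OF charted_euclid cCM cCM cv \<Psi>])
       (simp add: mderiv_pt[OF Q] mderiv_pt_curve[OF Q] D\<Psi>_fibre m_def fibre_rate_eq)
  then have "(?K has_real_derivative m) (at s)" for s
    using DERIV_mderiv[OF smooth_map_comp[OF charted_euclid cCM \<Psi>cv pt], of s] by simp
  then have K: "(?k has_real_derivative m) (at s)" for s by (simp add: comp_def)
  have "((\<lambda>s. ?k s - m * s) has_real_derivative 0) (at s)" for s
    using DERIV_diff[OF K[of s] DERIV_cmult_Id[of m s]] by simp
  then have "?k s - m * s = ?k 0 - m * 0" for s
    using DERIV_isconst_all[of "\<lambda>s. ?k s - m * s" s 0] by blast
  from this[of "(r - ?k 0) / m"] have "?k ((r - ?k 0) / m) = r" using m by simp
  then have "\<Psi> (insert_pt ((r - ?k 0) / m) x) = insert_pt r (\<phi> x)"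
    using insert_forget_pt[of "\<Psi> (insert_pt ((r - ?k 0) / m) x)"] proj_apply[of "insert_pt ((r - ?k 0) / m) x"] by simp
  then show ?thesis by blast
qed

section \<open>Inverting the projected map and its slices\<close>

context
  assumes \<Psi>_diffeo: "diffeomorphism CM CM \<Psi>"
begin

lemma bij_\<Psi>: "bij \<Psi>" using \<Psi>_diffeo by (simp add: diffeomorphism_def)

text \<open>Two points with the same image have fibres mapped into one common fibre, and by
  \<open>fibre_surj\<close> the fibre of the first already fills it. Injectivity of
  \<open>\<Psi>\<close> then identifies the points.\<close>

lemma inj_\<phi>: "inj \<phi>"
proof (rule injI)
  fix x y assume "\<phi> x = \<phi> y"
  then have "forget_pt (\<Psi> (insert_pt 0 y)) = \<phi> x" using proj_apply[of "insert_pt 0 y"] by simp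
  then have "\<Psi> (insert_pt 0 y) = insert_pt (snd (snd (\<Psi> (insert_pt 0 y)))) (\<phi> x)"
    using insert_forget_pt by metis
  then obtain s where "\<Psi> (insert_pt s x) = \<Psi> (insert_pt 0 y)" using fibre_surj by metis
  then have "insert_pt s x = insert_pt 0 y" using bij_\<Psi> by (simp add: bij_def inj_eq)
  then show "x = y" by (metis forget_insert_pt)
qed

text \<open>The inverse of \<open>\<phi>\<close>, written through \<open>inv \<Psi>\<close> because
  smoothness is evident in this form; the 0 is an arbitrary choice of
  \<open>p\<^sub>t\<close>.\<close>

definition G :: "('q \<times> 'a) \<times> real \<Rightarrow> ('q \<times> 'a) \<times> real" where
  "G = forget_pt \<circ> (inv \<Psi> \<circ> insert_pt 0)"

lemma \<phi>_G: "\<phi> (G w) = w"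
  using bij_\<Psi> by (simp add: G_def proj_apply bij_is_surj surj_f_inv_f)

lemma G_\<phi>: "G (\<phi> x) = x"
  using inj_\<phi> \<phi>_G by (metis injD)

lemma smooth_G: "smooth_map EP EP G"
  unfolding G_def
  by (intro smooth_map_comp[OF cEP cCM _ forget] smooth_map_comp[OF cEP cCM insert])
     (use \<Psi>_diffeo in \<open>simp add: diffeomorphism_def\<close>)

text \<open>With \<open>\<tau>\<close> frozen the curve stays inside one time slice, where the new
  time has zero derivative. Following a curve avoids any assumption that slices are
  connected.\<close>

lemma new_time_const: "snd (\<phi> (fst (G (w, s)), \<tau>)) = snd (\<phi> (fst (G (w, 0)), \<tau>))"
proof -
  note cv = smooth_map_time_curve[OF Q, of w]
  note g1 = smooth_map_comp[OF charted_euclid cEP cv smooth_G]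
  note g2 = smooth_map_comp[OF charted_euclid cEP g1 smooth_map_fst[OF Q]]
  note g3 = smooth_map_comp[OF charted_euclid cCQ g2 smooth_map_slice[OF Q, of \<tau>]]
  note g4 = smooth_map_comp[OF charted_euclid cEP g3 smooth_\<phi>]
  note g5 = smooth_map_comp[OF charted_euclid cEP g4 smooth_map_snd[OF Q]]
  let ?F = "snd \<circ> (\<phi> \<circ> ((\<lambda>z. (z, \<tau>)) \<circ> (fst \<circ> (G \<circ> (\<lambda>s. (w, s))))))"
  have "mderiv euclid euclid ?F s 1 = 0" for s
    by (subst mderiv_comp[OF charted_euclid cEP charted_euclid g4 smooth_map_snd[OF Q]],
        subst mderiv_comp[OF charted_euclid cEP cEP g3 smooth_\<phi>],
        subst mderiv_comp[OF charted_euclid cCQ cEP g2 smooth_map_slice[OF Q]])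
       (simp add: mderiv_snd_ext_phase[OF Q] mderiv_slice[OF Q] D\<phi>_slice)
  then have "(?F has_real_derivative 0) (at s)" for s using DERIV_mderiv[OF g5, of s] by simp
  then have "?F s = ?F 0" using DERIV_isconst_all by blast
  then show ?thesis by simp
qed

text \<open>The derivative in time never vanishes, so equal values at two times would contradict the
  mean value theorem.\<close>

lemma new_time_inj:
  assumes "snd (\<phi> (z, \<tau>)) = snd (\<phi> (z, \<tau>'))" shows "\<tau> = \<tau>'"
proof -
  have D: "((\<lambda>\<tau>. (snd \<circ> \<phi>) (z, \<tau>)) has_real_derivative snd (D\<phi> (z, \<tau>) (0, 1))) (at \<tau>)" for \<tau>
    using time_derivative[OF Q smooth_map_comp[OF cEP cEP smooth_\<phi> smooth_map_snd[OF Q]], of z \<tau>]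
    by (simp add: mderiv_comp[OF cEP cEP charted_euclid smooth_\<phi> smooth_map_snd[OF Q]] mderiv_snd_ext_phase[OF Q])
  have False if "a < b" "snd (\<phi> (z, a)) = snd (\<phi> (z, b))" for a b
  proof -
    obtain c where "(snd \<circ> \<phi>) (z, b) - (snd \<circ> \<phi>) (z, a) = (b - a) * snd (D\<phi> (z, c) (0, 1))"
      using MVT2[OF \<open>a < b\<close>, of "\<lambda>\<tau>. (snd \<circ> \<phi>) (z, \<tau>)" "\<lambda>\<tau>. snd (D\<phi> (z, \<tau>) (0, 1))"] D by blast
    then show False using that D\<phi>_time_nz[of "(z, c)"] by simp
  qed
  then show ?thesis using assms by (metis linorder_neqE)
qed

text \<open>With \<open>\<tau>\<close> the old time of \<open>G (w, s)\<close>, the left side of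
  \<open>new_time_const\<close> is the time component of \<open>\<phi> (G (w, s)) = (w, s)\<close>.
  The correspondence of times along \<open>G\<close> thus becomes visible over one spatial
  point.\<close>

lemma new_time_G: "snd (\<phi> (fst (G (w, 0)), snd (G (w, s)))) = s"
  using new_time_const[of w s "snd (G (w, s))"] \<phi>_G[of "(w, s)"] by simp

text \<open>The slice at time \<open>t\<close> is inverted by going back from the time to which \<open>\<phi>\<close> moves it.\<close>

lemma symplectomorphism_slice: "symplectomorphism Q (fst \<circ> \<phi> \<circ> (\<lambda>z. (z, t)))"
proof -
  let ?f = "fst \<circ> \<phi> \<circ> (\<lambda>z. (z, t))"
  \<comment> \<open>The new time of the slice at \<open>t\<close>. It ought to be evaluated at the
    unknown preimage of \<open>w\<close>; \<open>new_time_const\<close> permits the known point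
    \<open>fst (G (w, 0))\<close> instead.\<close>
  define a where "a = snd \<circ> (\<phi> \<circ> ((\<lambda>z. (z, t)) \<circ> (fst \<circ> (G \<circ> (\<lambda>w. (w, 0))))))"
  define k where "k = fst \<circ> (G \<circ> (\<lambda>w. (w, a w)))"
  have f_k: "?f (k w) = w" for w
  proof -
    have "snd (\<phi> (fst (G (w, 0)), snd (G (w, a w)))) = snd (\<phi> (fst (G (w, 0)), t))"
      using new_time_G[of w "a w"] by (simp add: a_def)
    then have "snd (G (w, a w)) = t" by (rule new_time_inj)
    then have "(k w, t) = G (w, a w)" by (simp add: k_def prod_eq_iff)
    then show ?thesis by (simp add: \<phi>_G)
  qed
  have k_f: "k (?f z) = z" for z
  proof -
    define w s where "w = fst (\<phi> (z, t))" and "s = snd (\<phi> (z, t))"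
    have G: "G (w, s) = (z, t)" by (simp add: w_def s_def G_\<phi>)
    have "a w = s" using new_time_G[of w s] by (simp add: a_def G)
    then show ?thesis using G by (simp add: k_def w_def)
  qed
  have sm: "symplectic_map Q ?f" by (rule symplectic_map_slice)
  have "bij ?f" 
    by (rule bijI[OF inj_on_inverseI[of UNIV k] surjI[of _ k]]) (simp_all only: f_k k_f)
  moreover have "inv ?f = k" by (rule inv_equality) (simp_all only: f_k k_f)
  moreover have "smooth_map (cotangent Q) (cotangent Q) k"
  proof -
    note sl = smooth_map_slice[OF Q] and fs = smooth_map_fst[OF Q]
    have "smooth_map (cotangent Q) euclid a"
      unfolding a_def
      by (intro smooth_map_comp[OF cCQ cEP _ smooth_map_snd[OF Q]] smooth_map_comp[OF cCQ cEP _ smooth_\<phi>]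
          smooth_map_comp[OF cCQ cCQ _ sl] smooth_map_comp[OF cCQ cEP _ fs] smooth_map_comp[OF cCQ cEP sl smooth_G])
    then have "smooth_map (cotangent Q) EP (\<lambda>w. (id w, a w))"
      by (rule smooth_map_on_Pair[OF cCQ smooth_map_id[OF smooth_atlas_cotangent[OF Q]]])
    then show ?thesis
      unfolding k_def
      by (intro smooth_map_comp[OF cCQ cEP _ fs] smooth_map_comp[OF cCQ cEP _ smooth_G]) simp
  qed
  ultimately show ?thesis
    using sm by (simp add: symplectomorphism_def diffeomorphism_def symplectic_map_def)
qed

end

end

section \<open>The time velocity and the conclusion\<close>

lemma mderiv_add_real:
  assumes M: "charted M" and f: "smooth_map M euclid f" and g: "smooth_map M euclid g"
  shows "mderiv M euclid (\<lambda>x. f x + g x :: real) x v = mderiv M euclid f x v + mderiv M euclid g x v"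
proof -
  let ?c = "chart_at M x"
  have "((\<lambda>y. f (chart_inv ?c y) + g (chart_inv ?c y)) has_derivative
      (\<lambda>v. mderiv M euclid f x v + mderiv M euclid g x v)) (at (snd ?c x))"
    using mderiv_has_derivative[OF f M charted_euclid, of x] mderiv_has_derivative[OF g M charted_euclid, of x]
    by (intro has_derivative_add) (simp_all add: comp_def)
  from frechet_derivative_at[OF this]
  have "mderiv M euclid (\<lambda>x. f x + g x) x = (\<lambda>v. mderiv M euclid f x v + mderiv M euclid g x v)"
    by (simp add: mderiv_def[of M euclid "\<lambda>x. f x + g x"] comp_def)
  then show ?thesis by simp
qed

text \<open>\<open>forget_pt\<close> kills the direction of \<open>p\<^sub>t\<close>, so only the
  summand \<open>p\<^sub>t\<close> of \<open>H_tilde\<close> contributes. This value makes the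
  generating time velocity equal to \<open>h\<close>.\<close>

lemma H_tilde_derivative_pt:
  fixes H :: "('q \<times> 'a::euclidean_space) \<times> real \<Rightarrow> real"
  assumes Q: "smooth_atlas Q" and H: "smooth_map (ext_phase Q) euclid H"
  shows "mderiv (cotangent (time_ext Q)) euclid (H_tilde H) z ((0, 0), (0, 1)) = 1"
proof -
  note ch = charted_cotangent_time_ext[OF Q] charted_ext_phase[OF Q]
  have Hf: "smooth_map (cotangent (time_ext Q)) euclid (H \<circ> forget_pt)"
    by (rule smooth_map_on_compose[OF ch smooth_map_forget_pt[OF Q] H]) simp
  have lin: "linear (mderiv (ext_phase Q) euclid H (forget_pt z))"
    by (rule linear_mderiv[OF H ch(2) charted_euclid]) simp
  have "mderiv (cotangent (time_ext Q)) euclid (H \<circ> forget_pt) z ((0, 0), (0, 1)) = 0"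
    using linear_0[OF lin] by (simp add: mderiv_compose[OF ch charted_euclid smooth_map_forget_pt[OF Q] H]
        mderiv_forget_pt[OF Q] zero_prod_def)
  then show ?thesis
    using mderiv_add_real[OF ch(1) Hf smooth_map_pt[OF Q], of z "((0, 0), (0, 1))"]
    by (simp add: H_tilde_def[abs_def] mderiv_pt[OF Q])
qed

text \<open>A discretization map is constrained only to first order at the zero section, so the
  times in \<open>RR (t, h)\<close> need not differ by \<open>h\<close>. If their difference varies
  with \<open>t\<close>, then \<open>\<phi>\<close> in general stretches time and volume; hence the
  clause on \<open>is_time_step\<close>. A smooth \<open>\<Psi>\<close> with the given graph does
  not by itself come with a global inverse, hence the clause on diffeomorphic
  \<open>\<Psi>\<close>.\<close>

theorem corollary1:
  fixes Q :: "('q, 'a::euclidean_space) mfd"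
    and H :: "('q \<times> 'a) \<times> real \<Rightarrow> real"
    and UQ :: "('q \<times> 'a) set" and RQ :: "'q \<times> 'a \<Rightarrow> 'q \<times> 'q"
    and UR :: "(real \<times> real) set" and RR :: "real \<times> real \<Rightarrow> real \<times> real"
    and h :: real
    and \<Psi> :: "('q \<times> real) \<times> ('a \<times> real) \<Rightarrow> ('q \<times> real) \<times> ('a \<times> real)"
    and \<phi> :: "('q \<times> 'a) \<times> real \<Rightarrow> ('q \<times> 'a) \<times> real"
  defines "M \<equiv> Q \<times>\<^sub>M (euclid :: (real, real) mfd)"
  assumes "smooth_manifold Q"
    and "smooth_map (ext_phase Q) euclid H"
    and "discretization_map Q UQ RQ" "diffeo_onto_image (tangent Q) (Q \<times>\<^sub>M Q) UQ RQ"
    and "discretization_map euclid UR RR" "diffeo_onto_image (tangent euclid) (euclid \<times>\<^sub>M euclid) UR RR"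
    and "smooth_map (cotangent M) (cotangent M) \<Psi>"
    and "{(z, \<Psi> z) | z. True} =
         discrete_relation M (prod_domain UQ UR) (prod_discretization RQ RR) h (H_tilde H)"
    and "forget_pt \<circ> \<Psi> = \<phi> \<circ> forget_pt"
  shows "(is_time_step UR RR h \<longrightarrow>
            form_eq (2 * DIM('a) + 1) (pullback (ext_phase Q) (ext_phase Q) \<phi> (vol0 Q)) (vol0 Q)) \<and>
         (\<forall>f g. smooth_map (ext_phase Q) euclid f \<and> smooth_map (ext_phase Q) euclid g \<longrightarrow>
            poisson0 Q (f \<circ> \<phi>) (g \<circ> \<phi>) = poisson0 Q f g \<circ> \<phi>) \<and>
         (\<forall>t. symplectic_map Q (fst \<circ> \<phi> \<circ> (\<lambda>z. (z, t))) \<and>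
            (diffeomorphism (cotangent M) (cotangent M) \<Psi> \<longrightarrow>
               symplectomorphism Q (fst \<circ> \<phi> \<circ> (\<lambda>z. (z, t)))))"
proof -
  have Q: "smooth_atlas Q" using assms(2) by (rule smooth_manifold_imp_smooth_atlas)
  interpret discrete_flow M "prod_domain UQ UR" "prod_discretization RQ RR" h "H_tilde H" \<Psi>
  proof
    show "smooth_atlas M" unfolding M_def by (rule smooth_atlas_time_ext[OF Q])
    show "diffeo_onto_image (tangent M) (M \<times>\<^sub>M M) (prod_domain UQ UR) (prod_discretization RQ RR)"
      unfolding M_def by (rule diffeo_prod_discretization[OF Q assms(5,7)])
    show "smooth_map (cotangent M) euclid (H_tilde H)"
      unfolding M_def by (rule smooth_map_H_tilde[OF Q assms(3)])
    show "smooth_map (cotangent M) (cotangent M) \<Psi>" by fact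
    show "(z, \<Psi> z) \<in> discrete_relation M (prod_domain UQ UR) (prod_discretization RQ RR) h (H_tilde H)" for z
      using assms(9) by blast
  qed
  interpret P: projected_flow Q \<Psi> \<phi>
    using Q assms(8,10) symplectic unfolding M_def by unfold_locales
  have step: "snd (\<phi> x) = snd x + h" if "is_time_step UR RR h" for x
  proof -
    let ?z = "insert_pt 0 x"
    \<comment> \<open>The \<open>p\<^sub>t\<close> component of
      \<open>v = h \<partial>f/\<partial>p\<close>.\<close>
    have v: "snd (gen_velocity ?z) = h"
      using gen_velocity_inner[of ?z "(0, 1)"] H_tilde_derivative_pt[OF Q assms(3)]
      by (simp add: M_def inner_prod_def zero_prod_def)
    obtain q t vq where gp: "gen_point ?z = (q, t)" "gen_velocity ?z = (vq, h)" using v by (metis prod.collapse)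
    have "(t, h) \<in> UR" using gen_exists(1)[of ?z] unfolding gp by (simp add: prod_domain_def)
    then have "snd (RR (t, h)) = fst (RR (t, h)) + h" using that by (simp add: is_time_step_def)
    \<comment> \<open>The time part of the product discretization is \<open>RR\<close> alone, here
      at velocity \<open>h\<close>.\<close>
    moreover have "fst (RR (t, h)) = snd (fst ?z)" "snd (RR (t, h)) = snd (fst (\<Psi> ?z))"
      using gen_exists(2)[of ?z] unfolding gp by (simp_all add: prod_discretization_def prod_eq_iff)
    ultimately have "snd (forget_pt (\<Psi> ?z)) = snd (forget_pt ?z) + h" by simp
    then show ?thesis using P.proj_apply[of ?z] by simp
  qed
  show ?thesis
    using P.volume_preserved[OF step] P.poisson_preserved P.symplectic_map_slice P.symplectomorphism_slice
    unfolding M_def by blast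
qed

end
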